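(* Let $F$ be a field of characteristic two and let $(A,\sigma)$ be a totally decomposable central simple $F$-algebra of degree $2^n$ with orthogonal involution, and let $x\in\mathrm{Sym}(A,\sigma)^+$ with $x^2\notin F^2$. If $\mathfrak i(A,\sigma)=n-1$, then the following are equivalent: (1) there exists a $\sigma$-invariant quaternion subalgebra $Q$ of $A$ containing $x$; (2) there exists an inseparable subalgebra $S$ of $(A,\sigma)$ with $x\in S$.
   Context: Involutions are of the first kind. $(A,\sigma)$ is totally decomposable if $(A,\sigma)\simeq\bigotimes_{i=1}^n(Q_i,\sigma_i)$ with quaternion $F$-algebras with involution $(Q_i,\sigma_i)$. $\mathrm{Sym}(A,\sigma)^+=\{x\in A\mid \sigma(x)=x,\ x^2\in F\}$. A $\sigma$-invariant quaternion subalgebra is an $F$-subalgebra which is a quaternion $F$-algebra and is stable under $\sigma$. An inseparable subalgebra is a $2^n$-dimensional subalgebra $S\subseteq\mathrm{Sym}(A,\sigma)^+$ with $C_A(S)=S$, generated as an $F$-algebra by $n$ elements. Bilinear Pfister form: $\langle\!\langle\alpha_1,\dots,\alpha_n\rangle\!\rangle=\langle1,\alpha_1\rangle\otimes\cdots\otimes\langle1,\alpha_n\rangle$; $\langle\!\langle1\rangle\!\rangle^r$ denotes the $r$-fold form $\langle\!\langle1,\dots,1\rangle\!\rangle$ ($\langle\!\langle1\rangle\!\rangle^0=\langle1\rangle$). The Pfister invariant $\mathfrak{Pf}(A,\sigma)=\langle\!\langle\alpha_1,\dots,\alpha_n\rangle\!\rangle$, where $\alpha_i$ represents $\mathrm{disc}\,\sigma_i\in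 F^\times/F^{\times2}$ (independent of the decomposition up to isometry). Every bilinear Pfister form $\mathfrak b$ is isometric to $\langle\!\langle1\rangle\!\rangle^r\otimes\mathfrak b'$ with $\mathfrak b'$ an anisotropic bilinear Pfister form; this integer $r$ is denoted $\mathfrak i(\mathfrak b)$, and $\mathfrak i(A,\sigma):=\mathfrak i(\mathfrak{Pf}(A,\sigma))$. *)

theory Defs
  imports Complex_Main
begin

text \<open>
  Setting.  The field F is a type 'f (class field).  An F-algebra is a ring 'a (class ring_1)
  together with a ring embedding emb of F into the centre of 'a; scalar multiplication is
  c . x = emb c * x.  Subsets of 'a play the role of subalgebras.
\<close>

definition f_algebra :: "('f::field \<Rightarrow> 'a::ring_1) \<Rightarrow> bool" where
  "f_algebra emb \<longleftrightarrow>
     emb 1 = 1 \<and> (\<forall>c d. emb (c + d) = emb c + emb d) \<and> (\<forall>c d. emb (c * d) = emb c * emb d) \<and>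
     (\<forall>c x. emb c * x = x * emb c)"

abbreviation scal :: "('f::field \<Rightarrow> 'a::ring_1) \<Rightarrow> 'f \<Rightarrow> 'a \<Rightarrow> 'a" where
  "scal emb c x \<equiv> emb c * x"

text \<open>B is an F-subspace of dimension d (finite basis of cardinality d).\<close>
definition has_fdim :: "('f::field \<Rightarrow> 'a::ring_1) \<Rightarrow> 'a set \<Rightarrow> nat \<Rightarrow> bool" where
  "has_fdim emb B d \<longleftrightarrow>
     (\<exists>X. finite X \<and> X \<subseteq> B \<and> module.span (scal emb) X = B \<and>
          \<not> module.dependent (scal emb) X \<and> card X = d)"

text \<open>F-subalgebra (contains F, closed under ring operations).\<close>
definition subalg :: "('f::field \<Rightarrow> 'a::ring_1) \<Rightarrow> 'a set \<Rightarrow> bool" where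
  "subalg emb B \<longleftrightarrow> range emb \<subseteq> B \<and> (\<forall>x\<in>B. -x \<in> B) \<and>
     (\<forall>x\<in>B. \<forall>y\<in>B. x + y \<in> B \<and> x * y \<in> B)"

text \<open>Two-sided ideal of the subalgebra B.\<close>
definition ideal_in :: "'a::ring_1 set \<Rightarrow> 'a set \<Rightarrow> bool" where
  "ideal_in B I \<longleftrightarrow> I \<subseteq> B \<and> 0 \<in> I \<and> (\<forall>x\<in>I. \<forall>y\<in>I. x + y \<in> I \<and> -x \<in> I) \<and>
     (\<forall>b\<in>B. \<forall>x\<in>I. b * x \<in> I \<and> x * b \<in> I)"

definition centralizer :: "'a::ring_1 set \<Rightarrow> 'a set \<Rightarrow> 'a set" where
  "centralizer B S = {y\<in>B. \<forall>s\<in>S. y * s = s * y}"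

text \<open>B is a central simple F-algebra of F-dimension d.\<close>
definition csa :: "('f::field \<Rightarrow> 'a::ring_1) \<Rightarrow> 'a set \<Rightarrow> nat \<Rightarrow> bool" where
  "csa emb B d \<longleftrightarrow> subalg emb B \<and> has_fdim emb B d \<and>
     centralizer B B = range emb \<and> (\<forall>I. ideal_in B I \<longrightarrow> I = {0} \<or> I = B)"

text \<open>Quaternion F-subalgebra: a central simple F-subalgebra of degree 2.\<close>
definition quat_subalg :: "('f::field \<Rightarrow> 'a::ring_1) \<Rightarrow> 'a set \<Rightarrow> bool" where
  "quat_subalg emb Q \<longleftrightarrow> csa emb Q 4"

text \<open>Involution of the first kind on the (whole) algebra.\<close>
definition involution1 :: "('f::field \<Rightarrow> 'a::ring_1) \<Rightarrow> ('a \<Rightarrow> 'a) \<Rightarrow> bool" where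
  "involution1 emb \<sigma> \<longleftrightarrow> (\<forall>x y. \<sigma> (x + y) = \<sigma> x + \<sigma> y) \<and> (\<forall>x y. \<sigma> (x * y) = \<sigma> y * \<sigma> x) \<and>
     (\<forall>x. \<sigma> (\<sigma> x) = x) \<and> (\<forall>c. \<sigma> (emb c) = emb c)"

text \<open>Alternating elements of (B, sigma|B): x - sigma(x), x in B.\<close>
definition Alt :: "'a::ring_1 set \<Rightarrow> ('a \<Rightarrow> 'a) \<Rightarrow> 'a set" where
  "Alt B \<sigma> = {x - \<sigma> x | x. x \<in> B}"

text \<open>In characteristic two an involution of the first kind is orthogonal iff 1 is not
  in Symd = Alt (Knus-Merkurjev-Rost-Tignol, Prop. 2.6).\<close>
definition orthogonal_on :: "'a::ring_1 set \<Rightarrow> ('a \<Rightarrow> 'a) \<Rightarrow> bool" where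
  "orthogonal_on B \<sigma> \<longleftrightarrow> 1 \<notin> Alt B \<sigma>"

definition Sym_plus :: "('f::field \<Rightarrow> 'a::ring_1) \<Rightarrow> ('a \<Rightarrow> 'a) \<Rightarrow> 'a set" where
  "Sym_plus emb \<sigma> = {x. \<sigma> x = x \<and> x * x \<in> range emb}"

text \<open>Reduced norm of an element a of a quaternion subalgebra Q:
  for a in F it is a^2, otherwise the constant term of the (reduced) characteristic
  polynomial X^2 - Trd(a) X + Nrd(a).\<close>
definition quat_nrd :: "('f::field \<Rightarrow> 'a::ring_1) \<Rightarrow> 'a \<Rightarrow> 'f \<Rightarrow> bool" where
  "quat_nrd emb a c \<longleftrightarrow>
     (a \<in> range emb \<and> a * a = emb c) \<or>
     (a \<notin> range emb \<and> (\<exists>t. a * a - emb t * a + emb c = 0))"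

text \<open>alpha represents disc(sigma|Q) in F^x/F^x2 for an orthogonal involution on a quaternion
  algebra Q: disc = (-1)^1 Nrd(a) for an invertible alternating element a (KMRT (7.2)).\<close>
definition disc_rep :: "('f::field \<Rightarrow> 'a::ring_1) \<Rightarrow> 'a set \<Rightarrow> ('a \<Rightarrow> 'a) \<Rightarrow> 'f \<Rightarrow> bool" where
  "disc_rep emb Q \<sigma> \<alpha> \<longleftrightarrow> \<alpha> \<noteq> 0 \<and>
     (\<exists>a\<in>Alt Q \<sigma>. (\<exists>a'\<in>Q. a * a' = 1 \<and> a' * a = 1) \<and> quat_nrd emb a (- \<alpha>))"

text \<open>Internal total decomposition: (A,sigma) = (Q_0,sigma|) \<otimes> ... \<otimes> (Q_{n-1},sigma|) with
  pairwise commuting sigma-invariant quaternion subalgebras whose products span A.\<close>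
definition tot_decomp :: "('f::field \<Rightarrow> 'a::ring_1) \<Rightarrow> ('a \<Rightarrow> 'a) \<Rightarrow> nat \<Rightarrow> (nat \<Rightarrow> 'a set) \<Rightarrow> bool" where
  "tot_decomp emb \<sigma> n Qs \<longleftrightarrow>
     (\<forall>i<n. quat_subalg emb (Qs i) \<and> \<sigma> ` Qs i \<subseteq> Qs i) \<and>
     (\<forall>i<n. \<forall>j<n. i \<noteq> j \<longrightarrow> (\<forall>x\<in>Qs i. \<forall>y\<in>Qs j. x * y = y * x)) \<and>
     module.span (scal emb) {prod_list (map f [0..<n]) | f. \<forall>i<n. f i \<in> Qs i} = UNIV"

definition totally_decomposable :: "('f::field \<Rightarrow> 'a::ring_1) \<Rightarrow> ('a \<Rightarrow> 'a) \<Rightarrow> nat \<Rightarrow> bool" where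
  "totally_decomposable emb \<sigma> n \<longleftrightarrow> (\<exists>Qs. tot_decomp emb \<sigma> n Qs)"

text \<open>Diagonal symmetric bilinear forms <a_0,...,a_{m-1}> as lists; Pfister forms.\<close>
fun pfister :: "'f::field list \<Rightarrow> 'f list" where
  "pfister [] = [1]"
| "pfister (a # as) = pfister as @ map (\<lambda>c. a * c) (pfister as)"

definition isometric :: "'f::field list \<Rightarrow> 'f list \<Rightarrow> bool" where
  "isometric a b \<longleftrightarrow> length a = length b \<and>
     (\<exists>P Q :: nat \<Rightarrow> nat \<Rightarrow> 'f.
        (\<forall>i<length a. \<forall>j<length a.
            (\<Sum>k<length a. P i k * Q k j) = (if i = j then 1 else 0) \<and>
            (\<Sum>k<length a. Q i k * P k j) = (if i = j then 1 else 0)) \<and>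
        (\<forall>j<length a. \<forall>k<length a.
            (\<Sum>i<length a. P i j * a ! i * P i k) = (if j = k then b ! j else 0)))"

definition anisotropic :: "'f::field list \<Rightarrow> bool" where
  "anisotropic a \<longleftrightarrow> (\<forall>x :: nat \<Rightarrow> 'f. (\<Sum>i<length a. a ! i * x i * x i) = 0 \<longrightarrow> (\<forall>i<length a. x i = 0))"

text \<open>i(b) = r for a bilinear n-fold Pfister form b: b = <<1>>^r \<otimes> b' with b' anisotropic Pfister.\<close>
definition pf_index :: "'f::field list \<Rightarrow> nat \<Rightarrow> bool" where
  "pf_index as r \<longleftrightarrow> r \<le> length as \<and>
     (\<exists>bs. length bs = length as - r \<and> anisotropic (pfister bs) \<and>
           isometric (pfister as) (pfister (replicate r 1 @ bs)))"

text \<open>i(A,sigma) = r, computed from some total decomposition (the Pfister invariant does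
  not depend on the decomposition).\<close>
definition alg_pf_index :: "('f::field \<Rightarrow> 'a::ring_1) \<Rightarrow> ('a \<Rightarrow> 'a) \<Rightarrow> nat \<Rightarrow> nat \<Rightarrow> bool" where
  "alg_pf_index emb \<sigma> n r \<longleftrightarrow>
     (\<exists>Qs \<alpha>. tot_decomp emb \<sigma> n Qs \<and> (\<forall>i<n. disc_rep emb (Qs i) \<sigma> (\<alpha> i)) \<and>
            pf_index (map \<alpha> [0..<n]) r)"

definition gen_subalg :: "('f::field \<Rightarrow> 'a::ring_1) \<Rightarrow> 'a set \<Rightarrow> 'a set" where
  "gen_subalg emb X = \<Inter>{B. subalg emb B \<and> X \<subseteq> B}"

text \<open>Inseparable subalgebra of (A,sigma), A of degree 2^n.\<close>
definition insep_subalg :: "('f::field \<Rightarrow> 'a::ring_1) \<Rightarrow> ('a \<Rightarrow> 'a) \<Rightarrow> nat \<Rightarrow> 'a set \<Rightarrow> bool" where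
  "insep_subalg emb \<sigma> n S \<longleftrightarrow> subalg emb S \<and> has_fdim emb S (2 ^ n) \<and>
     S \<subseteq> Sym_plus emb \<sigma> \<and> centralizer UNIV S = S \<and>
     (\<exists>g :: nat \<Rightarrow> 'a. S = gen_subalg emb (g ` {..<n}))"

end

theory Submission
  imports Defs
begin

text \<open>
  Both conditions are equivalent to the statement that x lies in F + Alt(A).  Index n - 1 means that
  (A, sigma) is a matrix algebra with transposition over a quaternion algebra Q0 = [b, a) with
  a not a square; only a symmetric idempotent e with e A e = Q0 e is needed.  Write u for the
  alternating generator of Q0, so that u^2 = a.  Reducing sigma(y) y modulo Alt(A) for y in A e
  shows that x^2 = w^2 with w in F(u).  Let V0 be the space of all y in A e with x y = y w.  On it
  (y, y') \<mapsto> sigma(y) y' is a nondegenerate symmetric bilinear form over F(u) e, and the centralizer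
  of x acts on V0 as the full endomorphism ring.

  If V0 represents a single square class m F(u)^2, then it has a basis Y of vectors with
  sigma(y) y = m e.  The matrix units y m^(-1) sigma(y') commute with x, so their centralizer is an
  invariant quaternion algebra containing x, and an elementary abelian 2-group permuting Y regularly
  spans, together with x, an inseparable subalgebra.

  If x lies in a quaternion subalgebra, then x is in F + Alt(A), and comparing sigma(y) x y with
  sigma(y) y shows that V0 represents one square class.  If x lies in an inseparable subalgebra S,
  let N be the ideal of elements of S with square zero.  For w1, w2 in V0 killed by N the operator
  w1 sigma(w2) centralizes S, hence lies in S and is symmetric, so the vectors killed by N form a
  line; dually V0 / N V0 is a line, and sigma(y) y vanishes on N V0.
\<close>

section \<open>Values of Pfister forms\<close>

text \<open>F(u) is a purely inseparable quadratic field and F(u)^2 = F^2 + a F^2 lies in F. Any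
  symmetric s with s^2 in F has s^2 in this set, so w is simply a square root of x^2, and as x^2 is
  not in F^2, w generates F(u). Hence the centralizer of w in Q0 is F(u); this is why the form takes
  values in F(u) e on V0, although on A e it takes values in Q0 e. Squaring is additive in F(u), and
  y -> sigma(y) y is additive on V0 by symmetry. The vectors whose value lies in a fixed m F(u)^2
  therefore form an F(u)-subspace, so that having one square class is a linear condition, which
  orthogonality can test. Two obstacles shape the rest. A symmetric form in characteristic two can
  be alternating and then has no orthogonal basis; an explicit vector built from v e excludes this
  for V0. And the given decomposition has arbitrary slots: its factors are changed two at a time
  until all but one have a = 1 and b = 0. There \<open>V i\<close> is a symmetric idempotent, and e
  is the product of these.\<close>

lemma isometric_represents:
  fixes a b :: "'f::field list"
  assumes "isometric a b" "j < length a"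
  obtains x y where "b ! j = (\<Sum>i<length a. a ! i * (x i * x i))"
    "a ! j = (\<Sum>i<length a. b ! i * (y i * y i))"
proof -
  let ?n = "length a"
  obtain P Q :: "nat \<Rightarrow> nat \<Rightarrow> 'f" where
    PQ: "\<And>i j. i < ?n \<Longrightarrow> j < ?n \<Longrightarrow> (\<Sum>k<?n. P i k * Q k j) = (if i = j then 1 else 0)"
    and D: "\<And>j k. j < ?n \<Longrightarrow> k < ?n \<Longrightarrow>
      (\<Sum>i<?n. P i j * a ! i * P i k) = (if j = k then b ! j else 0)"
    using assms(1) unfolding isometric_def by blast
  have 1: "b ! j = (\<Sum>i<?n. a ! i * (P i j * P i j))"
    using D[OF assms(2) assms(2)] by (simp add: mult.commute mult.left_commute)
  \<comment> \<open>The inverse matrix reverses the change of basis, diag(a) = Q^T diag(b) Q, and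
    the entry (j, j) is read off. The Kronecker symbol is inserted so that the congruence
    \<open>D\<close> can be substituted.\<close>
  have "(\<Sum>m<?n. b ! m * (Q m j * Q m j)) =
      (\<Sum>m<?n. \<Sum>k<?n. Q m j * (if m = k then b ! m else 0) * Q k j)"
    by (rule sum.cong) (auto simp: if_distrib[of "\<lambda>t. _ * t"] if_distrib[of "\<lambda>t. t * _"]
      mult.commute mult.left_commute cong: if_cong)
  also have "\<dots> = (\<Sum>m<?n. \<Sum>k<?n. Q m j * (\<Sum>i<?n. P i m * a ! i * P i k) * Q k j)"
    by (intro sum.cong refl) (simp add: D)
  also have "\<dots> = (\<Sum>m<?n. \<Sum>k<?n. \<Sum>i<?n. a ! i * (P i m * Q m j) * (P i k * Q k j))"
    by (simp add: sum_distrib_left sum_distrib_right mult.commute mult.left_commute)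
  also have "\<dots> = (\<Sum>m<?n. \<Sum>i<?n. \<Sum>k<?n. a ! i * (P i m * Q m j) * (P i k * Q k j))"
    by (rule sum.cong[OF refl sum.swap])
  also have "\<dots> = (\<Sum>i<?n. \<Sum>m<?n. \<Sum>k<?n. a ! i * (P i m * Q m j) * (P i k * Q k j))"
    by (rule sum.swap)
  also have "\<dots> = (\<Sum>i<?n. a ! i * (\<Sum>m<?n. P i m * Q m j) * (\<Sum>k<?n. P i k * Q k j))"
    by (intro sum.cong refl, unfold mult.assoc sum_product) (simp add: sum_distrib_left mult.assoc)
  also have "\<dots> = (\<Sum>i<?n. a ! i * (if i = j then 1 else 0) * (if i = j then 1 else 0))"
    using assms(2) by (intro sum.cong refl) (simp add: PQ)
  also have "\<dots> = (\<Sum>i<?n. if i = j then a ! j else 0)"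
    by (rule sum.cong) auto
  also have "\<dots> = a ! j" using assms(2) by simp
  finally show thesis using that[OF 1] by metis
qed

lemma one_in_pfister: "1 \<in> set (pfister as)"
  by (induction as) auto

lemma slot_in_pfister: "c \<in> set as \<Longrightarrow> c \<in> set (pfister as)"
proof (induction as)
  case (Cons a as)
  then show ?case using one_in_pfister[of as] by force
qed simp

lemma length_pfister [simp]: "length (pfister as) = 2 ^ length as"
  by (induction as) auto

text \<open>A slot 1 merely doubles the list. This is how the factor <<1>>^r disappears when only
  represented values matter.\<close>

lemma set_pfister_ones: "set (pfister (replicate r 1 @ bs)) = set (pfister bs)"
  by (induction r) auto

lemma set_pfister_squares:
  assumes "\<forall>c\<in>set as. \<exists>d. c = d * (d::'f::field)"
  shows "\<forall>c\<in>set (pfister as). \<exists>d. c = d * d"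
  using assms
proof (induction as)
  case Nil then show ?case by (auto intro: exI[of _ 1])
next
  case (Cons a as)
  obtain d where d: "a = d * d" using Cons.prems by auto
  have IH: "\<forall>c\<in>set (pfister as). \<exists>d. c = d * d"
    by (rule Cons.IH) (use Cons.prems in simp)
  have "\<exists>d. a * c = d * d" if c: "c \<in> set (pfister as)" for c
  proof -
    obtain c' where "c = c' * c'" using bspec[OF IH c] by (elim exE)
    then have "a * c = (d * c') * (d * c')" unfolding d by (simp only: ac_simps)
    then show ?thesis by blast
  qed
  then show ?case using IH by auto
qed

lemma csa_ideal:
  assumes "csa emb B k" "ideal_in B I"
  shows "I = {0} \<or> I = B"
proof -
  have "\<forall>I. ideal_in B I \<longrightarrow> I = {0} \<or> I = B"
    using assms(1) unfolding csa_def by (elim conjE) assumption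
  from mp[OF spec[OF this, of I] assms(2)] show ?thesis .
qed

section \<open>Quaternion algebras in characteristic two\<close>

locale char2_algebra =
  fixes emb :: "'f::field \<Rightarrow> 'a::ring_1" and \<sigma> :: "'a \<Rightarrow> 'a"
  assumes char2: "CHAR('f) = 2"
    and alg: "f_algebra emb"
    and inv: "involution1 emb \<sigma>"
begin

section \<open>Scalars, signs and the involution in characteristic two\<close>

lemma emb_1 [simp]: "emb 1 = 1"
  and emb_add: "emb (c + d) = emb c + emb d"
  and emb_mult: "emb (c * d) = emb c * emb d"
  and emb_comm: "emb c * x = x * emb c"
  using alg unfolding f_algebra_def by blast+

lemma emb_0 [simp]: "emb 0 = 0"
  using emb_add[of 0 0] by simp

lemma emb_left: "y * emb c = emb c * y" "y * (emb c * x) = emb c * (y * x)"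
  by (metis emb_comm mult.assoc)+

lemma emb_mult_assoc: "emb c * (emb d * x) = emb (c * d) * x"
  by (simp add: emb_mult mult.assoc)

text \<open>Instances of emb_left must be supplied for the atoms of a term; the general rules loop.\<close>

lemmas emb_simps = emb_add emb_mult[symmetric] emb_mult_assoc algebra_simps

sublocale vs: vector_space "\<lambda>c. (*) (emb c)"
  by unfold_locales (simp_all add: emb_add emb_mult algebra_simps)

lemma two_f [simp]: "(c::'f) + c = 0"
proof -
  have "of_nat 2 = (0::'f)"
    using char2 by (metis of_nat_CHAR)
  then show ?thesis
    by (metis mult_2 mult_zero_left of_nat_numeral)
qed

lemma two_a [simp]: "(x::'a) + x = 0"
proof -
  have "emb (1 + 1) = 0" by (simp only: two_f emb_0)
  then have "(1::'a) + 1 = 0" by (simp only: emb_add emb_1)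
  then show ?thesis by (metis distrib_right mult_1 mult_zero_left)
qed

lemma two_f' [simp]: "(c::'f) + (c + d) = d" by (simp flip: add.assoc)
lemma two_a' [simp]: "(x::'a) + (x + y) = y" by (simp flip: add.assoc)

lemma minus_f [simp]: "- (c::'f) = c" by (simp add: minus_unique)
lemma minus_a [simp]: "- (x::'a) = x" by (simp add: minus_unique)
lemma diff_f [simp]: "(c::'f) - d = c + d" by (metis diff_conv_add_uminus minus_f)
lemma diff_a [simp]: "(x::'a) - y = x + y" by (metis diff_conv_add_uminus minus_a)

lemma eq_iff_add_f: "(c::'f) = d \<longleftrightarrow> c + d = 0" by (metis diff_f eq_iff_diff_eq_0)
lemma eq_iff_add_a: "(x::'a) = y \<longleftrightarrow> x + y = 0" by (metis diff_a eq_iff_diff_eq_0)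

lemma add0D_f: "(c::'f) + d = 0 \<Longrightarrow> d = c" by (simp add: eq_iff_add_f[of d] add.commute)
lemma add0D: "(x::'a) + y = 0 \<Longrightarrow> y = x" by (simp add: eq_iff_add_a[of y] add.commute)

lemma emb_eq_0 [simp]: "emb c = 0 \<longleftrightarrow> c = 0"
proof
  assume "emb c = 0"
  then have "emb (c * inverse c) = 0" by (simp add: emb_mult)
  then show "c = 0" using right_inverse[of c] by (cases "c = 0") simp_all
qed simp

lemma emb_eq_iff [simp]: "emb c = emb d \<longleftrightarrow> c = d"
  by (metis emb_add emb_eq_0 eq_iff_add_a eq_iff_add_f)

lemma emb_mult_eq_0 [simp]: "emb c * x = 0 \<longleftrightarrow> c = 0 \<or> x = 0"
  by (metis vs.scale_eq_0_iff)

lemma sq_add_f: "((c::'f) + d) * (c + d) = c * c + d * d"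
  by (simp add: algebra_simps)

lemma sq_sum_f: "finite I \<Longrightarrow> (\<Sum>i\<in>I. f i * f i) = (\<Sum>i\<in>I. f i) * (\<Sum>i\<in>I. (f i::'f))"
  by (induction I rule: finite_induct) (simp_all add: algebra_simps)

lemma sq_add_a: "x * y = y * x \<Longrightarrow> (x + y) * (x + y) = x * x + y * (y::'a)"
  by (simp add: algebra_simps)

lemma inv_add: "\<sigma> (x + y) = \<sigma> x + \<sigma> y"
  and inv_mult: "\<sigma> (x * y) = \<sigma> y * \<sigma> x"
  and inv_inv [simp]: "\<sigma> (\<sigma> x) = x"
  and inv_emb [simp]: "\<sigma> (emb c) = emb c"
  using inv unfolding involution1_def by blast+

lemma inv_0 [simp]: "\<sigma> 0 = 0" by (metis emb_0 inv_emb)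
lemma inv_1 [simp]: "\<sigma> 1 = 1" by (metis emb_1 inv_emb)

lemma inv_sum: "\<sigma> (sum f I) = (\<Sum>i\<in>I. \<sigma> (f i))"
  by (induction I rule: infinite_finite_induct) (simp_all add: inv_add)

lemma inv_scale: "\<sigma> (emb c * x) = emb c * \<sigma> x"
  by (simp add: inv_mult emb_comm)

lemma inv_eq_0 [simp]: "\<sigma> x = 0 \<longleftrightarrow> x = 0" by (metis inv_0 inv_inv)

text \<open>The presentation of the quaternion algebra [b, a) in characteristic two. The last
  relation says that conjugation by U moves V to V + 1; a nonzero \<open>a\<close> makes U
  invertible.\<close>

definition quat_pair :: "'f \<Rightarrow> 'f \<Rightarrow> 'a \<Rightarrow> 'a \<Rightarrow> bool" where
  "quat_pair a b U V \<longleftrightarrow> a \<noteq> 0 \<and> U * U = emb a \<and> V * V = V + emb b \<and> V * U = U * V + U"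

definition lin2 :: "'a \<Rightarrow> 'a set" where
  "lin2 U = {emb p + emb q * U | p q. True}"

definition quat :: "'a \<Rightarrow> 'a \<Rightarrow> 'a set" where
  "quat U V = {emb p + emb q * U + emb r * V + emb s * (U * V) | p q r s. True}"

lemma lin2I: "emb p + emb q * U \<in> lin2 U" unfolding lin2_def by blast
lemma quatI: "emb p + emb q * U + emb r * V + emb s * (U * V) \<in> quat U V"
  unfolding quat_def by blast

text \<open>The last three equations repeat the relations with a trailing factor, so that simp can
  bring right-nested products into the order U before V.\<close>

lemma quat_pairD:
  assumes "quat_pair a b U V"
  shows "a \<noteq> 0" "U * U = emb a" "V * V = V + emb b" "V * U = U * V + U"
    "U * (U * x) = emb a * x" "V * (V * x) = V * x + emb b * x" "V * (U * x) = U * (V * x) + U * x"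
  using assms unfolding quat_pair_def by (simp_all flip: mult.assoc add: distrib_right)

lemma lin2_add: "k \<in> lin2 U \<Longrightarrow> l \<in> lin2 U \<Longrightarrow> k + l \<in> lin2 U"
proof -
  assume "k \<in> lin2 U" "l \<in> lin2 U"
  then obtain p q p' q' where "k = emb p + emb q * U" "l = emb p' + emb q' * U"
    unfolding lin2_def by blast
  then have "k + l = emb (p + p') + emb (q + q') * U" by (simp add: emb_simps)
  then show ?thesis using lin2I by metis
qed

lemma lin2_scale: "k \<in> lin2 U \<Longrightarrow> emb c * k \<in> lin2 U"
proof -
  assume "k \<in> lin2 U"
  then obtain p q where "k = emb p + emb q * U" unfolding lin2_def by blast
  then have "emb c * k = emb (c * p) + emb (c * q) * U" by (simp add: emb_simps)
  then show ?thesis using lin2I by metis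
qed

lemma lin2_emb [simp]: "emb c \<in> lin2 U"
  using lin2I[of c 0 U] by simp

lemma lin2_self [simp]: "U \<in> lin2 U"
  using lin2I[of 0 1 U] by simp

lemma lin2_mult:
  assumes "U * U = emb a" "k \<in> lin2 U" "l \<in> lin2 U"
  shows "k * l \<in> lin2 U" "k * l = l * k"
proof -
  obtain p q p' q' where kl: "k = emb p + emb q * U" "l = emb p' + emb q' * U"
    using assms unfolding lin2_def by blast
  have "k * l = emb (p * p' + q * q' * a) + emb (p * q' + q * p') * U"
    unfolding kl using assms(1)
    by (simp add: emb_simps emb_left[of U])
  moreover have "l * k = emb (p * p' + q * q' * a) + emb (p * q' + q * p') * U"
    unfolding kl using assms(1)
    by (simp add: emb_simps emb_left[of U])
  ultimately show "k * l \<in> lin2 U" "k * l = l * k" using lin2I by metis+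
qed

text \<open>Iterated, this turns membership in the span of an explicit list into the existence of
  coefficients.\<close>

lemma span_insert_iff: "y \<in> vs.span (insert x X) \<longleftrightarrow> (\<exists>c z. z \<in> vs.span X \<and> y = emb c * x + z)"
proof
  assume "y \<in> vs.span (insert x X)"
  then obtain c where "y - emb c * x \<in> vs.span X"
    using vs.span_breakdown_eq by blast
  moreover have "y = emb c * x + (y - emb c * x)" by (simp add: add.left_commute)
  ultimately show "\<exists>c z. z \<in> vs.span X \<and> y = emb c * x + z" by blast
next
  assume "\<exists>c z. z \<in> vs.span X \<and> y = emb c * x + z"
  then obtain c z where "z \<in> vs.span X" "y = emb c * x + z" by blast
  then have "y - emb c * x \<in> vs.span X" by (simp add: add.left_commute add.commute)
  then show "y \<in> vs.span (insert x X)"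
    using vs.span_breakdown_eq by blast
qed

lemma quat_span: "quat U V = vs.span {1, U, V, U * V}"
proof -
  have "y \<in> quat U V \<longleftrightarrow> y \<in> vs.span {1, U, V, U * V}" for y
    unfolding quat_def span_insert_iff by (simp add: vs.span_empty add.assoc) metis
  then show ?thesis by blast
qed

lemma lin2_span: "lin2 U = vs.span {1, U}"
proof -
  have "y \<in> lin2 U \<longleftrightarrow> y \<in> vs.span {1, U}" for y
    unfolding lin2_def span_insert_iff by (simp add: vs.span_empty add.assoc) metis
  then show ?thesis by blast
qed

text \<open>Commutators isolate the coefficients: z U + U z = r U + s a, and the commutator of this
  with V is r U. What remains, p + q U, has commutator q U with V.\<close>

lemma quat_indep:
  assumes P: "quat_pair a b U V"
    and 0: "emb p + emb q * U + emb r * V + emb s * (U * V) = 0"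
  shows "p = 0 \<and> q = 0 \<and> r = 0 \<and> s = 0"
proof -
  note P' = quat_pairD[OF P]
  have U0: "U \<noteq> 0" using P' by auto
  let ?z = "emb p + emb q * U + emb r * V + emb s * (U * V)"
  have "emb r * U + emb (s * a) = ?z * U + U * ?z"
    using P' by (simp add: emb_simps emb_left[of U] emb_left[of V])
  then have 1: "emb r * U + emb (s * a) = 0" unfolding 0 by simp
  have "emb r * U = (emb r * U + emb (s * a)) * V + V * (emb r * U + emb (s * a))"
    using P' by (simp add: emb_simps emb_left[of U] emb_left[of V])
  then have r: "r = 0" unfolding 1 using U0 by simp
  then have s: "s = 0" using 1 P'(1) by simp
  have 2: "emb p + emb q * U = 0" using 0 r s by simp
  have "emb q * U = (emb p + emb q * U) * V + V * (emb p + emb q * U)"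
    using P' by (simp add: emb_simps emb_left[of U] emb_left[of V])
  then have q: "q = 0" unfolding 2 using U0 by simp
  then show ?thesis using r s 2 by simp
qed

lemma quat_eq_iff:
  assumes P: "quat_pair a b U V"
  shows "emb p + emb q * U + emb r * V + emb s * (U * V) =
    emb p' + emb q' * U + emb r' * V + emb s' * (U * V) \<longleftrightarrow> p = p' \<and> q = q' \<and> r = r' \<and> s = s'"
    (is "?z = ?z' \<longleftrightarrow> _")
proof
  assume "?z = ?z'"
  then have "emb (p + p') + emb (q + q') * U + emb (r + r') * V + emb (s + s') * (U * V) = 0"
    by (simp only: eq_iff_add_a[of ?z]) (simp add: emb_simps)
  from quat_indep[OF P this] show "p = p' \<and> q = q' \<and> r = r' \<and> s = s'"
    by (simp add: eq_iff_add_f[symmetric])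
qed simp

lemma quat_mult:
  assumes P: "quat_pair a b U V"
  shows "(emb p + emb q * U + emb r * V + emb s * (U * V)) *
    (emb p' + emb q' * U + emb r' * V + emb s' * (U * V)) =
    emb (p*p' + a*q*q' + b*r*r' + a*s*q' + a*b*s*s') +
    emb (p*q' + q*p' + r*q' + b*r*s' + b*s*r') * U +
    emb (p*r' + r*p' + r*r' + a*q*s' + a*s*q') * V +
    emb (p*s' + s*p' + q*r' + r*q' + s*r') * (U * V)"
  using quat_pairD[OF P] by (simp add: emb_simps emb_left[of U] emb_left[of V])

lemma quat_closed:
  assumes P: "quat_pair a b U V" and "z \<in> quat U V" "z' \<in> quat U V"
  shows "z + z' \<in> quat U V" "z * z' \<in> quat U V"
proof -
  show "z + z' \<in> quat U V"
    using assms(2,3) unfolding quat_span by (rule vs.span_add)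
  obtain p q r s p' q' r' s' where
    z: "z = emb p + emb q * U + emb r * V + emb s * (U * V)"
    "z' = emb p' + emb q' * U + emb r' * V + emb s' * (U * V)"
    using assms(2,3) unfolding quat_def by blast
  show "z * z' \<in> quat U V"
    unfolding z quat_mult[OF P] by (rule quatI)
qed

lemma quat_emb [simp]: "emb c \<in> quat U V"
  using quatI[of c 0 U 0 V 0] by simp

lemma quat_0 [simp]: "0 \<in> quat U V"
  using quat_emb[of 0 U V] by simp

lemma quat_gens [simp]: "U \<in> quat U V" "V \<in> quat U V" "1 \<in> quat U V"
  using quatI[of 0 1 U 0 V 0] quatI[of 0 0 U 1 V 0] quatI[of 1 0 U 0 V 0] by simp_all

lemma lin2_quat: "k \<in> lin2 U \<Longrightarrow> k \<in> quat U V"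
  unfolding lin2_span quat_span using vs.span_mono[of "{1, U}" "{1, U, V, U * V}"] by blast

lemma subalg_quat: "quat_pair a b U V \<Longrightarrow> subalg emb (quat U V)"
  unfolding subalg_def by (auto intro: quat_closed)

lemma quat_basis:
  assumes P: "quat_pair a b U V"
  shows "vs.independent {1, U, V, U * V}" "card {1, U, V, U * V} = 4"
proof -
  have neq: "1 \<noteq> U" "1 \<noteq> V" "1 \<noteq> U * V" "U \<noteq> V" "U \<noteq> U * V" "V \<noteq> U * V"
    using quat_eq_iff[OF P, of 1 0 0 0 0 1 0 0] quat_eq_iff[OF P, of 1 0 0 0 0 0 1 0]
      quat_eq_iff[OF P, of 1 0 0 0 0 0 0 1] quat_eq_iff[OF P, of 0 1 0 0 0 0 1 0]
      quat_eq_iff[OF P, of 0 1 0 0 0 0 0 1] quat_eq_iff[OF P, of 0 0 1 0 0 0 0 1] by simp_all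
  then show "card {1, U, V, U * V} = 4" by simp
  show "vs.independent {1, U, V, U * V}"
  proof
    assume "vs.dependent {1, U, V, U * V}"
    then obtain u where u: "\<exists>v\<in>{1, U, V, U * V}. u v \<noteq> 0"
      "(\<Sum>v\<in>{1, U, V, U * V}. emb (u v) * v) = 0"
      using vs.dependent_finite[of "{1, U, V, U * V}"] by auto
    have "emb (u 1) + emb (u U) * U + emb (u V) * V + emb (u (U * V)) * (U * V) = 0"
      using u(2) neq by (simp add: add.assoc)
    from quat_indep[OF P this] show False using u(1) by auto
  qed
qed

text \<open>Centre and simplicity rest on the commutators that prove \<open>quat_indep\<close>. They
  reduce an element of an ideal to a multiple of U or of 1, and such a multiple generates everything
  unless it vanishes.\<close>

lemma csa_quat:
  assumes P: "quat_pair a b U V"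
  shows "csa emb (quat U V) 4"
proof -
  note P' = quat_pairD[OF P]
  have U0: "U \<noteq> 0" using P' by auto
  have dim: "has_fdim emb (quat U V) 4"
    unfolding has_fdim_def
  proof (intro exI conjI)
    show "{1, U, V, U * V} \<subseteq> quat U V" unfolding quat_span by (rule vs.span_superset)
  qed (simp_all add: quat_span quat_basis[OF P])
  have cent: "centralizer (quat U V) (quat U V) = range emb"
  proof
    show "range emb \<subseteq> centralizer (quat U V) (quat U V)"
      unfolding centralizer_def using emb_comm by auto
    show "centralizer (quat U V) (quat U V) \<subseteq> range emb"
    proof
      fix z assume "z \<in> centralizer (quat U V) (quat U V)"
      then have z: "z \<in> quat U V" and "z * U = U * z" "z * V = V * z"
        unfolding centralizer_def by simp_all
      then obtain p q r s where zz: "z = emb p + emb q * U + emb r * V + emb s * (U * V)"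
        unfolding quat_def by blast
      have "emb (s * a) + emb r * U + emb 0 * V + emb 0 * (U * V) = z * U + U * z"
        unfolding zz using P' by (simp add: emb_simps emb_left[of U] emb_left[of V])
      also have "\<dots> = 0" using \<open>z * U = U * z\<close> by simp
      finally have rs: "r = 0" "s = 0" using quat_indep[OF P, of "s * a" r 0 0] P'(1) by simp_all
      have "emb q * U = z * V + V * z"
        unfolding zz using P' rs by (simp add: emb_simps emb_left[of U] emb_left[of V])
      also have "\<dots> = 0" using \<open>z * V = V * z\<close> by simp
      finally have "q = 0" using U0 by simp
      then show "z \<in> range emb" using zz rs by simp
    qed
  qed
  have simple: "I = {0} \<or> I = quat U V" if I: "ideal_in (quat U V) I" for I
  proof (rule disjCI)
    assume "I \<noteq> quat U V"
    have Isub: "I \<subseteq> quat U V" and I0: "0 \<in> I" and Iadd: "\<And>x y. x \<in> I \<Longrightarrow> y \<in> I \<Longrightarrow> x + y \<in> I"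
      and Il: "\<And>q x. q \<in> quat U V \<Longrightarrow> x \<in> I \<Longrightarrow> q * x \<in> I"
      and Ir: "\<And>q x. q \<in> quat U V \<Longrightarrow> x \<in> I \<Longrightarrow> x * q \<in> I"
      using I unfolding ideal_in_def by blast+
    have noc: "c = 0" if "emb c \<in> I" for c
    proof (rule ccontr)
      assume "c \<noteq> 0"
      then have "1 \<in> I" using Il[of "emb (inverse c)", OF _ that] by (simp flip: emb_mult)
      then have "quat U V \<subseteq> I" using Il by fastforce
      then show False using \<open>I \<noteq> quat U V\<close> Isub by blast
    qed
    have noU: "c = 0" if "emb c * U \<in> I" for c
    proof -
      have "emb (c * a) \<in> I" using Ir[of U, OF _ that] P' by (simp add: emb_mult mult.assoc)
      then show ?thesis using noc P'(1) by fastforce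
    qed
    have comm: "z * q + q * z \<in> I" if "z \<in> I" "q \<in> quat U V" for z q
      using that Iadd Il Ir by blast
    have "z = 0" if z: "z \<in> I" for z
    proof -
      obtain p q r s where zz: "z = emb p + emb q * U + emb r * V + emb s * (U * V)"
        using z Isub unfolding quat_def by blast
      have 1: "emb (s * a) + emb r * U \<in> I"
        using comm[OF z, of U] unfolding zz using P'
        by (simp add: emb_simps emb_left[of U] emb_left[of V])
      have "emb r * U \<in> I"
        using comm[OF 1, of V] using P' by (simp add: emb_simps emb_left[of U] emb_left[of V])
      then have r: "r = 0" by (rule noU)
      then have s: "s = 0" using 1 noc[of "s * a"] P'(1) by simp
      have "emb q * U \<in> I"
        using comm[OF z, of V] unfolding zz using P' r s
        by (simp add: emb_simps emb_left[of U] emb_left[of V])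
      then have q: "q = 0" by (rule noU)
      then have "p = 0" using z r s noc unfolding zz by simp
      then show "z = 0" using zz q r s by simp
    qed
    then show "I = {0}" using I0 by blast
  qed
  show ?thesis
    unfolding csa_def using subalg_quat[OF P] dim cent simple by blast
qed

section \<open>Dimension counts and centralizers\<close>

lemma fdim_indep_card:
  assumes "has_fdim emb B d" "vs.independent Y" "Y \<subseteq> B"
  shows "finite Y \<and> card Y \<le> d"
  using assms unfolding has_fdim_def by (metis vs.independent_span_bound)

lemma fdim_span:
  assumes B: "has_fdim emb B d" and Y: "vs.independent Y" "Y \<subseteq> B" "card Y = d"
  shows "B \<subseteq> vs.span Y"
proof
  fix y assume "y \<in> B"
  show "y \<in> vs.span Y"
  proof (rule ccontr)
    assume n: "y \<notin> vs.span Y"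
    then have "vs.independent (insert y Y)" using Y(1) by (simp add: vs.independent_insert)
    then have "finite (insert y Y) \<and> card (insert y Y) \<le> d"
      using Y(2) \<open>y \<in> B\<close> by (intro fdim_indep_card[OF B]) simp_all
    moreover have "y \<notin> Y" using n vs.span_base by blast
    ultimately show False using Y(3) by (cases "finite Y") simp_all
  qed
qed

lemma fdim_not_subset:
  assumes B: "has_fdim emb B d" and Y: "finite Y" "card Y < d"
  shows "\<not> B \<subseteq> vs.span Y"
proof
  assume "B \<subseteq> vs.span Y"
  moreover obtain X where "X \<subseteq> B" "\<not> vs.dependent X" "card X = d"
    using B unfolding has_fdim_def by blast
  ultimately have "d \<le> card Y" using vs.independent_span_bound[OF Y(1), of X] by auto
  then show False using Y(2) by simp
qed

lemma fdim_subspace: "has_fdim emb B d \<Longrightarrow> vs.subspace B"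
  unfolding has_fdim_def using vs.subspace_span by metis

lemma span_1: "vs.span {1} = range emb"
proof -
  have "y \<in> vs.span {1} \<longleftrightarrow> y \<in> range emb" for y
    unfolding span_insert_iff by (auto simp: vs.span_empty)
  then show ?thesis by blast
qed

lemma commutes_span:
  assumes "\<And>x. x \<in> X \<Longrightarrow> x * u = u * x" "y \<in> vs.span X"
  shows "y * u = u * y"
  using assms(2)
proof (induction rule: vs.span_induct_alt)
  case base then show ?case by simp
next
  case (step c x y)
  then show ?case using assms(1)[of x] by (simp add: algebra_simps emb_left[of u])
qed

text \<open>If the centralizer C of u is larger than F + F u, then Q = C + F z for some z, and with
  c = u z + z u the two-dimensional space F c + F z c is an ideal of Q.\<close>

lemma csa_centralizer_quadratic:
  assumes Q: "csa emb Q 4" and u: "u \<in> Q" "u \<notin> range emb" "u * u \<in> range emb"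
    and y: "y \<in> Q" "y * u = u * y"
  shows "y \<in> lin2 u"
proof (rule ccontr)
  assume yn: "y \<notin> lin2 u"
  have sub: "subalg emb Q" and dim: "has_fdim emb Q 4"
    and cent: "centralizer Q Q = range emb"
    and simple: "\<And>I. ideal_in Q I \<Longrightarrow> I = {0} \<or> I = Q"
    using Q unfolding csa_def by auto
  have mult: "\<And>a b. a \<in> Q \<Longrightarrow> b \<in> Q \<Longrightarrow> a * b \<in> Q" using sub unfolding subalg_def by blast
  have one: "1 \<in> Q" using sub emb_1 unfolding subalg_def by (metis rangeI subsetD)
  note ssp = fdim_subspace[OF dim]
  obtain z where z: "z \<in> Q" "z * u \<noteq> u * z"
    using cent u(1,2) unfolding centralizer_def by force
  have comm3: "w * u = u * w" if "w \<in> vs.span {1, u, y}" for w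
    by (rule commutes_span[OF _ that]) (use y(2) in auto)
  let ?B = "{z, y, u, 1}"
  have n: "z \<notin> vs.span {y, u, 1}" "y \<notin> vs.span {u, 1}" "u \<notin> vs.span {1}"
    using comm3 z(2) yn u(2) by (auto simp: insert_commute lin2_span span_1)
  have B: "vs.independent ?B"
    using n by (intro vs.independent_insertI) (simp_all add: vs.independent_empty)
  have "z \<noteq> y" "z \<noteq> u" "z \<noteq> 1" "y \<noteq> u" "y \<noteq> 1" "u \<noteq> 1"
    using n vs.span_base by (metis insertCI)+
  then have card: "card ?B = 4" by simp
  have span: "Q \<subseteq> vs.span ?B"
    using fdim_span[OF dim B _ card] z(1) y(1) u(1) one by simp
  define c where "c = u * z + z * u"
  have cQ: "c \<in> Q" unfolding c_def using mult u(1) z(1) ssp by (simp add: vs.subspace_add)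
  have c0: "c \<noteq> 0" using z(2) unfolding c_def by (metis eq_iff_add_a)
  have dec: "\<exists>w m. w \<in> Q \<and> w * u = u * w \<and> q = w + emb m * z" if q: "q \<in> Q" for q
  proof -
    obtain m w where w: "w \<in> vs.span {y, u, 1}" "q = emb m * z + w"
      using subsetD[OF span q] unfolding span_insert_iff[of q z] by blast
    have "w \<in> Q"
      using w(1) vs.span_minimal[OF _ ssp, of "{y, u, 1}"] y(1) u(1) one by blast
    moreover have "w * u = u * w" using comm3[of w] w(1) by (simp add: insert_commute)
    ultimately show ?thesis using w(2) by (auto simp: add.commute)
  qed
  \<comment> \<open>The commutator with u kills w and sends z to c, so its image is the line F
    c.\<close>
  have F: "\<exists>l. u * q + q * u = emb l * c" if q: "q \<in> Q" for q
  proof -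
    obtain w m where w: "w * u = u * w" "q = w + emb m * z" using dec[OF q] by blast
    have "u * q + q * u = emb m * c"
      unfolding c_def w(2) using w(1) by (simp add: algebra_simps emb_left[of u])
    then show ?thesis by blast
  qed
  \<comment> \<open>The elements c w, w c and c z + z c are the commutators of u with z w, w z and
    z^2, hence multiples of c.\<close>
  have cw: "\<exists>l. c * w = emb l * c" if "w \<in> Q" "w * u = u * w" for w
  proof -
    have "u * (z * w) + (z * w) * u = c * w"
      unfolding c_def using that(2) by (simp add: algebra_simps)
    then show ?thesis using F[of "z * w"] mult z(1) that(1) by metis
  qed
  have wc: "\<exists>l. w * c = emb l * c" if "w \<in> Q" "w * u = u * w" for w
  proof -
    have "u * (w * z) + (w * z) * u = w * c"
      unfolding c_def using that(2) by (simp add: algebra_simps flip: mult.assoc)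
    then show ?thesis using F[of "w * z"] mult z(1) that(1) by metis
  qed
  obtain l0 where l0: "c * z = z * c + emb l0 * c"
  proof -
    have "u * (z * z) + (z * z) * u = c * z + z * c"
      unfolding c_def by (simp add: algebra_simps)
    then obtain l where "c * z + z * c = emb l * c" using F[of "z * z"] mult z(1) by metis
    then have "c * z = z * c + emb l * c" by (metis add.commute two_a')
    then show ?thesis by (rule that)
  qed
  define I where "I = vs.span {c, z * c}"
  have Iq: "q * c \<in> I" if q: "q \<in> Q" for q
  proof -
    obtain w m where w: "w \<in> Q" "w * u = u * w" "q = w + emb m * z" using dec[OF q] by blast
    obtain l where "w * c = emb l * c" using wc w by blast
    then have "q * c = emb l * c + emb m * (z * c)" using w(3) by (simp add: algebra_simps)
    then show ?thesis unfolding I_def by (simp add: vs.span_add vs.span_scale vs.span_base)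
  qed
  have Il: "q * i \<in> I" if qi: "q \<in> Q" "i \<in> I" for q i
  proof -
    obtain l m where "i = emb l * c + emb m * (z * c)"
      using qi(2) unfolding I_def span_insert_iff by (auto simp: vs.span_empty)
    then have i: "q * i = emb l * (q * c) + emb m * ((q * z) * c)"
      by (simp add: algebra_simps emb_left[of q])
    show ?thesis unfolding i
      using Iq[of q] Iq[of "q * z"] mult z(1) qi(1) unfolding I_def
      by (simp add: vs.span_add vs.span_scale)
  qed
  have cq: "c * q \<in> I" if q: "q \<in> Q" for q
  proof -
    obtain w m where w: "w \<in> Q" "w * u = u * w" "q = w + emb m * z" using dec[OF q] by blast
    obtain l where "c * w = emb l * c" using cw w by blast
    then have "c * q = emb (l + m * l0) * c + emb m * (z * c)"
      using w(3) l0 by (simp add: emb_simps emb_left[of c])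
    then show ?thesis unfolding I_def by (simp add: vs.span_add vs.span_scale vs.span_base)
  qed
  have Ir: "i * q \<in> I" if qi: "q \<in> Q" "i \<in> I" for q i
  proof -
    obtain l m where "i = emb l * c + emb m * (z * c)"
      using qi(2) unfolding I_def span_insert_iff by (auto simp: vs.span_empty)
    then have i: "i * q = emb l * (c * q) + emb m * (z * (c * q))"
      by (simp add: algebra_simps)
    show ?thesis unfolding i
      using cq[of q] Il[OF z(1), of "c * q"] qi(1) unfolding I_def
      by (simp add: vs.span_add vs.span_scale)
  qed
  have IQ: "I \<subseteq> Q"
    unfolding I_def using vs.span_minimal[OF _ ssp] cQ mult z(1) by simp
  have "ideal_in Q I"
    unfolding ideal_in_def using IQ Il Ir unfolding I_def
    by (auto simp: vs.span_zero vs.span_add)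
  then have "I = {0} \<or> I = Q" by (rule simple)
  moreover have "c \<in> I" unfolding I_def by (simp add: vs.span_base)
  moreover have "\<not> Q \<subseteq> I"
    unfolding I_def by (rule fdim_not_subset[OF dim]) (auto simp: card_insert_if)
  ultimately show False using c0 by blast
qed

section \<open>Alternating elements and invariant quaternion subalgebras\<close>

lemma Alt_iff: "y \<in> Alt B \<sigma> \<longleftrightarrow> (\<exists>x\<in>B. y = x + \<sigma> x)"
  unfolding Alt_def by auto

lemma AltI: "x \<in> B \<Longrightarrow> x + \<sigma> x \<in> Alt B \<sigma>"
  unfolding Alt_iff by blast

lemma Alt_UNIV_add: "y \<in> Alt UNIV \<sigma> \<Longrightarrow> y' \<in> Alt UNIV \<sigma> \<Longrightarrow> y + y' \<in> Alt UNIV \<sigma>"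
proof -
  assume "y \<in> Alt UNIV \<sigma>" "y' \<in> Alt UNIV \<sigma>"
  then obtain x x' where "y = x + \<sigma> x" "y' = x' + \<sigma> x'" unfolding Alt_iff by blast
  then have "y + y' = (x + x') + \<sigma> (x + x')" by (simp add: inv_add algebra_simps)
  then show ?thesis using AltI by (metis UNIV_I)
qed

lemma Alt_UNIV_scale: "y \<in> Alt UNIV \<sigma> \<Longrightarrow> emb c * y \<in> Alt UNIV \<sigma>"
proof -
  assume "y \<in> Alt UNIV \<sigma>"
  then obtain x where "y = x + \<sigma> x" unfolding Alt_iff by blast
  then have "emb c * y = emb c * x + \<sigma> (emb c * x)" by (simp add: inv_scale algebra_simps)
  then show ?thesis using AltI by (metis UNIV_I)
qed

lemma emb_in_Alt:
  assumes "1 \<notin> Alt UNIV \<sigma>" "emb c \<in> Alt UNIV \<sigma>"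
  shows "c = 0"
proof (rule ccontr)
  assume "c \<noteq> 0"
  then have "1 = emb (inverse c) * emb c" by (simp flip: emb_mult)
  then show False using Alt_UNIV_scale[OF assms(2)] assms(1) by metis
qed

text \<open>Were all symmetric elements of Q to commute with u, they would lie in F + F u, and so
  would every z + \<sigma> z. Two elements independent modulo F + F u then combine to some z with z
  + \<sigma> z in F, hence zero by orthogonality, and this z is symmetric but outside F + F u. The
  commutator of r and u is alternating and commutes with u; q = 0 would make it an alternating
  scalar.\<close>

lemma quat_symmetric_noncommuting:
  assumes Q: "csa emb Q 4" and \<sigma>Q: "\<sigma> ` Q \<subseteq> Q" and orth: "1 \<notin> Alt UNIV \<sigma>"
    and u: "u \<in> Q" "\<sigma> u = u" "u \<notin> range emb" "u * u \<in> range emb"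
  obtains r p q where "r \<in> Q" "\<sigma> r = r" "r * u + u * r = emb p + emb q * u" "q \<noteq> 0"
proof -
  have sub: "subalg emb Q" and dim: "has_fdim emb Q 4"
    using Q unfolding csa_def by auto
  have mult: "\<And>a b. a \<in> Q \<Longrightarrow> b \<in> Q \<Longrightarrow> a * b \<in> Q" using sub unfolding subalg_def by blast
  note ssp = fdim_subspace[OF dim]
  note C = csa_centralizer_quadratic[OF Q u(1,3,4)]
  have "\<exists>r\<in>Q. \<sigma> r = r \<and> r * u \<noteq> u * r"
  proof (rule ccontr)
    assume "\<not> ?thesis"
    then have sym: "\<And>r. r \<in> Q \<Longrightarrow> \<sigma> r = r \<Longrightarrow> r \<in> lin2 u" using C by blast
    have "card {1, u} < 4" "card {z1, 1, u} < 4" for z1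
      by (simp_all add: card_insert_if)
    note ns = this[THEN fdim_not_subset[OF dim, rotated]]
    obtain z1 where z1: "z1 \<in> Q" "z1 \<notin> vs.span {1, u}"
      using ns(1) by auto
    obtain z2 where z2: "z2 \<in> Q" "z2 \<notin> vs.span {z1, 1, u}"
      using ns(2)[of z1] by auto
    have tau: "\<exists>p q. z + \<sigma> z = emb p + emb q * u" if "z \<in> Q" for z
    proof -
      have "z + \<sigma> z \<in> lin2 u"
        using that \<sigma>Q ssp by (intro sym) (auto simp: vs.subspace_add inv_add add.commute)
      then show ?thesis unfolding lin2_def by blast
    qed
    obtain p1 q1 where t1: "z1 + \<sigma> z1 = emb p1 + emb q1 * u" using tau[OF z1(1)] by blast
    obtain p2 q2 where t2: "z2 + \<sigma> z2 = emb p2 + emb q2 * u" using tau[OF z2(1)] by blast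
    \<comment> \<open>The coefficients cancel the u-parts. If q1 = 0 this combination may be zero,
      and z1 alone is used instead.\<close>
    let ?z = "emb q2 * z1 + emb q1 * z2"
    have "?z + \<sigma> ?z = emb q2 * (z1 + \<sigma> z1) + emb q1 * (z2 + \<sigma> z2)"
      by (simp add: inv_add inv_scale algebra_simps)
    also have "\<dots> = emb (q2 * p1 + q1 * p2)"
      unfolding t1 t2 by (simp add: emb_simps)
    finally have "?z + \<sigma> ?z = emb (q2 * p1 + q1 * p2)" .
    moreover have "q2 * p1 + q1 * p2 = 0"
      using emb_in_Alt[OF orth] AltI[of ?z UNIV] calculation by simp
    ultimately have "?z + \<sigma> ?z = 0" by (simp only: emb_0)
    then have "\<sigma> ?z = ?z" by (metis add0D)
    then have "?z \<in> lin2 u"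
      using z1(1) z2(1) ssp by (intro sym) (auto simp: vs.subspace_add vs.subspace_scale)
    then have zs: "?z \<in> vs.span {1, u}" by (simp add: lin2_span)
    have q1: "q1 = 0"
    proof (rule ccontr)
      assume q1: "q1 \<noteq> 0"
      have "emb q1 * z2 = emb q2 * z1 + ?z" by simp
      then have "emb q1 * z2 \<in> vs.span {z1, 1, u}"
        unfolding span_insert_iff[of _ z1] using zs by blast
      then show False
        using z2(2) q1 vs.span_scale[of "emb q1 * z2" _ "inverse q1"]
        by (simp add: emb_mult_assoc)
    qed
    then have "p1 = 0" using t1 emb_in_Alt[OF orth] AltI[of z1 UNIV] by simp
    then have "\<sigma> z1 = z1" using t1 q1 by (simp add: eq_iff_add_a[of "\<sigma> z1"] add.commute)
    then show False using sym[of z1] z1 by (simp add: lin2_span)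
  qed
  then obtain r where r: "r \<in> Q" "\<sigma> r = r" "r * u \<noteq> u * r" by blast
  have alt: "r * u + u * r \<in> Alt UNIV \<sigma>"
    using AltI[of "r * u" UNIV] r(2) u(2) by (simp add: inv_mult)
  have "(r * u + u * r) * u = u * (r * u + u * r)"
  proof -
    obtain m where "u * u = emb m" using u(4) by blast
    then have "r * (u * u) = u * u * r" using emb_comm by simp
    then show ?thesis by (simp add: algebra_simps)
  qed
  then have "r * u + u * r \<in> lin2 u"
    using r(1) u(1) mult ssp by (intro C) (auto simp: vs.subspace_add)
  then obtain p q where pq: "r * u + u * r = emb p + emb q * u"
    unfolding lin2_def by blast
  have "q \<noteq> 0"
  proof
    assume "q = 0"
    then have "p = 0" using alt pq emb_in_Alt[OF orth] by simp
    then show False using r(3) \<open>q = 0\<close> pq by (simp add: eq_iff_add_a[of "r * u"])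
  qed
  then show thesis using that r pq by blast
qed

text \<open>r x + x r = r x + \<sigma>(r x) is alternating and equals p + q x with q nonzero; it
  remains to divide by q.\<close>

lemma quat_invariant_alternating:
  assumes Q: "csa emb Q 4" and \<sigma>Q: "\<sigma> ` Q \<subseteq> Q" and orth: "1 \<notin> Alt UNIV \<sigma>"
    and x: "x \<in> Q" "\<sigma> x = x" "x \<notin> range emb" "x * x \<in> range emb"
  obtains p where "x + emb p \<in> Alt UNIV \<sigma>"
proof -
  obtain r p q where r: "r \<in> Q" "\<sigma> r = r" "r * x + x * r = emb p + emb q * x" "q \<noteq> 0"
    using quat_symmetric_noncommuting[OF Q \<sigma>Q orth x] by blast
  have "r * x + x * r \<in> Alt UNIV \<sigma>"
    using AltI[of "r * x" UNIV] r(2) x(2) by (simp add: inv_mult)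
  then have "emb (inverse q) * (emb p + emb q * x) \<in> Alt UNIV \<sigma>"
    using r(3) Alt_UNIV_scale by simp
  also have "emb (inverse q) * (emb p + emb q * x) = x + emb (inverse q * p)"
    using r(4) by (simp add: emb_simps)
  finally show thesis using that by blast
qed

text \<open>The alternating element of reduced norm a serves as u. A symmetric r whose commutator
  with u is a nonzero multiple q u yields v = r / q, for which v u = u v + u.\<close>

lemma quat_pair_of_disc:
  assumes Q: "quat_subalg emb Q" and \<sigma>Q: "\<sigma> ` Q \<subseteq> Q" and orth: "1 \<notin> Alt UNIV \<sigma>"
    and disc: "disc_rep emb Q \<sigma> a"
  obtains u v b where "u \<in> Q" "v \<in> Q" "\<sigma> u = u" "\<sigma> v = v" "quat_pair a b u v"
    "Q \<subseteq> quat u v"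
proof -
  have Q': "csa emb Q 4" using Q unfolding quat_subalg_def .
  have sub: "subalg emb Q" and dim: "has_fdim emb Q 4"
    using Q' unfolding csa_def by auto
  have mult: "\<And>a b. a \<in> Q \<Longrightarrow> b \<in> Q \<Longrightarrow> a * b \<in> Q" using sub unfolding subalg_def by blast
  note ssp = fdim_subspace[OF dim]
  obtain u where a0: "a \<noteq> 0" and ua: "u \<in> Alt Q \<sigma>" and nrd: "quat_nrd emb u a"
    using disc unfolding disc_rep_def by auto
  obtain z where z: "z \<in> Q" "u = z + \<sigma> z" using ua unfolding Alt_iff by blast
  have uQ: "u \<in> Q" using z \<sigma>Q ssp by (auto simp: vs.subspace_add)
  have us: "\<sigma> u = u" using z by (simp add: inv_add add.commute)
  have uU: "u \<in> Alt UNIV \<sigma>" using z AltI[of z UNIV] by simp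
  \<comment> \<open>A scalar u would be zero, being alternating, and would then have norm
    zero.\<close>
  have un: "u \<notin> range emb"
  proof
    assume "u \<in> range emb"
    then obtain c where c: "u = emb c" by blast
    then have "u = 0" using uU emb_in_Alt[OF orth] by simp
    moreover have "0 = emb 0" by simp
    ultimately have "emb a = 0"
      using nrd unfolding quat_nrd_def by auto
    then show False using a0 by simp
  qed
  then obtain t where "u * u - emb t * u + emb a = 0"
    using nrd unfolding quat_nrd_def by blast
  then have ut: "u * u = emb t * u + emb a"
    by (simp add: eq_iff_add_a[of "u * u"] add.assoc)
  \<comment> \<open>Since u^3 is alternating and u^2 = t u + a, so is t a; hence the trace t vanishes.\<close>
  have "u * z * u + \<sigma> (u * z * u) = u * u * u"
  proof -
    have "u * z * u + \<sigma> (u * z * u) = u * (z + \<sigma> z) * u"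
      using us by (simp add: inv_mult algebra_simps)
    then show ?thesis by (simp only: z(2)[symmetric])
  qed
  then have "u * u * u \<in> Alt UNIV \<sigma>" using AltI[of "u * z * u" UNIV] by simp
  moreover have "u * u * u = emb (t * t + a) * u + emb (t * a)"
    by (simp add: ut emb_simps)
  ultimately have "emb (t * t + a) * u + (emb (t * t + a) * u + emb (t * a)) \<in> Alt UNIV \<sigma>"
    using Alt_UNIV_add Alt_UNIV_scale[OF uU] by metis
  then have "t = 0" using emb_in_Alt[OF orth] a0 by fastforce
  then have uu: "u * u = emb a" using ut by simp
  obtain r p q where r: "r \<in> Q" "\<sigma> r = r" "r * u + u * r = emb p + emb q * u" "q \<noteq> 0"
    using quat_symmetric_noncommuting[OF Q' \<sigma>Q orth uQ us un] uu by blast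
  \<comment> \<open>Both the commutator p + q u and q u are alternating, so the scalar p is
    alternating and vanishes.\<close>
  have "r * u + u * r \<in> Alt UNIV \<sigma>"
    using AltI[of "r * u" UNIV] r(2) us by (simp add: inv_mult)
  then have "(emb p + emb q * u) + emb q * u \<in> Alt UNIV \<sigma>"
    using r(3) Alt_UNIV_add Alt_UNIV_scale[OF uU] by metis
  then have "p = 0" using emb_in_Alt[OF orth] by (simp add: add.assoc)
  then have ru: "r * u = u * r + emb q * u" using r(3) by (metis add.commute add.left_neutral emb_0 two_a')
  define v where "v = emb (inverse q) * r"
  have vQ: "v \<in> Q" unfolding v_def using r(1) ssp by (simp add: vs.subspace_scale)
  have vs: "\<sigma> v = v" unfolding v_def using r(2) by (simp add: inv_scale)
  have vu: "v * u = u * v + u"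
    unfolding v_def using ru r(4) by (simp add: emb_simps emb_left[of u] mult.assoc)
  have vu': "v * (u * y) = u * (v * y) + u * y" for y
    using vu by (metis distrib_right mult.assoc)
  note C = csa_centralizer_quadratic[OF Q' uQ un]
  \<comment> \<open>v^2 + v commutes with u because u moves v to v + 1, and it commutes with v,
    which u does not. Hence its u-coefficient is zero.\<close>
  have "v * v + v \<in> lin2 u"
    using uu vQ mult ssp vu by (intro C) (auto simp: vs.subspace_add algebra_simps vu')
  then obtain b b' where b: "v * v + v = emb b + emb b' * u" unfolding lin2_def by blast
  have "emb b' * u = (v * v + v) * v + v * (v * v + v)"
    unfolding b using vu by (simp add: algebra_simps emb_left[of v])
  also have "\<dots> = 0" by (simp add: algebra_simps)
  finally have "b' = 0" using un by (metis emb_0 emb_mult_eq_0 rangeI)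
  then have vv: "v * v = v + emb b"
    using b by (metis emb_0 mult_zero_left add_0_right add.commute two_a')
  have P: "quat_pair a b u v" unfolding quat_pair_def using a0 uu vv vu by simp
  have "y \<in> quat u v" if y: "y \<in> Q" for y
  proof -
    have "(y * u + u * y) * u = u * (y * u + u * y)"
      using uu emb_comm[of a y] by (simp add: algebra_simps) (simp flip: mult.assoc)
    then have "y * u + u * y \<in> lin2 u"
      using y uQ uu mult ssp by (intro C) (auto simp: vs.subspace_add)
    then obtain k where k: "k \<in> lin2 u" "y * u + u * y = k" by blast
    obtain k0 k1 where k01: "k = emb k0 + emb k1 * u" using k(1) unfolding lin2_def by blast
    \<comment> \<open>Chosen so that l u = y u + u y. As v u + u v = u, the element y + l v then
      commutes with u.\<close>
    define l where "l = emb (inverse a * k0) * u + emb k1"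
    have lu: "l * u = k" "u * l = l * u"
      unfolding l_def k01 using uu a0 by (simp_all add: emb_simps emb_left[of u])
    have lQ: "l \<in> Q" unfolding l_def using uQ sub
      by (intro vs.subspace_add[OF ssp] vs.subspace_scale[OF ssp]) (auto simp: subalg_def)
    let ?w = "y + l * v"
    have "?w * u + u * ?w = (y * u + u * y) + l * u + l * (u * v) + (u * l) * v"
      using vu by (simp add: algebra_simps)
    also have "\<dots> = 0" using k(2) lu by (simp flip: mult.assoc)
    finally have "?w * u = u * ?w" by (rule add0D[symmetric])
    then have w: "?w \<in> lin2 u"
      using y vQ lQ uu mult ssp by (intro C) (auto simp: vs.subspace_add)
    have "l \<in> quat u v"
      unfolding l_def using lin2_quat lin2I by (metis add.commute)
    then have "?w + l * v \<in> quat u v"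
      using quat_closed[OF P] lin2_quat[OF w] by (simp del: two_a' two_a)
    then show ?thesis by (simp add: add.assoc)
  qed
  then show thesis using that[OF uQ vQ us vs P] by blast
qed

text \<open>In <<1>>^r <<b>> every diagonal entry is 1 or b, so all values lie in F^2 + b F^2, in
  particular every slot of \<open>as\<close>. If all slots were squares, all values would be, but b
  is a value and not a square. A nonsquare slot can then replace b as generator of F^2 + b
  F^2.\<close>

lemma pf_index_corank_one:
  fixes as :: "'f list"
  assumes idx: "pf_index as r" and len: "length as = Suc r"
  obtains k where "k < length as" "\<And>c. as ! k \<noteq> c * c"
    "\<And>i. i < length as \<Longrightarrow> \<exists>c d. as ! i = c * c + d * d * as ! k"
proof -
  obtain bs where bs: "length bs = 1" "anisotropic (pfister bs)"
    and iso: "isometric (pfister as) (pfister (replicate r 1 @ bs))" (is "isometric ?a ?b")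
    using idx len unfolding pf_index_def by auto
  obtain b where b: "bs = [b]" using bs(1) by (auto simp: length_Suc_conv)
  have bset: "set ?b = {1, b}" unfolding set_pfister_ones b by auto
  have len': "length ?a = length ?b" using iso unfolding isometric_def by blast
  have bns: "b \<noteq> c * c" for c
  proof
    assume c: "b = c * c"
    \<comment> \<open>The vector (c, 1) is isotropic for <1, c^2>, as c^2 + c^2 = 0.\<close>
    let ?x = "\<lambda>i. if i = 0 then c else (1::'f)"
    have "(\<Sum>i<length (pfister bs). pfister bs ! i * ?x i * ?x i) = 0"
      unfolding b c by (simp add: numeral_2_eq_2)
    then have x0: "\<forall>i<length (pfister bs). ?x i = 0"
      by (rule mp[OF spec[OF bs(2)[unfolded anisotropic_def], of ?x]])
    have "1 < length (pfister bs)" unfolding b by simp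
    then show False using spec[OF x0, of 1] by simp
  qed
  have sub: "\<exists>c d. (\<Sum>i\<in>I. s i) = c * c + d * d * b"
    if "finite I" "\<And>i. i \<in> I \<Longrightarrow> \<exists>c d. s i = c * c + d * d * b" for I :: "nat set" and s
    using that
  proof (induction I rule: finite_induct)
    case empty then show ?case by (auto intro!: exI[of _ 0])
  next
    case (insert i I)
    obtain c d where 1: "s i = c * c + d * d * b" using insert.prems[of i] by blast
    obtain c' d' where 2: "sum s I = c' * c' + d' * d' * b"
      using insert.IH insert.prems by blast
    have "sum s (insert i I) = (c + c') * (c + c') + (d + d') * (d + d') * b"
      using insert.hyps 1 2 by (simp add: algebra_simps)
    then show ?case by blast
  qed
  have in_b: "\<exists>c d. as ! i = c * c + d * d * b" if i: "i < length as" for i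
  proof -
    have "as ! i \<in> set ?a" using i by (simp add: slot_in_pfister)
    then obtain j where j: "j < length ?a" "?a ! j = as ! i" by (metis in_set_conv_nth)
    obtain y where y: "?a ! j = (\<Sum>i<length ?a. ?b ! i * (y i * y i))"
      using isometric_represents[OF iso j(1)] by metis
    have "\<exists>c d. ?b ! m * (y m * y m) = c * c + d * d * b" if "m < length ?a" for m
    proof -
      have "?b ! m \<in> {1, b}" using that len' bset nth_mem by metis
      then consider "?b ! m * (y m * y m) = y m * y m + 0 * 0 * b"
        | "?b ! m * (y m * y m) = 0 * 0 + y m * y m * b" by auto
      then show ?thesis by cases blast+
    qed
    then show ?thesis using sub[of "{..<length ?a}"] y j(2) by simp
  qed
  have "\<exists>k<length as. \<forall>c. as ! k \<noteq> c * c"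
  proof (rule ccontr)
    assume "\<not> ?thesis"
    then have "\<forall>c\<in>set as. \<exists>d. c = d * d" by (metis in_set_conv_nth)
    then have sq: "\<forall>c\<in>set ?a. \<exists>d. c = d * d" by (rule set_pfister_squares)
    have "b \<in> set ?b" using bset by simp
    then obtain j where j: "j < length ?a" "?b ! j = b" using len' by (metis in_set_conv_nth)
    obtain x where x: "b = (\<Sum>i<length ?a. ?a ! i * (x i * x i))"
      using isometric_represents[OF iso j(1)] j(2) by metis
    have "\<exists>d. ?a ! i = d * d" if "i < length ?a" for i
      using sq that nth_mem by blast
    then obtain d where "\<And>i. i < length ?a \<Longrightarrow> ?a ! i = d i * d i" by metis
    then have "b = (\<Sum>i<length ?a. (d i * x i) * (d i * x i))"
      unfolding x by (intro sum.cong) (simp_all add: algebra_simps)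
    also have "\<dots> = (\<Sum>i<length ?a. d i * x i) * (\<Sum>i<length ?a. d i * x i)"
      by (rule sq_sum_f) simp
    finally show False using bns by blast
  qed
  then obtain k where k: "k < length as" "\<And>c. as ! k \<noteq> c * c" by blast
  obtain c d where cd: "as ! k = c * c + d * d * b" using in_b k(1) by blast
  have d0: "d \<noteq> 0"
  proof
    assume "d = 0"
    then have "as ! k = c * c" using cd by simp
    then show False using k(2) by blast
  qed
  have "\<exists>c d. as ! i = c * c + d * d * as ! k" if i: "i < length as" for i
  proof -
    obtain p q where pq: "as ! i = p * p + q * q * b" using in_b[OF i] by blast
    \<comment> \<open>Here \<open>as ! k\<close> = c^2 + d^2 b is solved for b; d is nonzero because
      \<open>as ! k\<close> is not a square.\<close>
    let ?q = "q / d"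
    have "as ! i = (p + ?q * c) * (p + ?q * c) + ?q * ?q * as ! k"
      unfolding pq cd using d0 by (simp add: field_simps)
    then show ?thesis by blast
  qed
  then show thesis using that k by blast
qed

section \<open>Normalizing a total decomposition\<close>

definition commuting :: "'a set \<Rightarrow> 'a \<Rightarrow> bool" where
  "commuting X z \<longleftrightarrow> (\<forall>x\<in>X. x * z = z * x)"

definition generated_by :: "'a set \<Rightarrow> 'a set \<Rightarrow> bool" where
  "generated_by X Y \<longleftrightarrow> (\<forall>B. subalg emb B \<longrightarrow> X \<subseteq> B \<longrightarrow> Y \<subseteq> B)"

text \<open>The factors are recorded by generators, so that two of them can be traded for two others
  without touching the rest; generation replaces the spanning condition of a decomposition.\<close>

definition frame :: "nat \<Rightarrow> (nat \<Rightarrow> 'f) \<Rightarrow> (nat \<Rightarrow> 'f) \<Rightarrow> (nat \<Rightarrow> 'a) \<Rightarrow> (nat \<Rightarrow> 'a) \<Rightarrow> bool" where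
  "frame n a b U V \<longleftrightarrow>
    (\<forall>i<n. \<sigma> (U i) = U i \<and> \<sigma> (V i) = V i \<and> quat_pair (a i) (b i) (U i) (V i)) \<and>
    (\<forall>i<n. \<forall>j<n. i \<noteq> j \<longrightarrow> (\<forall>x\<in>{U i, V i}. \<forall>y\<in>{U j, V j}. x * y = y * x)) \<and>
    generated_by (\<Union>i<n. {U i, V i}) UNIV"

lemma subalg_closed:
  assumes "subalg emb B"
  shows "emb c \<in> B" "1 \<in> B" "0 \<in> B" "x \<in> B \<Longrightarrow> y \<in> B \<Longrightarrow> x + y \<in> B"
    "x \<in> B \<Longrightarrow> y \<in> B \<Longrightarrow> x * y \<in> B"
proof -
  show e: "emb c \<in> B" for c using assms unfolding subalg_def by blast
  show "1 \<in> B" "0 \<in> B" using e[of 1] e[of 0] by simp_all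
qed (use assms in \<open>unfold subalg_def, blast+\<close>)

lemma subalg_centralizer_of: "subalg emb {x. x * z = z * x}"
  unfolding subalg_def by (auto simp: emb_comm algebra_simps) (metis mult.assoc)

lemma generated_by_commute:
  assumes "generated_by X Y" "\<And>x. x \<in> X \<Longrightarrow> x * z = z * x" "y \<in> Y"
  shows "y * z = z * y"
  using assms subalg_centralizer_of[of z] unfolding generated_by_def by blast

lemma quat_pair_scale:
  assumes "quat_pair a b U V" "c \<noteq> 0"
  shows "quat_pair (c * c * a) b (emb c * U) V"
  using assms quat_pairD[OF assms(1)] unfolding quat_pair_def
  by (simp add: emb_simps emb_left[of U] emb_left[of V])

text \<open>The alternating elements s = u1 + d u and w = u u1 have alternating product, so they are adapted
  to a decomposition; s^2 = 1 makes its second factor split with the transposition.\<close>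

lemma merge_pairs_unit:
  assumes P0: "quat_pair a0 b0 u v" and P1: "quat_pair a1 b1 u1 v1"
    and sym: "\<sigma> u = u" "\<sigma> v = v" "\<sigma> u1 = u1" "\<sigma> v1 = v1"
    and comm: "u1 * u = u * u1" "v1 * u = u * v1" "v * u1 = u1 * v" "v1 * v = v * v1"
    and a1: "a1 = 1 + d * d * a0"
  obtains b' w v' s p where "\<sigma> w = w" "\<sigma> v' = v'" "\<sigma> s = s" "\<sigma> p = p"
    "quat_pair (a0 * a1) b' w v'" "quat_pair 1 0 s p"
    "\<And>x y. x \<in> {w, v'} \<Longrightarrow> y \<in> {s, p} \<Longrightarrow> x * y = y * x"
    "generated_by {w, v', s, p} {u, v, u1, v1}" "generated_by {u, v, u1, v1} {w, v', s, p}"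
proof -
  note Q0 = quat_pairD[OF P0] and Q1 = quat_pairD[OF P1]
  have comm': "u1 * (u * z) = u * (u1 * z)" "v1 * (u * z) = u * (v1 * z)"
    "v * (u1 * z) = u1 * (v * z)" "v1 * (v * z) = v * (v1 * z)" for z
    using comm by (metis mult.assoc)+
  note rew = Q0(2-) Q1(2-) comm comm' emb_simps
    emb_left[of u] emb_left[of u1] emb_left[of v] emb_left[of v1]
  define b where "b = b0 + b1"
  define w where "w = u * u1"
  define s where "s = u1 + emb d * u"
  \<comment> \<open>t = v + v1 satisfies t^2 = t + b and t s = s t + s. Since s^2 = 1, adding b (1 +
    s) makes it idempotent.\<close>
  define p where "p = v + v1 + emb b + emb b * s"
  \<comment> \<open>This is u1 s, so that u1 = h s and d u = (1 + h) s. With these weights the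
    commutators of h v and (1 + h) v1 with s cancel, so v' commutes with s.\<close>
  define h where "h = emb a1 + emb d * w"
  define v' where "v' = h * v + (1 + h) * v1"
  note defs = v'_def h_def p_def s_def w_def b_def a1
  have 1: "\<sigma> w = w" "\<sigma> s = s" "\<sigma> p = p" "\<sigma> v' = v'"
    unfolding defs using sym
    by (simp_all add: inv_add inv_mult inv_scale rew[unfolded a1])
  have 2: "quat_pair (a0 * a1) (a1 * b0 + d * d * a0 * b1) w v'"
  proof -
    have "w * w = emb (a0 * a1)" "v' * v' = v' + emb (a1 * b0 + d * d * a0 * b1)"
      "v' * w = w * v' + w"
      unfolding defs by (simp_all add: rew[unfolded a1])
    then show ?thesis unfolding quat_pair_def using Q0(1) Q1(1) by simp
  qed
  have 3: "quat_pair 1 0 s p"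
    unfolding quat_pair_def unfolding defs by (simp add: rew[unfolded a1])
  have 4: "w * s = s * w" "w * p = p * w" "v' * s = s * v'" "v' * p = p * v'"
    unfolding defs by (simp_all add: rew[unfolded a1])
  have R: "u1 = h * s" "u = emb (inverse a1) * (w * (h * s))"
    "v1 = v' + h * (p + emb b + emb b * s)" "v = v1 + p + emb b + emb b * s"
  proof -
    show u1: "u1 = h * s" unfolding defs by (simp add: rew[unfolded a1])
    have "w * u1 = emb a1 * u" unfolding defs by (simp add: rew[unfolded a1])
    then show "u = emb (inverse a1) * (w * (h * s))"
      unfolding u1[symmetric] using Q1(1) by (simp add: emb_mult_assoc)
    show "v = v1 + p + emb b + emb b * s" unfolding p_def by (simp add: algebra_simps)
    show "v1 = v' + h * (p + emb b + emb b * s)"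
      unfolding v'_def p_def by (simp add: algebra_simps)
  qed
  have 5: "generated_by {w, v', s, p} {u, v, u1, v1}"
    unfolding generated_by_def
  proof (intro allI impI)
    fix B assume B: "subalg emb B" "{w, v', s, p} \<subseteq> B"
    note cl = subalg_closed[OF B(1)]
    have m: "w \<in> B" "v' \<in> B" "s \<in> B" "p \<in> B" using B(2) by auto
    have h: "h \<in> B" unfolding h_def by (intro cl m)
    have "u1 \<in> B" by (subst R(1)) (intro cl m h)
    moreover have "u \<in> B" by (subst R(2)) (intro cl m h)
    moreover have v1: "v1 \<in> B" by (subst R(3)) (intro cl m h)
    moreover have "v \<in> B" by (subst R(4)) (intro cl m h v1)
    ultimately show "{u, v, u1, v1} \<subseteq> B" by simp
  qed
  have 6: "generated_by {u, v, u1, v1} {w, v', s, p}"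
    unfolding generated_by_def
  proof (intro allI impI)
    fix B assume B: "subalg emb B" "{u, v, u1, v1} \<subseteq> B"
    note cl = subalg_closed[OF B(1)]
    have m: "u \<in> B" "v \<in> B" "u1 \<in> B" "v1 \<in> B" using B(2) by auto
    have "w \<in> B" "s \<in> B" "p \<in> B" "v' \<in> B" unfolding v'_def h_def p_def s_def w_def
      by (intro cl m)+
    then show "{w, v', s, p} \<subseteq> B" by simp
  qed
  show thesis using that[OF 1(1,4,2,3) 2 3 _ 5 6] 4 by blast
qed

text \<open>The counterpart for a1 in a0 F^2, scaled so that s = u u1 has square 1. Now u is kept. v
  and v1 have the same commutator s with s, so v + v1 commutes with s; adding b1 (1 + s) to v1 makes
  it idempotent.\<close>

lemma merge_pairs_inverse:
  assumes P0: "quat_pair a0 b0 u v" and P1: "quat_pair a1 b1 u1 v1"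
    and sym: "\<sigma> u = u" "\<sigma> v = v" "\<sigma> u1 = u1" "\<sigma> v1 = v1"
    and comm: "u1 * u = u * u1" "v1 * u = u * v1" "v * u1 = u1 * v" "v1 * v = v * v1"
    and a1: "a0 * a1 = 1"
  obtains b' w v' s p where "\<sigma> w = w" "\<sigma> v' = v'" "\<sigma> s = s" "\<sigma> p = p"
    "quat_pair a0 b' w v'" "quat_pair 1 0 s p"
    "\<And>x y. x \<in> {w, v'} \<Longrightarrow> y \<in> {s, p} \<Longrightarrow> x * y = y * x"
    "generated_by {w, v', s, p} {u, v, u1, v1}" "generated_by {u, v, u1, v1} {w, v', s, p}"
proof -
  note Q0 = quat_pairD[OF P0] and Q1 = quat_pairD[OF P1]
  have comm': "u1 * (u * z) = u * (u1 * z)" "v1 * (u * z) = u * (v1 * z)"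
    "v * (u1 * z) = u1 * (v * z)" "v1 * (v * z) = v * (v1 * z)" for z
    using comm by (metis mult.assoc)+
  have a1': "a1 * a0 = 1" "a0 * (a1 * z) = z" "a1 * (a0 * z) = z" for z
    using a1 by (simp_all add: mult.commute flip: mult.assoc)
  note rew = Q0(2-) Q1(2-) comm comm' emb_simps a1 a1'
    emb_left[of u] emb_left[of u1] emb_left[of v] emb_left[of v1]
  define s where "s = u * u1"
  define p where "p = v1 + emb b1 + emb b1 * s"
  define v' where "v' = v + v1"
  note defs = v'_def p_def s_def
  have 1: "\<sigma> s = s" "\<sigma> p = p" "\<sigma> v' = v'"
    unfolding defs using sym by (simp_all add: inv_add inv_mult inv_scale rew)
  have 2: "quat_pair a0 (b0 + b1) u v'"
    unfolding quat_pair_def using Q0(1) Q1(1) unfolding defs by (simp add: rew)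
  have 3: "quat_pair 1 0 s p"
    unfolding quat_pair_def unfolding defs by (simp add: rew)
  have 4: "u * s = s * u" "u * p = p * u" "v' * s = s * v'" "v' * p = p * v'"
    unfolding defs by (simp_all add: rew)
  have R: "u1 = emb a1 * (u * s)" "v1 = p + emb b1 + emb b1 * s" "v = v' + v1"
    unfolding defs by (simp_all add: rew)
  have 5: "generated_by {u, v', s, p} {u, v, u1, v1}"
    unfolding generated_by_def
  proof (intro allI impI)
    fix B assume B: "subalg emb B" "{u, v', s, p} \<subseteq> B"
    note cl = subalg_closed[OF B(1)]
    have m: "u \<in> B" "v' \<in> B" "s \<in> B" "p \<in> B" using B(2) by auto
    have "u1 \<in> B" by (subst R(1)) (intro cl m)
    moreover have v1: "v1 \<in> B" by (subst R(2)) (intro cl m)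
    moreover have "v \<in> B" by (subst R(3)) (intro cl m v1)
    ultimately show "{u, v, u1, v1} \<subseteq> B" using m by simp
  qed
  have 6: "generated_by {u, v, u1, v1} {u, v', s, p}"
    unfolding generated_by_def
  proof (intro allI impI)
    fix B assume B: "subalg emb B" "{u, v, u1, v1} \<subseteq> B"
    note cl = subalg_closed[OF B(1)]
    have m: "u \<in> B" "v \<in> B" "u1 \<in> B" "v1 \<in> B" using B(2) by auto
    have "s \<in> B" "p \<in> B" "v' \<in> B" unfolding v'_def p_def s_def
      by (intro cl m)+
    then show "{u, v', s, p} \<subseteq> B" using m by simp
  qed
  show thesis using that[OF sym(1) 1(3,1,2) 2 3 _ 5 6] 4 by blast
qed

text \<open>Scaling u1 by e multiplies a1 by e^2. For c nonzero, e = 1 / c gives the shape 1 + d^2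
  a0; for c = 0, e = 1 / (d a0) makes the product of the two slots 1. In the first case a' = a0 + (e
  d a0)^2, so a' is again a nonsquare and a0 lies in F^2 + a' F^2.\<close>

lemma merge_pairs:
  assumes P0: "quat_pair a0 b0 u v" and P1: "quat_pair a1 b1 u1 v1"
    and sym: "\<sigma> u = u" "\<sigma> v = v" "\<sigma> u1 = u1" "\<sigma> v1 = v1"
    and comm: "u1 * u = u * u1" "v1 * u = u * v1" "v * u1 = u1 * v" "v1 * v = v * v1"
    and a1: "a1 = c * c + d * d * a0" and ns: "\<And>k. a0 \<noteq> k * k"
  obtains w v' s p a' b' t r where "\<sigma> w = w" "\<sigma> v' = v'" "\<sigma> s = s" "\<sigma> p = p"
    "quat_pair a' b' w v'" "quat_pair 1 0 s p"
    "\<And>x y. x \<in> {w, v'} \<Longrightarrow> y \<in> {s, p} \<Longrightarrow> x * y = y * x"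
    "generated_by {w, v', s, p} {u, v, u1, v1}" "generated_by {u, v, u1, v1} {w, v', s, p}"
    "\<And>k. a' \<noteq> k * k" "a0 = t * t + r * r * a'"
proof -
  have scaled: "quat_pair (e * e * a1) b1 (emb e * u1) v1" "\<sigma> (emb e * u1) = emb e * u1"
      "(emb e * u1) * u = u * (emb e * u1)" "v * (emb e * u1) = (emb e * u1) * v"
      "generated_by X {u, v, emb e * u1, v1} \<Longrightarrow> generated_by X {u, v, u1, v1}"
      "generated_by {u, v, emb e * u1, v1} X \<Longrightarrow> generated_by {u, v, u1, v1} X"
    if e: "e \<noteq> 0" for e X
  proof -
    show "quat_pair (e * e * a1) b1 (emb e * u1) v1" using quat_pair_scale[OF P1 e] .
    show "\<sigma> (emb e * u1) = emb e * u1" using sym by (simp add: inv_scale)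
    show "(emb e * u1) * u = u * (emb e * u1)" "v * (emb e * u1) = (emb e * u1) * v"
      using comm by (simp_all add: emb_left[of u] emb_left[of v] mult.assoc)
    have eq: "u1 = emb (inverse e) * (emb e * u1)" using e by (simp add: emb_mult_assoc)
    have iff: "emb e * u1 \<in> B \<longleftrightarrow> u1 \<in> B" if B: "subalg emb B" for B
      using subalg_closed(1,5)[OF B] eq by metis
    show "generated_by X {u, v, emb e * u1, v1} \<Longrightarrow> generated_by X {u, v, u1, v1}"
      "generated_by {u, v, emb e * u1, v1} X \<Longrightarrow> generated_by {u, v, u1, v1} X"
      unfolding generated_by_def using iff by simp_all
  qed
  show thesis
  proof (cases "c = 0")
    case False
    define e where "e = inverse c"
    have e0: "e \<noteq> 0" and "e * c = 1" using False unfolding e_def by simp_all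
    have "e * e * a1 = (e * c) * (e * c) + (e * d) * (e * d) * a0"
      unfolding a1 by (simp add: algebra_simps)
    then have eq: "e * e * a1 = 1 + (e * d) * (e * d) * a0" using \<open>e * c = 1\<close> by simp
    note S = scaled[OF e0]
    obtain b' w v' s p where *: "\<sigma> w = w" "\<sigma> v' = v'" "\<sigma> s = s" "\<sigma> p = p"
      "quat_pair (a0 * (e * e * a1)) b' w v'" "quat_pair 1 0 s p"
      "\<And>x y. x \<in> {w, v'} \<Longrightarrow> y \<in> {s, p} \<Longrightarrow> x * y = y * x"
      "generated_by {w, v', s, p} {u, v, emb e * u1, v1}"
      "generated_by {u, v, emb e * u1, v1} {w, v', s, p}"
      using merge_pairs_unit[OF P0 S(1) sym(1,2) S(2) sym(4) S(3) comm(2) S(4) comm(4) eq]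
      by metis
    let ?m = "e * d * a0"
    have a': "a0 * (e * e * a1) = a0 + ?m * ?m" unfolding eq by (simp add: algebra_simps)
    have "a0 * (e * e * a1) \<noteq> k * k" for k
    proof
      assume "a0 * (e * e * a1) = k * k"
      then have "a0 = (k + ?m) * (k + ?m)"
        unfolding a' sq_add_f by (metis add.commute two_f')
      then show False using ns by blast
    qed
    moreover have "a0 = ?m * ?m + 1 * 1 * (a0 * (e * e * a1))" unfolding a' by (simp add: add.left_commute)
    ultimately show thesis
      using that[OF *(1-7) S(5)[OF *(8)] S(6)[OF *(9)]] by blast
  next
    case True
    have a10: "a1 \<noteq> 0" "a0 \<noteq> 0" using quat_pairD(1)[OF P0] quat_pairD(1)[OF P1] by auto
    then have d0: "d \<noteq> 0" using a1 True by auto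
    define e where "e = inverse (d * a0)"
    have e0: "e \<noteq> 0" unfolding e_def using d0 a10 by simp
    have eq: "a0 * (e * e * a1) = 1"
      unfolding a1 True e_def using d0 a10 by (simp add: field_simps)
    note S = scaled[OF e0]
    obtain b' w v' s p where *: "\<sigma> w = w" "\<sigma> v' = v'" "\<sigma> s = s" "\<sigma> p = p"
      "quat_pair a0 b' w v'" "quat_pair 1 0 s p"
      "\<And>x y. x \<in> {w, v'} \<Longrightarrow> y \<in> {s, p} \<Longrightarrow> x * y = y * x"
      "generated_by {w, v', s, p} {u, v, emb e * u1, v1}"
      "generated_by {u, v, emb e * u1, v1} {w, v', s, p}"
      using merge_pairs_inverse[OF P0 S(1) sym(1,2) S(2) sym(4) S(3) comm(2) S(4) comm(4) eq]
      by metis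
    have "a0 = 0 * 0 + 1 * 1 * a0" by simp
    then show thesis
      using that[OF *(1-7) S(5)[OF *(8)] S(6)[OF *(9)] ns] by blast
  qed
qed

lemma frameD:
  assumes "frame n a b U V" "i < n"
  shows "\<sigma> (U i) = U i" "\<sigma> (V i) = V i" "quat_pair (a i) (b i) (U i) (V i)"
    "j < n \<Longrightarrow> i \<noteq> j \<Longrightarrow> x \<in> {U i, V i} \<Longrightarrow> y \<in> {U j, V j} \<Longrightarrow> x * y = y * x"
  using assms unfolding frame_def by blast+

lemma frame_of_decomposition:
  assumes orth: "1 \<notin> Alt UNIV \<sigma>" and td: "tot_decomp emb \<sigma> n Qs"
    and disc: "\<And>i. i < n \<Longrightarrow> disc_rep emb (Qs i) \<sigma> (a i)"
  obtains b U V where "frame n a b U V"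
proof -
  have "\<exists>u v b. u \<in> Qs i \<and> v \<in> Qs i \<and> \<sigma> u = u \<and> \<sigma> v = v \<and> quat_pair (a i) b u v \<and> Qs i \<subseteq> quat u v"
    if i: "i < n" for i
  proof -
    have "quat_subalg emb (Qs i)" "\<sigma> ` Qs i \<subseteq> Qs i"
      using td i unfolding tot_decomp_def by auto
    from quat_pair_of_disc[OF this orth disc[OF i]] show ?thesis by metis
  qed
  then obtain U V b where UV: "\<And>i. i < n \<Longrightarrow> U i \<in> Qs i \<and> V i \<in> Qs i \<and> \<sigma> (U i) = U i \<and>
      \<sigma> (V i) = V i \<and> quat_pair (a i) (b i) (U i) (V i) \<and> Qs i \<subseteq> quat (U i) (V i)"
    by metis
  have gen: "generated_by (\<Union>i<n. {U i, V i}) UNIV"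
    unfolding generated_by_def
  proof (intro allI impI)
    fix B assume B: "subalg emb B" "(\<Union>i<n. {U i, V i}) \<subseteq> B"
    note cl = subalg_closed[OF B(1)]
    have QB: "Qs i \<subseteq> B" if i: "i < n" for i
    proof -
      have "U i \<in> B" "V i \<in> B" using B(2) i by auto
      then have "quat (U i) (V i) \<subseteq> B" unfolding quat_def by (auto intro!: cl)
      then show ?thesis using UV[OF i] by blast
    qed
    have PB: "prod_list (map f js) \<in> B" if "set js \<subseteq> {..<n}" "\<forall>i<n. f i \<in> Qs i" for f js
      using that(1)
    proof (induction js)
      case (Cons j js)
      then have "f j \<in> B" "prod_list (map f js) \<in> B" using QB[of j] that(2) by auto
      then show ?case by (simp add: cl)
    qed (simp add: cl)
    then have "{prod_list (map f [0..<n]) | f. \<forall>i<n. f i \<in> Qs i} \<subseteq> B"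
      by (auto intro!: PB)
    moreover have "vs.subspace B" unfolding vs.subspace_def using cl by blast
    ultimately have "vs.span {prod_list (map f [0..<n]) | f. \<forall>i<n. f i \<in> Qs i} \<subseteq> B"
      by (rule vs.span_minimal)
    then show "UNIV \<subseteq> B" using td unfolding tot_decomp_def by simp
  qed
  have "x * y = y * x" if "i < n" "j < n" "i \<noteq> j" "x \<in> {U i, V i}" "y \<in> {U j, V j}" for i j x y
  proof -
    have "x \<in> Qs i" "y \<in> Qs j" using UV that by auto
    then show ?thesis using td that(1-3) unfolding tot_decomp_def by blast
  qed
  then have "frame n a b U V" unfolding frame_def using UV gen by blast
  then show thesis by (rule that)
qed

text \<open>The new generators lie in the subalgebra generated by the four old ones, so whatever
  commutes with the old ones commutes with the new ones; the other factors stay in place.\<close>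

lemma frame_merge:
  assumes F: "frame n a b U V" and km: "k < n" "m < n" "m \<noteq> k"
    and ns: "\<And>c. a k \<noteq> c * c" and am: "a m = c * c + d * d * a k"
  obtains a' b' w v' s p t r where
    "frame n (a(k := a', m := 1)) (b(k := b', m := 0)) (U(k := w, m := s)) (V(k := v', m := p))"
    "\<And>k. a' \<noteq> k * k" "a k = t * t + r * r * a'"
proof -
  note Fk = frameD[OF F km(1)] and Fm = frameD[OF F km(2)]
  have comm: "U m * U k = U k * U m" "V m * U k = U k * V m" "V k * U m = U m * V k"
    "V m * V k = V k * V m"
    using Fm(4)[OF km(1,3), of "U m" "U k"] Fm(4)[OF km(1,3), of "V m" "U k"]
      Fm(4)[OF km(1,3), of "U m" "V k"] Fm(4)[OF km(1,3), of "V m" "V k"] by simp_all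
  show thesis
  proof (rule merge_pairs[OF Fk(3) Fm(3) Fk(1,2) Fm(1,2) comm am ns])
  fix w v' s p a' b' t r
  assume *: "\<sigma> w = w" "\<sigma> v' = v'" "\<sigma> s = s" "\<sigma> p = p"
    "quat_pair a' b' w v'" "quat_pair 1 0 s p"
    "\<And>x y. x \<in> {w, v'} \<Longrightarrow> y \<in> {s, p} \<Longrightarrow> x * y = y * x"
    "generated_by {w, v', s, p} {U k, V k, U m, V m}"
    "generated_by {U k, V k, U m, V m} {w, v', s, p}"
    "\<And>k. a' \<noteq> k * k" "a k = t * t + r * r * a'"
  define U' V' where "U' = U(k := w, m := s)" and "V' = V(k := v', m := p)"
  have UV': "U' k = w" "V' k = v'" "U' m = s" "V' m = p"
    "\<And>i. i \<noteq> k \<Longrightarrow> i \<noteq> m \<Longrightarrow> U' i = U i" "\<And>i. i \<noteq> k \<Longrightarrow> i \<noteq> m \<Longrightarrow> V' i = V i"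
    unfolding U'_def V'_def using km by auto
  have out: "x * y = y * x"
    if i: "i < n" "i \<noteq> k" "i \<noteq> m" "y \<in> {U i, V i}" and x: "x \<in> {w, v', s, p}" for i x y
  proof (rule generated_by_commute[OF *(9) _ x])
    fix z assume "z \<in> {U k, V k, U m, V m}"
    then show "z * y = y * z" using Fk(4)[OF i(1) i(2)[symmetric] _ i(4)] Fm(4)[OF i(1) i(3)[symmetric] _ i(4)] by blast
  qed
  have "x * y = y * x" if ij: "i < n" "j < n" "i \<noteq> j" and x: "x \<in> {U' i, V' i}" and y: "y \<in> {U' j, V' j}" for i j x y
  proof -
    consider "i = k" "j = m" | "i = m" "j = k" | "i \<in> {k, m}" "j \<noteq> k" "j \<noteq> m"
      | "j \<in> {k, m}" "i \<noteq> k" "i \<noteq> m" | "i \<noteq> k" "i \<noteq> m" "j \<noteq> k" "j \<noteq> m"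
      using ij(3) by blast
    then show ?thesis
    proof cases
      case 1 then show ?thesis using *(7)[of x y] x y UV' by simp
    next
      case 2 then show ?thesis using *(7)[of y x] x y UV' by simp
    next
      case 3
      then have "x \<in> {w, v', s, p}" using x UV' by auto
      then show ?thesis using out[OF ij(2) 3(2,3)] y UV' 3 by simp
    next
      case 4
      then have "y \<in> {w, v', s, p}" using y UV' by auto
      then show ?thesis using out[OF ij(1) 4(2,3), of x y] x UV' 4 by simp
    next
      case 5
      then show ?thesis using frameD(4)[OF F ij, of x y] x y UV' by simp
    qed
  qed
  moreover have "\<sigma> (U' i) = U' i \<and> \<sigma> (V' i) = V' i \<and>
      quat_pair ((a(k := a', m := 1)) i) ((b(k := b', m := 0)) i) (U' i) (V' i)" if "i < n" for i
    using frameD(1-3)[OF F that] *(1-6) UV' km(3) by (cases "i = k"; cases "i = m") auto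
  moreover have "generated_by (\<Union>i<n. {U' i, V' i}) UNIV"
    unfolding generated_by_def
  proof (intro allI impI)
    fix B assume B: "subalg emb B" "(\<Union>i<n. {U' i, V' i}) \<subseteq> B"
    have in': "U' i \<in> B" "V' i \<in> B" if "i < n" for i using B(2) that by auto
    have km': "{U k, V k, U m, V m} \<subseteq> B"
      using *(8) B(1) in'[OF km(1)] in'[OF km(2)] UV' unfolding generated_by_def by simp
    have "{U i, V i} \<subseteq> B" if "i < n" for i
      using in'[OF that] km' UV'(5,6)[of i] by (cases "i = k"; cases "i = m") auto
    then have "(\<Union>i<n. {U i, V i}) \<subseteq> B" by blast
    then show "UNIV \<subseteq> B" using F B(1) unfolding frame_def generated_by_def by blast
  qed
  ultimately have "frame n (a(k := a', m := 1)) (b(k := b', m := 0)) U' V'"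
    unfolding frame_def by blast
  then show thesis unfolding U'_def V'_def using that *(10,11) by blast
  qed
qed

text \<open>The factor k absorbs the slots of the others one by one. Since the old
  \<open>a k\<close> is t^2 + r^2 a', every slot lies in F^2 + a' F^2 and stays eligible for the
  next merge.\<close>

lemma frame_normalize:
  assumes "frame n a b U V" "k < n" "\<And>c. a k \<noteq> c * c"
    and "\<And>i. i < n \<Longrightarrow> \<exists>c d. a i = c * c + d * d * a k"
  shows "m \<le> n \<Longrightarrow> \<exists>a b U V. frame n a b U V \<and> (\<forall>c. a k \<noteq> c * c) \<and>
    (\<forall>i<n. \<exists>c d. a i = c * c + d * d * a k) \<and> (\<forall>i<m. i \<noteq> k \<longrightarrow> a i = 1 \<and> b i = 0)"
proof (induction m)
  case 0 then show ?case using assms by blast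
next
  case (Suc m)
  then obtain a b U V where F: "frame n a b U V" and ns: "\<And>c. a k \<noteq> c * c"
    and rep: "\<And>i. i < n \<Longrightarrow> \<exists>c d. a i = c * c + d * d * a k"
    and one: "\<And>i. i < m \<Longrightarrow> i \<noteq> k \<Longrightarrow> a i = 1 \<and> b i = 0" by auto
  show ?case
  proof (cases "m = k")
    case True
    then show ?thesis using F ns rep one less_Suc_eq by blast
  next
    case False
    have mn: "m < n" using Suc by simp
    obtain c d where cd: "a m = c * c + d * d * a k" using rep[OF mn] by blast
    obtain a' b' w v' s p t r where *:
      "frame n (a(k := a', m := 1)) (b(k := b', m := 0)) (U(k := w, m := s)) (V(k := v', m := p))"
      "\<And>k. a' \<noteq> k * k" "a k = t * t + r * r * a'"
      using frame_merge[OF F assms(2) mn False ns cd] by metis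
    let ?a = "a(k := a', m := 1)" and ?b = "b(k := b', m := 0)"
    have ak: "?a k = a'" using False by simp
    have "\<exists>c d. ?a i = c * c + d * d * ?a k" if i: "i < n" for i
    proof -
      consider "i = m" | "i = k" "i \<noteq> m" | "i \<noteq> m" "i \<noteq> k" by blast
      then show ?thesis
      proof cases
        case 1 then show ?thesis by (intro exI[of _ 1] exI[of _ 0]) simp
      next
        case 2 then show ?thesis using False by (intro exI[of _ 0] exI[of _ 1]) simp
      next
        case 3
        obtain c d where "a i = c * c + d * d * a k" using rep[OF i] by blast
        then have "?a i = (c + d * t) * (c + d * t) + (d * r) * (d * r) * ?a k"
          unfolding *(3) ak using 3 by (simp add: algebra_simps)
        then show ?thesis by blast
      qed
    qed
    moreover have "\<forall>i<Suc m. i \<noteq> k \<longrightarrow> ?a i = 1 \<and> ?b i = 0"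
      using one by (simp add: less_Suc_eq)
    ultimately have "frame n ?a ?b (U(k := w, m := s)) (V(k := v', m := p)) \<and> (\<forall>c. ?a k \<noteq> c * c) \<and>
        (\<forall>i<n. \<exists>c d. ?a i = c * c + d * d * ?a k) \<and> (\<forall>i<Suc m. i \<noteq> k \<longrightarrow> ?a i = 1 \<and> ?b i = 0)"
      using *(1,2) unfolding ak by blast
    then show ?thesis by (intro exI)
  qed
qed

section \<open>A corner of dimension four\<close>

text \<open>These are the squares of the elements of F(u) when u^2 = a.\<close>

definition nsq :: "'f \<Rightarrow> 'f set" where
  "nsq a = {c * c + d * d * a | c d. True}"

lemma nsq_add: "x \<in> nsq a \<Longrightarrow> y \<in> nsq a \<Longrightarrow> x + y \<in> nsq a"
proof -
  assume "x \<in> nsq a" "y \<in> nsq a"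
  then obtain c d c' d' where "x = c * c + d * d * a" "y = c' * c' + d' * d' * a"
    unfolding nsq_def by blast
  then have "x + y = (c + c') * (c + c') + (d + d') * (d + d') * a" by (simp add: algebra_simps)
  then show ?thesis unfolding nsq_def by blast
qed

lemma nsq_scale: "x \<in> nsq a \<Longrightarrow> c * c * x \<in> nsq a"
proof -
  assume "x \<in> nsq a"
  then obtain d d' where "x = d * d + d' * d' * a" unfolding nsq_def by blast
  then have "c * c * x = (c * d) * (c * d) + (c * d') * (c * d') * a" by (simp add: algebra_simps)
  then show ?thesis unfolding nsq_def by blast
qed

lemma nsq_0: "0 \<in> nsq a" unfolding nsq_def by (auto intro!: exI[of _ 0])

text \<open>The last clause computes sigma(y) y modulo F u e: with q = k + r v, where k and r lie in F(u), one
  has sigma(q) q = r^2 v + k^2 + b r^2 + f u, and these values are closed under addition.\<close>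

definition corner :: "'f \<Rightarrow> 'f \<Rightarrow> 'a \<Rightarrow> 'a \<Rightarrow> 'a \<Rightarrow> bool" where
  "corner a b u v e \<longleftrightarrow> quat_pair a b u v \<and> \<sigma> u = u \<and> \<sigma> v = v \<and>
    e \<noteq> 0 \<and> e * e = e \<and> \<sigma> e = e \<and> e * u = u * e \<and> e * v = v * e \<and>
    (\<forall>z. \<exists>q\<in>quat u v. e * z * e = q * e) \<and>
    (\<forall>y. y * e = y \<longrightarrow> (\<exists>R\<in>nsq a. \<exists>L\<in>nsq a. \<exists>f.
      \<sigma> y * y = (emb R * v + emb (L + b * R) + emb f * u) * e))"

text \<open>\<sigma>(u v) = v u = u v + u, so q + \<sigma> q is a multiple of u. For q = (p + q1 u)
  + (r + s u) v, the witnesses are R = (r + s u)^2 and L = (p + q1 u)^2.\<close>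

lemma quat_inv:
  assumes P: "quat_pair a b u v" and "\<sigma> u = u" "\<sigma> v = v" "q \<in> quat u v"
  shows "\<exists>f. q + \<sigma> q = emb f * u" "\<sigma> q \<in> quat u v"
    "\<exists>R\<in>nsq a. \<exists>L\<in>nsq a. \<exists>f. \<sigma> q * q = emb R * v + emb (L + b * R) + emb f * u"
proof -
  note P' = quat_pairD[OF P]
  obtain p q1 r s where q: "q = emb p + emb q1 * u + emb r * v + emb s * (u * v)"
    using assms(4) unfolding quat_def by blast
  have \<sigma>q: "\<sigma> q = emb p + emb (q1 + s) * u + emb r * v + emb s * (u * v)"
    unfolding q using assms(2,3) P' by (simp add: inv_add inv_mult emb_simps emb_left[of u] emb_left[of v])
  show "\<sigma> q \<in> quat u v" unfolding \<sigma>q by (rule quatI)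
  have "q + \<sigma> q = emb s * u" unfolding \<sigma>q unfolding q by (simp add: emb_simps)
  then show "\<exists>f. q + \<sigma> q = emb f * u" by blast
  have "\<sigma> q * q = emb (r * r + s * s * a) * v + emb ((p * p + q1 * q1 * a) + b * (r * r + s * s * a)) +
      emb (p * s + q1 * r) * u"
    unfolding \<sigma>q unfolding q using P' by (simp add: emb_simps emb_left[of u] emb_left[of v])
  then show "\<exists>R\<in>nsq a. \<exists>L\<in>nsq a. \<exists>f. \<sigma> q * q = emb R * v + emb (L + b * R) + emb f * u"
    unfolding nsq_def by blast
qed

text \<open>e is the product of the idempotents \<open>V i\<close> with i different from k. The left
  ideal A e is spanned by elements g q e, with g a product of the remaining \<open>U i\<close> and q
  in the k-th factor; compressing such a g by e gives 0 or e.\<close>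

lemma corner_of_frame:
  assumes F: "frame n a b U V" and k: "k < n"
    and one: "\<And>i. i < n \<Longrightarrow> i \<noteq> k \<Longrightarrow> a i = 1 \<and> b i = 0"
    and cent: "centralizer UNIV UNIV = range emb"
  obtains e where "corner (a k) (b k) (U k) (V k) e"
proof -
  define u v where "u = U k" and "v = V k"
  define J where "J = {i. i < n \<and> i \<noteq> k}"
  note Fk = frameD[OF F k]
  have P: "quat_pair (a k) (b k) u v" and us: "\<sigma> u = u" and vs: "\<sigma> v = v"
    using Fk unfolding u_def v_def by auto
  have sym: "\<sigma> (U i) = U i" "\<sigma> (V i) = V i" and UU: "U i * U i = 1" and VV: "V i * V i = V i"
    and VU: "V i * U i = U i * V i + U i" if "i \<in> J" for i
    using frameD(1-3)[OF F, of i] one[of i] that quat_pairD(2-4)[of 1 0 "U i" "V i"]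
    unfolding J_def by auto
  have cm: "x * y = y * x" if "i \<in> J" "j \<in> J" "i \<noteq> j" "x \<in> {U i, V i}" "y \<in> {U j, V j}" for i j x y
    using frameD(4)[OF F, of i j x y] that unfolding J_def by auto
  have cmUU: "U i * U j = U j * U i" if "i \<in> J" "j \<in> J" for i j
    using cm[OF that, of "U i" "U j"] by (cases "i = j") auto
  have cmVV: "V i * V j = V j * V i" if "i \<in> J" "j \<in> J" for i j
    using cm[OF that, of "V i" "V j"] by (cases "i = j") auto
  have cmVU: "V i * U j = U j * V i" if "i \<in> J" "j \<in> J" "i \<noteq> j" for i j
    using cm[OF that, of "V i" "U j"] by auto
  have cq: "x * q = q * x" if i: "i \<in> J" and x: "x \<in> {U i, V i}" and q: "q \<in> quat u v" for i x q
  proof -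
    have "generated_by {u, v} (quat u v)"
      unfolding generated_by_def quat_def by (auto intro!: subalg_closed)
    then have "q * x = x * q"
    proof (rule generated_by_commute[OF _ _ q])
      fix z assume "z \<in> {u, v}"
      then show "z * x = x * z"
        using Fk(4)[of i z x] i x unfolding J_def u_def v_def by auto
    qed
    then show ?thesis by simp
  qed

  define G where "G = {prod_list (map U js) | js. set js \<subseteq> J}"
  have G1: "1 \<in> G" unfolding G_def by (auto intro!: exI[of _ "[]"])
  have GU: "U i * g \<in> G" if ig: "i \<in> J" "g \<in> G" for i g
  proof -
    obtain js where "g = prod_list (map U js)" "set js \<subseteq> J" using ig(2) unfolding G_def by blast
    then show ?thesis unfolding G_def using ig(1) by (auto intro!: exI[of _ "i # js"])
  qed
  have Gind: "Q g" if "g \<in> G" "Q 1" "\<And>i g. i \<in> J \<Longrightarrow> g \<in> G \<Longrightarrow> Q g \<Longrightarrow> Q (U i * g)" for Q g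
  proof -
    have "prod_list (map U js) \<in> G \<and> Q (prod_list (map U js))" if "set js \<subseteq> J" for js
      using that
    proof (induction js)
      case Nil then show ?case using G1 \<open>Q 1\<close> by simp
    next
      case (Cons j js)
      then show ?case using GU \<open>\<And>i g. i \<in> J \<Longrightarrow> g \<in> G \<Longrightarrow> Q g \<Longrightarrow> Q (U i * g)\<close> by simp
    qed
    then show ?thesis using that(1) unfolding G_def by blast
  qed
  have Gq: "g * q = q * g" if g: "g \<in> G" and q: "q \<in> quat u v" for g q
    using g
  proof (rule Gind)
    fix i g assume "i \<in> J" "g * q = q * g"
    then show "U i * g * q = q * (U i * g)" using cq[of i "U i" q] q by (simp add: mult.assoc) (simp flip: mult.assoc)
  qed simp
  have GUc: "g * U j = U j * g" if g: "g \<in> G" and j: "j \<in> J" for g j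
    using g
  proof (rule Gind)
    fix i g assume "i \<in> J" "g * U j = U j * g"
    then show "U i * g * U j = U j * (U i * g)"
      using cmUU[of i j] j by (simp add: mult.assoc) (simp flip: mult.assoc)
  qed simp
  have Gg: "g * g = 1 \<and> \<sigma> g = g" if g: "g \<in> G" for g
    using g
  proof (rule Gind)
    fix i g assume i: "i \<in> J" and g: "g \<in> G" and IH: "g * g = 1 \<and> \<sigma> g = g"
    have "U i * g * (U i * g) = (U i * U i) * (g * g)"
      using GUc[OF g i] by (metis mult.assoc)
    then show "U i * g * (U i * g) = 1 \<and> \<sigma> (U i * g) = U i * g"
      using IH UU[OF i] sym(1)[OF i] GUc[OF g i] by (simp add: inv_mult)
  qed simp
  \<comment> \<open>Conjugation by g moves \<open>V j\<close> to itself or to \<open>V j\<close> +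
    1.\<close>
  have GV: "V j * g = g * V j \<or> V j * g = g * V j + g" if g: "g \<in> G" and j: "j \<in> J" for g j
    using g
  proof (rule Gind)
    fix i g assume i: "i \<in> J" and IH: "V j * g = g * V j \<or> V j * g = g * V j + g"
    have "V j * (U i * g) = U i * (V j * g) \<or> V j * (U i * g) = U i * (V j * g) + U i * g"
    proof (cases "i = j")
      case True
      then show ?thesis using VU[OF i] by (simp flip: mult.assoc add: distrib_right)
    next
      case False
      then show ?thesis using cmVU[OF j i] by (simp flip: mult.assoc)
    qed
    then show "V j * (U i * g) = U i * g * V j \<or> V j * (U i * g) = U i * g * V j + U i * g"
      using IH by (auto simp: algebra_simps)
  qed simp

  define E where "E js = prod_list (map V js)" for js
  have E: "\<sigma> (E js) = E js \<and> E js * E js = E js \<and> (\<forall>i\<in>J. V i * E js = E js * V i) \<and>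
      (\<forall>i\<in>set js. V i * E js = E js) \<and> (\<forall>i\<in>J - set js. U i * E js = E js * U i) \<and>
      (\<forall>q\<in>quat u v. q * E js = E js * q) \<and> E js \<noteq> 0" if "set js \<subseteq> J" "distinct js" for js
    using that
  proof (induction js)
    case Nil then show ?case unfolding E_def by simp
  next
    case (Cons j js)
    then have j: "j \<in> J" "j \<notin> set js" and jsJ: "set js \<subseteq> J" by auto
    define P where "P = E js"
    have EP: "E (j # js) = V j * P" unfolding E_def P_def by simp
    have IH: "\<sigma> P = P" "P * P = P" "\<And>i. i \<in> J \<Longrightarrow> V i * P = P * V i" "\<And>i. i \<in> set js \<Longrightarrow> V i * P = P"
      "\<And>i. i \<in> J \<Longrightarrow> i \<notin> set js \<Longrightarrow> U i * P = P * U i" "\<And>q. q \<in> quat u v \<Longrightarrow> q * P = P * q" "P \<noteq> 0"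
      using Cons unfolding P_def by auto
    have 1: "\<sigma> (V j * P) = V j * P" using IH(1,3) j sym by (simp add: inv_mult)
    have 2: "V j * P * (V j * P) = V j * P"
      using IH(2) IH(3)[OF j(1)] VV[OF j(1)] by (metis mult.assoc)
    have 3: "V i * (V j * P) = V j * P * V i" if "i \<in> J" for i
      using IH(3)[OF that] cmVV[OF that j(1)] by (metis mult.assoc)
    have 4: "V i * (V j * P) = V j * P" if "i \<in> set (j # js)" for i
      using that IH(4)[of i] VV[OF j(1)] cmVV[of i j] j jsJ by (metis mult.assoc set_ConsD subsetD)
    have 5: "U i * (V j * P) = V j * P * U i" if "i \<in> J" "i \<notin> set (j # js)" for i
      using IH(5)[of i] cmVU[of j i] that j by (metis mult.assoc list.set_intros(1,2))
    have 6: "q * (V j * P) = V j * P * q" if "q \<in> quat u v" for q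
      using IH(6)[OF that] cq[OF j(1) _ that, of "V j"] by (metis mult.assoc insertCI)
    have 7: "V j * P \<noteq> 0"
    \<comment> \<open>Conjugation by \<open>U j\<close> turns \<open>V j\<close> P into
      (\<open>V j\<close> + 1) P; if both vanish, so does their sum P.\<close>
    proof
      assume 0: "V j * P = 0"
      have "U j * (V j * P) * U j = U j * V j * U j * P"
        using IH(5)[OF j] by (simp add: mult.assoc)
      also have "U j * V j * U j = V j + 1"
        using VU[OF j(1)] UU[OF j(1)] by (simp add: mult.assoc distrib_left) (simp flip: mult.assoc)
      finally have "(V j + 1) * P = 0" using 0 by simp
      then show False using 0 IH(7) by (simp add: distrib_right)
    qed
    show ?case unfolding EP using 1 2 3 4 5 6 7 by blast
  qed
  define js where "js = filter (\<lambda>i. i \<noteq> k) [0..<n]"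
  have js: "set js = J" "distinct js" unfolding js_def J_def by auto
  define e where "e = E js"
  have e: "\<sigma> e = e" "e * e = e" "\<And>i. i \<in> J \<Longrightarrow> V i * e = e" "\<And>i. i \<in> J \<Longrightarrow> e * V i = e"
    "\<And>q. q \<in> quat u v \<Longrightarrow> q * e = e * q" "e \<noteq> 0"
    using E[of js] js unfolding e_def by auto

  \<comment> \<open>If V_i g = g V_i + g for some i, absorbing V_i into e on either side gives e g e
    = e g e + e g e = 0. Otherwise g commutes with all generators and is a scalar c with c^2 = 1; in
    characteristic two this means c = 1.\<close>
  have ege: "e * g * e = 0 \<or> e * g * e = e" if g: "g \<in> G" for g
  proof (cases "\<exists>i\<in>J. V i * g = g * V i + g")
    case True
    then obtain i where i: "i \<in> J" "V i * g = g * V i + g" by blast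
    have "e * g * e = e * V i * g * e" using e(4)[OF i(1)] by simp
    also have "\<dots> = e * (V i * g) * e" by (simp add: mult.assoc)
    also have "\<dots> = e * (g * (V i * e)) + e * (g * e)" unfolding i(2) by (simp add: algebra_simps)
    also have "\<dots> = 0" using e(3)[OF i(1)] by simp
    finally show ?thesis by simp
  next
    case False
    then have Vg: "V i * g = g * V i" if "i \<in> J" for i using GV[OF g that] that by blast
    have gen: "generated_by (\<Union>i<n. {U i, V i}) UNIV" using F unfolding frame_def by blast
    have "z * g = g * z" for z
    proof (rule generated_by_commute[OF gen])
      fix y assume "y \<in> (\<Union>i<n. {U i, V i})"
      then obtain i where i: "i < n" "y = U i \<or> y = V i" by blast
      show "y * g = g * y"
      proof (cases "i = k")
        case True
        then have "y \<in> quat u v" using i(2) unfolding u_def v_def by auto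
        then show ?thesis using Gq[OF g] by simp
      next
        case False
        then have "i \<in> J" using i unfolding J_def by simp
        then show ?thesis using GUc[OF g] Vg i(2) by auto
      qed
    qed simp
    then have "g \<in> centralizer UNIV UNIV" unfolding centralizer_def by simp
    then obtain c where c: "g = emb c" unfolding cent by blast
    have "emb (c * c) = emb 1" using Gg[OF g] unfolding c by (simp add: emb_mult)
    then have "c * c = 1" by (simp only: emb_eq_iff)
    then have "(c + 1) * (c + 1) = 0" by (simp add: sq_add_f)
    then have "c = 1" by (simp add: eq_iff_add_f[symmetric])
    then show ?thesis using c e(2) by simp
  qed

  define X where "X = {g * q * e | g q. g \<in> G \<and> q \<in> quat u v}"
  \<comment> \<open>The span of X is a left ideal, as can be checked on generators of A; since it
    contains e, it contains A e.\<close>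
  have mulX: "x * m \<in> vs.span X" if "m \<in> vs.span X" for x m
  proof -
    have "subalg emb {x. \<forall>m\<in>vs.span X. x * m \<in> vs.span X}"
      unfolding subalg_def
      by (auto simp: vs.span_scale distrib_right vs.span_add mult.assoc)
    moreover have "x * m \<in> vs.span X" if x: "x \<in> (\<Union>i<n. {U i, V i})" and "m \<in> vs.span X" for x m
      using that(2)
    proof (induction rule: vs.span_induct_alt)
      case base then show ?case by (simp add: vs.span_zero)
    next
      case (step c y z)
      have "x * y \<in> vs.span X"
      proof -
        obtain g q where gq: "g \<in> G" "q \<in> quat u v" "y = g * q * e"
          using step(1) unfolding X_def by blast
        obtain i where i: "i < n" "x = U i \<or> x = V i" using x by blast
        show ?thesis
        proof (cases "i = k")
          case True
          then have xq: "x \<in> quat u v" using i(2) unfolding u_def v_def by auto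
          have "x * y = g * (x * q) * e" unfolding gq(3) using Gq[OF gq(1) xq] by (simp flip: mult.assoc)
          then have "x * y \<in> X" unfolding X_def using gq quat_closed(2)[OF P xq] by blast
          then show ?thesis by (rule vs.span_base)
        next
          case False
          then have iJ: "i \<in> J" using i unfolding J_def by simp
          show ?thesis
          proof (cases "x = U i")
            case True
            then have "x * y = (U i * g) * q * e" unfolding gq(3) by (simp add: mult.assoc)
            then have "x * y \<in> X" unfolding X_def using gq GU[OF iJ] by blast
            then show ?thesis by (rule vs.span_base)
          next
            case False
            then have xV: "x = V i" using i by blast
            have "g * (V i * (q * e)) = y"
              unfolding gq(3) using cq[OF iJ _ gq(2), of "V i"] e(3)[OF iJ]
              by (metis insertCI mult.assoc)
            then have "g * V i * (q * e) = y" "g * (q * e) = y" by (simp_all add: gq(3) mult.assoc)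
            moreover have "x * y = (V i * g) * (q * e)" unfolding gq(3) xV by (simp add: mult.assoc)
            ultimately have "x * y = y \<or> x * y = 0"
              using GV[OF gq(1) iJ] by (auto simp: distrib_right)
            then show ?thesis using step(1) by (auto simp: vs.span_base vs.span_zero)
          qed
        qed
      qed
      then have "emb c * (x * y) + x * z \<in> vs.span X" using step by (simp add: vs.span_add vs.span_scale)
      then show ?case by (simp add: distrib_left emb_left[of x])
    qed
    ultimately have "UNIV \<subseteq> {x. \<forall>m\<in>vs.span X. x * m \<in> vs.span X}"
      using F unfolding frame_def generated_by_def by blast
    then show ?thesis using that by blast
  qed
  have "1 * 1 * e \<in> X" unfolding X_def using G1 quat_gens(3) by blast
  then have eX: "y \<in> vs.span X" if "y * e = y" for y
    using mulX[OF vs.span_base, of e y] that by simp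
  have corner1: "\<exists>q\<in>quat u v. e * z = q * e" if "z \<in> vs.span X" for z
    using that
  proof (induction rule: vs.span_induct_alt)
    case base then show ?case by (auto intro!: bexI[of _ 0])
  next
    case (step c y z)
    obtain g q where gq: "g \<in> G" "q \<in> quat u v" "y = g * q * e"
      using step(1) unfolding X_def by blast
    have "e * y = (e * g * e) * q" unfolding gq(3) using e(5)[OF gq(2)] by (simp add: mult.assoc)
    then have "e * y = 0 * e \<or> e * y = q * e" using ege[OF gq(1)] e(5)[OF gq(2)] by auto
    then obtain q' where q': "q' \<in> quat u v" "e * y = q' * e"
      using gq(2) quat_0[of u v] by blast
    obtain q'' where q'': "q'' \<in> quat u v" "e * z = q'' * e" using step by blast
    have "e * (emb c * y + z) = (emb c * q' + q'') * e"
      using q' q'' by (simp add: algebra_simps emb_left[of e])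
    moreover have "emb c * q' + q'' \<in> quat u v"
      using quat_closed[OF P] q' q'' by simp
    ultimately show ?case by blast
  qed
  have ee: "z * e = z" if "z \<in> vs.span X" for z
    using that
  proof (induction rule: vs.span_induct_alt)
    case (step c y z)
    then show ?case unfolding X_def using e(2) by (auto simp: algebra_simps)
  qed simp
  have corner2: "y \<in> vs.span X \<and> (\<exists>R\<in>nsq (a k). \<exists>L\<in>nsq (a k). \<exists>f.
      \<sigma> y * y = (emb R * v + emb (L + b k * R) + emb f * u) * e)" if "y \<in> vs.span X" for y
    using that
  proof (induction rule: vs.span_induct_alt)
    case base
    have "\<sigma> 0 * 0 = (emb 0 * v + emb (0 + b k * 0) + emb 0 * u) * e" by simp
    then show ?case using nsq_0 vs.span_zero by blast
  next
    case (step c y z)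
    obtain g q where gq: "g \<in> G" "q \<in> quat u v" "y = g * q * e"
      using step(1) unfolding X_def by blast
    \<comment> \<open>g is symmetric of square 1 and cancels, so the value on a spanning vector is
      that of q alone.\<close>
    have "\<sigma> y * y = e * \<sigma> q * (g * g) * q * e"
      unfolding gq(3) using conjunct2[OF Gg[OF gq(1)]] e(1) by (simp add: inv_mult mult.assoc)
    also have "\<dots> = e * (\<sigma> q * q) * e"
      using Gg[OF gq(1)] by (simp add: mult.assoc)
    also have "\<dots> = \<sigma> q * q * e"
      using e(5)[OF quat_closed(2)[OF P quat_inv(2)[OF P us vs gq(2)] gq(2)]] e(2)
      by (metis mult.assoc)
    finally have y: "\<sigma> y * y = \<sigma> q * q * e" .
    obtain R L f where RL: "R \<in> nsq (a k)" "L \<in> nsq (a k)"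
      "\<sigma> q * q = emb R * v + emb (L + b k * R) + emb f * u"
      using quat_inv(3)[OF P us vs gq(2)] by blast
    obtain R' L' f' where RL': "R' \<in> nsq (a k)" "L' \<in> nsq (a k)"
      "\<sigma> z * z = (emb R' * v + emb (L' + b k * R') + emb f' * u) * e"
      using step by blast
    have yX: "y \<in> vs.span X" and zX: "z \<in> vs.span X" using step by (simp_all add: vs.span_base)
    \<comment> \<open>The cross terms are q' e and its image under \<sigma>. Their sum is a multiple
      of u e and only changes f.\<close>
    have "\<sigma> y * z = e * (\<sigma> y * z)"
      using ee[OF yX] e(1) by (metis inv_mult mult.assoc)
    then obtain q' where q': "q' \<in> quat u v" "\<sigma> y * z = q' * e"
      using corner1[OF mulX[OF zX, of "\<sigma> y"]] by auto
    have "\<sigma> z * y = \<sigma> (\<sigma> y * z)" by (simp add: inv_mult)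
    also have "\<dots> = \<sigma> q' * e"
      unfolding q'(2) inv_mult using e(1) e(5)[OF quat_inv(2)[OF P us vs q'(1)]] by simp
    finally have "\<sigma> y * z + \<sigma> z * y = (q' + \<sigma> q') * e" using q'(2) by (simp add: distrib_right)
    then obtain f'' where f'': "\<sigma> y * z + \<sigma> z * y = emb f'' * u * e"
      using quat_inv(1)[OF P us vs q'(1)] by auto
    have "\<sigma> (emb c * y + z) * (emb c * y + z) =
        emb (c * c) * (\<sigma> y * y) + \<sigma> z * z + emb c * (\<sigma> y * z + \<sigma> z * y)"
      by (simp add: inv_add inv_scale emb_simps emb_left[of "\<sigma> y"] emb_left[of "\<sigma> z"])
    also have "\<dots> = (emb (c * c * R + R') * v + emb ((c * c * L + L') + b k * (c * c * R + R')) +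
        emb (c * c * f + f' + c * f'') * u) * e"
      unfolding y RL(3) RL'(3) f'' by (simp add: emb_simps)
    finally show ?case
      using vs.span_add[OF vs.span_scale[OF yX] zX] nsq_add[OF nsq_scale[OF RL(1)] RL'(1)] nsq_add[OF nsq_scale[OF RL(2)] RL'(2)] by blast
  qed
  have "corner (a k) (b k) u v e"
    unfolding corner_def
  proof (intro conjI allI impI)
    show "e * u = u * e" "e * v = v * e" using e(5) by simp_all
    show "\<exists>q\<in>quat u v. e * z * e = q * e" for z
      using corner1[OF eX, of "z * e"] e(2) by (simp add: mult.assoc)
  qed (use P us vs e(1,2,6) corner2[OF eX] in simp_all)
  then show thesis using that unfolding u_def v_def by blast
qed

end

section \<open>The bilinear form attached to x\<close>

locale corner_algebra = char2_algebra emb \<sigma>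
  for emb :: "'f::field \<Rightarrow> 'a::ring_1" and \<sigma> :: "'a \<Rightarrow> 'a" +
  fixes n :: nat and a b :: 'f and u v e :: 'a
  assumes csa: "csa emb UNIV (4 ^ n)"
    and corner: "corner a b u v e"
    and nonsquare: "a \<noteq> k * k"
begin

lemma P: "quat_pair a b u v" and u_sym: "\<sigma> u = u" and v_sym: "\<sigma> v = v"
  and e0: "e \<noteq> 0" and ee: "e * e = e" and e_sym: "\<sigma> e = e"
  and eu: "e * u = u * e" and ev: "e * v = v * e"
  using corner unfolding corner_def by - (elim conjE, assumption)+

lemma eze: "\<exists>q\<in>quat u v. e * z * e = q * e"
proof -
  have "\<forall>z. \<exists>q\<in>quat u v. e * z * e = q * e"
    using corner unfolding corner_def by (elim conjE) assumption
  then show ?thesis by (rule spec)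
qed

lemma norm_form:
  assumes "y * e = y"
  shows "\<exists>R\<in>nsq a. \<exists>L\<in>nsq a. \<exists>f.
    \<sigma> y * y = (emb R * v + emb (L + b * R) + emb f * u) * e"
proof -
  have "\<forall>y. y * e = y \<longrightarrow> (\<exists>R\<in>nsq a. \<exists>L\<in>nsq a. \<exists>f.
      \<sigma> y * y = (emb R * v + emb (L + b * R) + emb f * u) * e)"
    using corner unfolding corner_def by (elim conjE) assumption
  from mp[OF spec[OF this, of y] assms] show ?thesis .
qed

lemmas P' = quat_pairD[OF P]

lemma fdim: "has_fdim emb UNIV (4 ^ n)"
  using csa unfolding csa_def by blast

lemma ideal_UNIV:
  fixes I :: "'a set"
  assumes "ideal_in UNIV I" "z \<in> I" "z \<noteq> 0"
  shows "I = UNIV"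
proof -
  show ?thesis using csa_ideal[OF csa assms(1)] assms(2,3) by auto
qed

lemma e_quat: "q \<in> quat u v \<Longrightarrow> e * q = q * e"
proof -
  assume "q \<in> quat u v"
  then obtain p1 p2 p3 p4 where q: "q = emb p1 + emb p2 * u + emb p3 * v + emb p4 * (u * v)"
    unfolding quat_def by blast
  have "e * (u * v) = u * (v * e)" using eu ev by (metis mult.assoc)
  then show ?thesis unfolding q
    by (simp add: distrib_left distrib_right mult.assoc emb_left[of e] eu ev)
qed

text \<open>The elements annihilating e form a two-sided ideal of the simple algebra
  \<open>quat u v\<close>, and 1 is not among them. So the corner e A e is a faithful copy of
  \<open>quat u v\<close>.\<close>

lemma quat_e_eq_0:
  assumes "q \<in> quat u v" "q * e = 0"
  shows "q = 0"
proof -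
  let ?I = "{q \<in> quat u v. q * e = 0}"
  have "ideal_in (quat u v) ?I"
  proof -
    have "q' * q * e = 0" "q * q' * e = 0" if "q \<in> quat u v" "q * e = 0" "q' \<in> quat u v" for q q'
    proof -
      have "q * q' * e = (q * e) * q'" using e_quat[OF that(3)] by (simp add: mult.assoc)
      then show "q * q' * e = 0" using that(2) by simp
      show "q' * q * e = 0" using that(2) by (simp add: mult.assoc)
    qed
    then show ?thesis unfolding ideal_in_def using quat_closed[OF P] by (auto simp: distrib_right)
  qed
  then have "?I = {0} \<or> ?I = quat u v" by (rule csa_ideal[OF csa_quat[OF P]])
  moreover have "1 \<notin> ?I" using e0 by simp
  ultimately show ?thesis using assms quat_gens(3) by blast
qed

lemma quat_e_eq:
  assumes "q \<in> quat u v" "q' \<in> quat u v" "q * e = q' * e"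
  shows "q = q'"
proof -
  have "(q + q') * e = 0" using assms(3) by (simp add: distrib_right)
  then have "q + q' = 0" using quat_e_eq_0 quat_closed(1)[OF P assms(1,2)] by blast
  then show ?thesis by (rule add0D[symmetric])
qed

lemma lin2_quat': "k \<in> lin2 u \<Longrightarrow> k \<in> quat u v" by (rule lin2_quat)

lemma lin2_sym: "k \<in> lin2 u \<Longrightarrow> \<sigma> k = k"
  unfolding lin2_def using u_sym by (auto simp: inv_add inv_scale)

lemma lin2_e: "k \<in> lin2 u \<Longrightarrow> e * k = k * e"
  using e_quat lin2_quat' by blast

lemma lin2_comm: "k \<in> lin2 u \<Longrightarrow> l \<in> lin2 u \<Longrightarrow> k * l = l * k"
  and lin2_mult': "k \<in> lin2 u \<Longrightarrow> l \<in> lin2 u \<Longrightarrow> k * l \<in> lin2 u"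
  using lin2_mult[OF P'(2)] by blast+

lemma lin2_eq_iff: "emb p + emb q * u = emb p' + emb q' * u \<longleftrightarrow> p = p' \<and> q = q'"
  using quat_eq_iff[OF P, of p q 0 0 p' q' 0 0] by simp

text \<open>With q nonzero, a would be (p / q)^2. As p^2 + q^2 a is the square of p + q u, this
  makes F(u) a field.\<close>

lemma nsq_eq_0: "p * p + q * q * a = 0 \<Longrightarrow> p = 0 \<and> q = 0"
proof -
  assume 0: "p * p + q * q * a = 0"
  have "q = 0"
  proof (rule ccontr)
    assume "q \<noteq> 0"
    have "p * p = q * q * a" using add0D_f[OF 0] by simp
    then have "a = (p / q) * (p / q)" using \<open>q \<noteq> 0\<close> by (simp add: field_simps)
    then show False using nonsquare by blast
  qed
  then show ?thesis using 0 by simp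
qed

lemma lin2_square: "(emb p + emb q * u) * (emb p + emb q * u) = emb (p * p + q * q * a)"
  using P' by (simp add: emb_simps emb_left[of u])

lemma nsq_square: "N \<in> nsq a \<Longrightarrow> \<exists>k\<in>lin2 u. k * k = emb N"
  unfolding nsq_def using lin2_square lin2I by blast

lemma lin2_inverse:
  assumes "k \<in> lin2 u" "k \<noteq> 0"
  obtains l where "l \<in> lin2 u" "l * k = 1" "k * l = 1" "l \<noteq> 0"
proof -
  obtain p q where k: "k = emb p + emb q * u" using assms(1) unfolding lin2_def by blast
  define N where "N = p * p + q * q * a"
  have "N \<noteq> 0" using nsq_eq_0[of p q] assms(2) unfolding N_def k by auto
  have kk: "k * k = emb N" unfolding k N_def by (rule lin2_square)
  let ?l = "emb (inverse N) * k"
  have "?l * k = 1" using kk \<open>N \<noteq> 0\<close> by (simp add: mult.assoc flip: emb_mult)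
  moreover have "?l \<in> lin2 u" using assms(1) by (rule lin2_scale)
  moreover have "k * ?l = ?l * k" using lin2_comm assms(1) calculation(2) by blast
  moreover have "?l \<noteq> 0" using assms(2) \<open>N \<noteq> 0\<close> by simp
  ultimately show thesis using that[of ?l] by simp
qed

lemma lin2_mult_eq_0:
  assumes "k \<in> lin2 u" "y * k = 0" "k \<noteq> 0"
  shows "y = 0"
proof -
  obtain l where "k * l = 1" using lin2_inverse[OF assms(1,3)] by blast
  then have "y = y * k * l" by (simp add: mult.assoc)
  then show ?thesis using assms(2) by simp
qed

text \<open>The elements t with z A t = 0 form a two-sided ideal of A; it contains e and is
  therefore all of A.\<close>

lemma faithful_e:
  assumes "\<And>y. y * e = y \<Longrightarrow> z * y = 0"
  shows "z = 0"
proof -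
  let ?I = "{w. \<forall>y. z * y * w = 0}"
  have "ideal_in UNIV ?I"
  proof -
    have "z * y * (r * t) = 0" "z * y * (t * r) = 0" if t: "\<forall>y. z * y * t = 0" for y r t
      using spec[OF t, of "y * r"] spec[OF t, of y] by (simp_all flip: mult.assoc)
    then show ?thesis unfolding ideal_in_def by (simp add: distrib_left)
  qed
  moreover have "e \<in> ?I" using assms[of "y * e" for y] ee by (simp add: mult.assoc)
  ultimately have "?I = UNIV" using ideal_UNIV e0 by blast
  then have "\<forall>y. z * y * 1 = 0" by blast
  from spec[OF this, of 1] show ?thesis by simp
qed

text \<open>At y = s e the norm form has the value m e. Its v-coefficient R is therefore zero, and
  the constant part m reduces to L.\<close>

lemma symmetric_square:
  assumes "\<sigma> s = s" "s * s = emb m"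
  shows "m \<in> nsq a"
proof -
  have "s * e * e = s * e" using ee by (simp add: mult.assoc)
  from norm_form[OF this] obtain R L f where RL: "R \<in> nsq a" "L \<in> nsq a"
    "\<sigma> (s * e) * (s * e) = (emb R * v + emb (L + b * R) + emb f * u) * e" by blast
  have "\<sigma> (s * e) * (s * e) = e * (s * s) * e"
    using assms(1) e_sym by (simp add: inv_mult mult.assoc)
  also have "\<dots> = emb m * e" unfolding assms(2) using ee by (simp add: emb_left[of e] mult.assoc)
  finally have "(emb m + emb 0 * u + emb 0 * v + emb 0 * (u * v)) * e =
      (emb (L + b * R) + emb f * u + emb R * v + emb 0 * (u * v)) * e"
    using RL(3) by (simp add: algebra_simps)
  then have "emb m + emb 0 * u + emb 0 * v + emb 0 * (u * v) =
      emb (L + b * R) + emb f * u + emb R * v + emb 0 * (u * v)"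
    using quat_e_eq quatI by blast
  then have "m = L + b * R \<and> 0 = R" using quat_eq_iff[OF P] by blast
  then show ?thesis using RL(2) by simp
qed

end

locale corner_square = corner_algebra emb \<sigma> n a b u v e
  for emb :: "'f::field \<Rightarrow> 'a::ring_1" and \<sigma> :: "'a \<Rightarrow> 'a" and n a b u v e +
  fixes x :: 'a and c d :: 'f
  assumes x_sym: "\<sigma> x = x"
    and x_sq: "x * x = emb (c * c + d * d * a)"
    and d0: "d \<noteq> 0"
begin

definition w :: 'a where "w = emb c + emb d * u"

lemma w_lin2: "w \<in> lin2 u" unfolding w_def by (rule lin2I)

lemma w_sq: "w * w = emb (c * c + d * d * a)" unfolding w_def by (rule lin2_square)

lemma vw: "v * w = w * v + emb d * u"
  unfolding w_def using P' by (simp add: emb_simps emb_left[of v])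

definition V0 :: "'a set" where "V0 = {y. y * e = y \<and> x * y = y * w}"

lemma V0D: "y \<in> V0 \<Longrightarrow> y * e = y" "y \<in> V0 \<Longrightarrow> x * y = y * w"
  unfolding V0_def by auto

lemma V0_inv: "y \<in> V0 \<Longrightarrow> e * \<sigma> y = \<sigma> y" "y \<in> V0 \<Longrightarrow> \<sigma> y * x = w * \<sigma> y"
  using V0D e_sym x_sym lin2_sym[OF w_lin2] by (metis inv_mult)+

lemma V0_add: "y \<in> V0 \<Longrightarrow> y' \<in> V0 \<Longrightarrow> y + y' \<in> V0"
  unfolding V0_def by (simp add: algebra_simps)

lemma V0_0: "0 \<in> V0" unfolding V0_def by simp

lemma V0_scale: "y \<in> V0 \<Longrightarrow> emb p * y \<in> V0"
  unfolding V0_def by (simp add: mult.assoc emb_left[of x])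

lemma V0_right: "y \<in> V0 \<Longrightarrow> k \<in> lin2 u \<Longrightarrow> y * k \<in> V0"
  unfolding V0_def using lin2_e[of k] lin2_comm[OF w_lin2, of k] by simp (metis mult.assoc)

lemma V0_left: "y \<in> V0 \<Longrightarrow> z * x = x * z \<Longrightarrow> z * y \<in> V0"
  unfolding V0_def by simp (metis mult.assoc)

text \<open>The map y -> x y + y w has square zero because x^2 = w^2 is central, so it sends A e
  into its own kernel, which is \<open>V0\<close>.\<close>

lemma V0_mk: "y * e = y \<Longrightarrow> x * y + y * w \<in> V0"
proof -
  assume y: "y * e = y"
  have "x * (x * y) = y * (w * w)" unfolding mult.assoc[symmetric] x_sq unfolding mult.assoc w_sq emb_left ..
  moreover have "y * w * e = y * w" using y lin2_e[OF w_lin2] by (metis mult.assoc)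
  ultimately show ?thesis unfolding V0_def using y by (simp add: algebra_simps)
qed

text \<open>By \<open>V0_mk\<close>, z x y = z y w for all y in A e. Using this for both y and y v,
  with v w = w v + d u, leaves d z y u = 0.\<close>

lemma V0_faithful:
  assumes "\<And>y. y \<in> V0 \<Longrightarrow> z * y = 0"
  shows "z = 0"
proof (rule faithful_e)
  fix y assume y: "y * e = y"
  have *: "z * (x * y) = z * y * w" if "y * e = y" for y
    using assms[OF V0_mk[OF that]] by (simp add: algebra_simps eq_iff_add_a[of "z * (x * y)"])
  have "y * v * e = y * v" using y ev by (metis mult.assoc)
  then have "z * (x * (y * v)) = z * (y * v) * w" by (rule *)
  also have "\<dots> = z * y * (w * v + emb d * u)" unfolding vw[symmetric] by (simp add: mult.assoc)
  also have "\<dots> = z * (x * y) * v + emb d * (z * y * u)"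
    unfolding *[OF y] by (simp add: algebra_simps emb_left[of z] emb_left[of y])
  finally have "emb d * (z * y * u) = 0" by (simp add: mult.assoc)
  then have "z * y * u = 0" using d0 by simp
  moreover have "u \<noteq> 0" using P' by auto
  ultimately show "z * y = 0" using lin2_mult_eq_0[OF lin2_self] by blast
qed

text \<open>Write \<sigma>(y) y' = q e. Moving x across the product gives w q = q w, and as d is
  nonzero this forces q into F(u). Elements of F(u) are symmetric, hence so is the form.\<close>

lemma form:
  assumes "y \<in> V0" "y' \<in> V0"
  obtains k where "k \<in> lin2 u" "\<sigma> y * y' = k * e" "\<sigma> y' * y = k * e"
proof -
  have eq: "e * (\<sigma> y * y') * e = \<sigma> y * y'"
    using V0D(1)[OF assms(2)] V0_inv(1)[OF assms(1)] by (metis mult.assoc)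
  obtain q where q: "q \<in> quat u v" "\<sigma> y * y' = q * e" using eze[of "\<sigma> y * y'"] eq by auto
  have "w * q * e = w * (\<sigma> y * y')" using q(2) by (simp add: mult.assoc)
  also have "\<dots> = \<sigma> y * (x * y')" using V0_inv(2)[OF assms(1)] by (metis mult.assoc)
  also have "\<dots> = \<sigma> y * y' * w" using V0D(2)[OF assms(2)] by (simp add: mult.assoc)
  also have "\<dots> = q * w * e" unfolding q(2) using lin2_e[OF w_lin2] by (simp add: mult.assoc)
  finally have "w * q = q * w"
    using quat_e_eq quat_closed(2)[OF P] q(1) lin2_quat'[OF w_lin2] by blast
  obtain p1 p2 p3 p4 where qq: "q = emb p1 + emb p2 * u + emb p3 * v + emb p4 * (u * v)"
    using q(1) unfolding quat_def by blast
  have "emb (d * p4 * a) + emb (d * p3) * u + emb 0 * v + emb 0 * (u * v) = w * q + q * w"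
    unfolding qq w_def using P' by (simp add: emb_simps emb_left[of u] emb_left[of v])
  also have "\<dots> = 0" using \<open>w * q = q * w\<close> by simp
  finally have "d * p4 * a = 0 \<and> d * p3 = 0" using quat_indep[OF P] by blast
  then have "p4 = 0" "p3 = 0" using d0 P'(1) by auto
  then have k: "q \<in> lin2 u" unfolding qq using lin2I by simp
  have "\<sigma> y' * y = \<sigma> (\<sigma> y * y')" by (simp add: inv_mult)
  also have "\<dots> = q * e" unfolding q(2) inv_mult using lin2_sym[OF k] lin2_e[OF k] e_sym by simp
  finally show thesis using that k q(2) by blast
qed

lemma form_add:
  assumes "y \<in> V0" "y' \<in> V0"
  shows "\<sigma> (y + y') * (y + y') = \<sigma> y * y + \<sigma> y' * y'"
proof -
  obtain k where k: "\<sigma> y * y' = k * e" "\<sigma> y' * y = k * e" using form[OF assms] by blast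
  have "\<sigma> (y + y') * (y + y') = \<sigma> y * y + \<sigma> y' * y' + (\<sigma> y * y' + \<sigma> y' * y)"
    by (simp add: inv_add algebra_simps)
  then show ?thesis by (simp add: k)
qed

lemma form_right:
  assumes "y \<in> V0" "k \<in> lin2 u" "\<sigma> y * y = l * e" "l \<in> lin2 u"
  shows "\<sigma> (y * k) * (y * k) = k * k * l * e"
proof -
  have "\<sigma> (y * k) * (y * k) = k * (\<sigma> y * y) * k"
    using lin2_sym[OF assms(2)] by (simp add: inv_mult mult.assoc)
  also have "\<dots> = k * l * (e * k)" unfolding assms(3) by (simp add: mult.assoc)
  also have "\<dots> = k * (l * k) * e" unfolding lin2_e[OF assms(2)] by (simp add: mult.assoc)
  also have "\<dots> = k * k * l * e" unfolding lin2_comm[OF assms(4,2)] by (simp add: mult.assoc)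
  finally show ?thesis .
qed

text \<open>A value in F(u) e has no v-part, so R = 0 in \<open>norm_form\<close> and the constant
  part is a square of F(u).\<close>

lemma norm_V0:
  assumes "y \<in> V0"
  obtains L f where "L \<in> nsq a" "\<sigma> y * y = (emb L + emb f * u) * e"
proof -
  obtain k where k: "k \<in> lin2 u" "\<sigma> y * y = k * e" using form[OF assms assms] by blast
  obtain p q where kk: "k = emb p + emb q * u" using k(1) unfolding lin2_def by blast
  obtain R L f where RL: "R \<in> nsq a" "L \<in> nsq a"
    "\<sigma> y * y = (emb R * v + emb (L + b * R) + emb f * u) * e"
    using norm_form[OF V0D(1)[OF assms]] by blast
  let ?q = "emb (L + b * R) + emb f * u + emb R * v + emb 0 * (u * v)"
  have "?q * e = (emb p + emb q * u + emb 0 * v + emb 0 * (u * v)) * e"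
    using RL(3) k(2) kk by (simp add: algebra_simps)
  then have "?q = emb p + emb q * u + emb 0 * v + emb 0 * (u * v)"
    using quat_e_eq quatI by blast
  then have "R = 0" using quat_eq_iff[OF P] by blast
  then have "\<sigma> y * y = (emb L + emb f * u) * e" using RL(3) by simp
  then show thesis using that RL(2) by blast
qed

text \<open>The vector is y = x t + t w with t = v e. In its value, w^2 v + w v w = w d u
  contributes the constant d^2 a. The rest is q w + w q, where q e = t x t; this q is symmetric, so
  it has no u v-part and q w + w q is a multiple of u. Hence the constant cannot cancel.\<close>

lemma V0_nonalternating: "\<exists>y\<in>V0. \<sigma> y * y \<noteq> 0"
proof -
  define t where "t = v * e"
  have t: "t * e = t" "\<sigma> t = t" "t * t = (v + emb b) * e"
    unfolding t_def using ee ev v_sym e_sym P'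
    by (simp_all add: mult.assoc inv_mult) (metis mult.assoc P'(3))
  have et: "e * t = t" unfolding t_def using ev ee by (metis mult.assoc)
  obtain q where q: "q \<in> quat u v" "t * x * t = q * e"
  proof -
    have "e * (t * x * t) * e = t * x * t" using t(1) et by (metis mult.assoc)
    then show thesis using eze[of "t * x * t"] that by auto
  qed
  have "\<sigma> q * e = \<sigma> (e * q)" using e_sym by (simp add: inv_mult)
  also have "\<dots> = \<sigma> (t * x * t)" using e_quat[OF q(1)] q(2) by simp
  also have "\<dots> = t * x * t" using t(2) x_sym by (simp add: inv_mult mult.assoc)
  also have "\<dots> = q * e" by (rule q(2))
  finally have q_sym: "\<sigma> q = q"
    using quat_e_eq quat_inv(2)[OF P u_sym v_sym q(1)] q(1) by blast
  obtain p1 p2 p3 p4 where qq: "q = emb p1 + emb p2 * u + emb p3 * v + emb p4 * (u * v)"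
    using q(1) unfolding quat_def by blast
  have "emb 0 + emb p4 * u + emb 0 * v + emb 0 * (u * v) = q + \<sigma> q"
    unfolding qq using u_sym v_sym P'
    by (simp add: inv_add inv_mult emb_simps emb_left[of u] emb_left[of v])
  also have "\<dots> = 0" unfolding q_sym by simp
  finally have p4: "p4 = 0" using quat_indep[OF P] by blast
  define y where "y = x * t + t * w"
  have y: "y \<in> V0" unfolding y_def by (rule V0_mk[OF t(1)])
  have "\<sigma> y = t * x + w * t"
    unfolding y_def using t(2) x_sym lin2_sym[OF w_lin2] by (simp add: inv_add inv_mult)
  then have "\<sigma> y * y = t * (x * x) * t + t * x * t * w + w * (t * x * t) + w * (t * t) * w"
    unfolding y_def by (simp add: algebra_simps)
  also have "\<dots> = (emb (c * c + d * d * a) * (v + emb b) + q * w + w * q + w * (v + emb b) * w) * e"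
    unfolding x_sq t(3) q(2) using lin2_e[OF w_lin2] t(3)
    by (simp add: algebra_simps emb_left[of t])
  also have "emb (c * c + d * d * a) * (v + emb b) + q * w + w * q + w * (v + emb b) * w =
      emb (d * d * a) + emb (d * c + p3 * d) * u + emb 0 * v + emb 0 * (u * v)"
    unfolding qq p4 w_def using P'
    by (simp add: emb_simps emb_left[of u] emb_left[of v])
  finally have yy: "\<sigma> y * y = (emb (d * d * a) + emb (d * c + p3 * d) * u + emb 0 * v + emb 0 * (u * v)) * e" .
  have "\<sigma> y * y \<noteq> 0"
  proof
    assume "\<sigma> y * y = 0"
    then have "emb (d * d * a) + emb (d * c + p3 * d) * u + emb 0 * v + emb 0 * (u * v) = 0"
      unfolding yy using quat_e_eq_0 quatI by blast
    then have "d * d * a = 0" using quat_indep[OF P] by blast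
    then show False using d0 P'(1) by simp
  qed
  then show ?thesis using y by blast
qed

text \<open>The symmetric bilinear form (y, y') \<mapsto> sigma(y) y' on V0 over F(u) represents only one square class.\<close>

definition one_square_class :: bool where
  "one_square_class \<longleftrightarrow> (\<exists>m\<in>lin2 u. m \<noteq> 0 \<and> (\<forall>y\<in>V0. \<exists>k\<in>lin2 u. \<sigma> y * y = k * k * m * e))"

text \<open>The eigenvalue equation gives \<sigma>(y) (x + p) y = (L + g u) (w + p) e, and since x +
  p is alternating this is a multiple of u e. The vanishing constant part determines g from
  L.\<close>

lemma one_square_class_of_alternating:
  assumes "x + emb p \<in> Alt UNIV \<sigma>"
  shows one_square_class
proof -
  obtain t where t: "x + emb p = t + \<sigma> t" using assms unfolding Alt_iff by blast
  \<comment> \<open>Solving L (c + p) + g d a = 0 for g makes L + g u equal to L m, with the same m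
    for every y.\<close>
  define m where "m = emb 1 + emb ((c + p) / (d * a)) * u"
  have m: "m \<in> lin2 u" unfolding m_def by (rule lin2I)
  have m0: "m \<noteq> 0" using lin2_eq_iff[of 1 "(c + p) / (d * a)" 0 0] unfolding m_def by simp
  have "\<exists>k\<in>lin2 u. \<sigma> y * y = k * k * m * e" if y: "y \<in> V0" for y
  proof -
    obtain L g where L: "L \<in> nsq a" "\<sigma> y * y = (emb L + emb g * u) * e"
      using norm_V0[OF y] by blast
    have "e * (\<sigma> y * t * y) * e = \<sigma> y * t * y"
      using V0D(1)[OF y] V0_inv(1)[OF y] by (metis mult.assoc)
    then obtain q where q: "q \<in> quat u v" "\<sigma> y * t * y = q * e"
      using eze[of "\<sigma> y * t * y"] by auto
    obtain f where f: "q + \<sigma> q = emb f * u" using quat_inv(1)[OF P u_sym v_sym q(1)] by blast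
    have "\<sigma> (\<sigma> y * t * y) = \<sigma> q * e"
      unfolding q(2) using e_sym e_quat[OF quat_inv(2)[OF P u_sym v_sym q(1)]] by (simp add: inv_mult)
    then have st: "\<sigma> y * \<sigma> t * y = \<sigma> q * e" by (simp add: inv_mult mult.assoc)
    have "(emb L + emb g * u) * (w + emb p) * e = \<sigma> y * y * (w + emb p)"
      unfolding L(2) using lin2_e[OF w_lin2] by (simp add: algebra_simps emb_left[of e])
    also have "\<dots> = \<sigma> y * (x + emb p) * y"
      using V0D(2)[OF y] by (simp add: algebra_simps emb_left[of "\<sigma> y"] emb_left[of y])
    also have "\<dots> = (q + \<sigma> q) * e" unfolding t using q(2) st by (simp add: algebra_simps)
    finally have "(emb L + emb g * u) * (w + emb p) * e = emb f * u * e" unfolding f .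
    moreover have "(emb L + emb g * u) * (w + emb p) =
      emb (L * (c + p) + g * d * a) + emb (L * d + g * (c + p)) * u"
      unfolding w_def using P' by (simp add: emb_simps emb_left[of u])
    ultimately have "(emb (L * (c + p) + g * d * a) + emb (L * d + g * (c + p)) * u) * e =
        (emb 0 + emb f * u) * e" by simp
    then have "emb (L * (c + p) + g * d * a) + emb (L * d + g * (c + p)) * u = emb 0 + emb f * u"
      using quat_e_eq lin2_quat' lin2I by blast
    then have "L * (c + p) + g * d * a = 0" unfolding lin2_eq_iff by blast
    then have "L * (c + p) = g * d * a" by (simp add: eq_iff_add_f[of "L * (c + p)"])
    then have "g = L * ((c + p) / (d * a))" using d0 P'(1) by (simp add: field_simps)
    then have "emb L + emb g * u = emb L * m" unfolding m_def by (simp add: emb_simps)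
    then have "\<sigma> y * y = emb L * m * e" using L(2) by simp
    moreover obtain k where "k \<in> lin2 u" "k * k = emb L" using nsq_square[OF L(1)] by blast
    ultimately show ?thesis by (metis (no_types))
  qed
  then show ?thesis unfolding one_square_class_def using m m0 by blast
qed

text \<open>F(x) and F(u) have the same squares, because x^2 = c^2 + d^2 a with d nonzero. In a
  commutative algebra of such elements containing x, each element is thus one of F(x) plus one of
  square zero.\<close>

lemma symmetric_square_x:
  assumes "\<sigma> s = s" "s * s = emb m"
  obtains p q where "s * s = (emb p + emb q * x) * (emb p + emb q * x)"
proof -
  obtain p q where m: "m = p * p + q * q * a"
    using symmetric_square[OF assms] unfolding nsq_def by blast
  let ?q = "q / d"
  have "(emb (p + ?q * c) + emb ?q * x) * (emb (p + ?q * c) + emb ?q * x) =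
      emb ((p + ?q * c) * (p + ?q * c)) + emb (?q * ?q) * (x * x)"
    by (simp add: emb_simps emb_left[of x])
  also have "\<dots> = emb ((p + ?q * c) * (p + ?q * c) + ?q * ?q * (c * c + d * d * a))"
    unfolding x_sq by (simp only: emb_add emb_mult)
  also have "(p + ?q * c) * (p + ?q * c) + ?q * ?q * (c * c + d * d * a) = m"
    unfolding m using d0 by (simp add: field_simps)
  finally have "s * s = (emb (p + ?q * c) + emb ?q * x) * (emb (p + ?q * c) + emb ?q * x)"
    using assms(2) by simp
  then show thesis by (rule that)
qed

text \<open>The coefficient of 1 in e z e. Composed with the form it gives an F-valued form, so that
  only dimensions over F have to be counted; \<open>coord_eqI\<close> shows that \<open>THE\<close>
  is well defined.\<close>

definition coord :: "'a \<Rightarrow> 'f" where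
  "coord z = (THE p. \<exists>q r s. e * z * e = (emb p + emb q * u + emb r * v + emb s * (u * v)) * e)"

lemma coord_eqI:
  assumes "e * z * e = (emb p + emb q * u + emb r * v + emb s * (u * v)) * e"
  shows "coord z = p"
  unfolding coord_def
proof (rule the_equality)
  show "\<exists>q r s. e * z * e = (emb p + emb q * u + emb r * v + emb s * (u * v)) * e"
    using assms by blast
next
  fix p' assume "\<exists>q r s. e * z * e = (emb p' + emb q * u + emb r * v + emb s * (u * v)) * e"
  then obtain q' r' s' where
    "e * z * e = (emb p' + emb q' * u + emb r' * v + emb s' * (u * v)) * e" by blast
  then have "emb p + emb q * u + emb r * v + emb s * (u * v) =
      emb p' + emb q' * u + emb r' * v + emb s' * (u * v)"
    using quat_e_eq[OF quatI quatI] assms by simp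
  then show "p' = p" unfolding quat_eq_iff[OF P] by simp
qed

lemma coord_ex:
  obtains q r s where "e * z * e = (emb (coord z) + emb q * u + emb r * v + emb s * (u * v)) * e"
proof -
  obtain p q r s where "e * z * e = (emb p + emb q * u + emb r * v + emb s * (u * v)) * e"
    using eze[of z] unfolding quat_def by blast
  then show thesis using that coord_eqI by metis
qed

lemma coord_add: "coord (z + z') = coord z + coord z'"
proof -
  obtain q r s where 1: "e * z * e = (emb (coord z) + emb q * u + emb r * v + emb s * (u * v)) * e"
    by (rule coord_ex)
  obtain q' r' s' where 2: "e * z' * e = (emb (coord z') + emb q' * u + emb r' * v + emb s' * (u * v)) * e"
    by (rule coord_ex)
  show ?thesis
  proof (rule coord_eqI)
    have "e * (z + z') * e = e * z * e + e * z' * e" by (simp add: algebra_simps)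
    then show "e * (z + z') * e = (emb (coord z + coord z') + emb (q + q') * u + emb (r + r') * v +
        emb (s + s') * (u * v)) * e"
      unfolding 1 2 by (simp add: emb_simps)
  qed
qed

lemma coord_scale: "coord (emb m * z) = m * coord z"
proof -
  obtain q r s where 1: "e * z * e = (emb (coord z) + emb q * u + emb r * v + emb s * (u * v)) * e"
    by (rule coord_ex)
  show ?thesis
  proof (rule coord_eqI)
    have "e * (emb m * z) * e = emb m * (e * z * e)" by (simp add: mult.assoc emb_left[of e])
    then show "e * (emb m * z) * e = (emb (m * coord z) + emb (m * q) * u + emb (m * r) * v +
        emb (m * s) * (u * v)) * e"
      unfolding 1 by (simp add: emb_simps)
  qed
qed

lemma coord_lin2:
  assumes "e * z * e = (emb p + emb q * u) * e"
  shows "coord z = p"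
  using coord_eqI[of z p q 0 0] assms by simp

lemma V0_subspace: "vs.subspace V0"
  unfolding vs.subspace_def using V0_0 V0_add V0_scale by blast

lemma V0_form_e: "y \<in> V0 \<Longrightarrow> y' \<in> V0 \<Longrightarrow> e * (\<sigma> y * y') * e = \<sigma> y * y'"
  using V0D(1) V0_inv(1) by (metis mult.assoc)

text \<open>T maps the span of a basis B of U and one further vector into the span of B, so it has a
  kernel. For y in it, \<open>coord\<close> vanishes on \<sigma>(y') y for all y' in U. Applied to
  y' u, which is in U too, this also kills the u-coefficient of the form.\<close>

lemma V0_dual:
  assumes UV: "U \<subseteq> V0" "vs.subspace U" "\<And>y. y \<in> U \<Longrightarrow> y * u \<in> U" "U \<noteq> V0"
  obtains y where "y \<in> V0" "y \<noteq> 0" "\<And>y'. y' \<in> U \<Longrightarrow> \<sigma> y' * y = 0"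
proof -
  interpret vp: vector_space_pair "\<lambda>c. (*) (emb c)" "\<lambda>c. (*) (emb c)" ..
  obtain y1 where y1: "y1 \<in> V0" "y1 \<notin> U" using UV(1,4) by blast
  obtain B where B: "B \<subseteq> U" "vs.independent B" "U \<subseteq> vs.span B"
    using vs.maximal_independent_subset[of U] by blast
  have fin: "finite B" using fdim_indep_card[OF fdim B(2)] by simp
  have span: "vs.span B = U" using B UV(2) vs.span_minimal by blast
  define T where "T y = (\<Sum>b\<in>B. emb (coord (\<sigma> b * y)) * b)" for y
  have "T (y + y') = T y + T y'" for y y'
    unfolding T_def by (simp add: distrib_left coord_add emb_add distrib_right sum.distrib)
  moreover have "T (emb m * y) = emb m * T y" for m y
  proof -
    have "\<sigma> b * (emb m * y) = emb m * (\<sigma> b * y)" for b by (rule emb_left(2))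
    then show ?thesis unfolding T_def
      by (simp add: coord_scale sum_distrib_left emb_mult_assoc)
  qed
  ultimately have lin: "Vector_Spaces.linear (\<lambda>c. (*) (emb c)) (\<lambda>c. (*) (emb c)) T"
    unfolding Vector_Spaces.linear_iff using vs.vector_space_axioms by blast
  let ?Z = "insert y1 B"
  have indZ: "vs.independent ?Z" using B(2) y1(2) span by (intro vs.independent_insertI) auto
  have TU: "T y \<in> vs.span B" for y
    unfolding T_def by (intro vs.span_sum vs.span_scale vs.span_base)
  have "\<not> inj_on T (vs.span ?Z)"
  proof
    assume inj: "inj_on T (vs.span ?Z)"
    have "vs.independent (T ` ?Z)"
      by (rule vp.linear_independent_injective_image[OF lin indZ inj])
    then have "card (T ` ?Z) \<le> card B"
      using vs.independent_span_bound[OF fin] TU by blast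
    moreover have "inj_on T ?Z" using inj vs.span_superset by (rule inj_on_subset)
    moreover have "y1 \<notin> B" using B(1) y1(2) by blast
    ultimately show False using fin by (simp add: card_image)
  qed
  then obtain y where y: "y \<in> vs.span ?Z" "T y = 0" "y \<noteq> 0"
    using vp.linear_inj_on_iff_eq_0[OF lin vs.subspace_span] by blast
  have "?Z \<subseteq> V0" using y1(1) B(1) UV(1) by blast
  then have yV: "y \<in> V0" using y(1) vs.span_minimal[OF _ V0_subspace] by blast
  have b0: "coord (\<sigma> b * y) = 0" if "b \<in> B" for b
    using vs.independentD[OF B(2) fin _ _ that, of "\<lambda>b. coord (\<sigma> b * y)"] y(2)
    unfolding T_def by simp
  have c0: "coord (\<sigma> y' * y) = 0" if "y' \<in> vs.span B" for y'
    using that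
  proof (induction rule: vs.span_induct_alt)
    case base show ?case using coord_scale[of 0 0] by simp
  next
    case (step m b z)
    have "\<sigma> (emb m * b + z) * y = emb m * (\<sigma> b * y) + \<sigma> z * y"
      by (simp add: inv_add inv_scale algebra_simps)
    then show ?case using step b0 by (simp add: coord_add coord_scale)
  qed
  have "\<sigma> y' * y = 0" if y': "y' \<in> U" for y'
  proof -
    have y'V: "y' \<in> V0" using y' UV(1) by blast
    obtain k where k: "k \<in> lin2 u" "\<sigma> y' * y = k * e" using form[OF y'V yV] by blast
    obtain p q where pq: "k = emb p + emb q * u" using k(1) unfolding lin2_def by blast
    have "coord (\<sigma> y' * y) = p"
      using coord_lin2 V0_form_e[OF y'V yV] k(2) pq by simp
    then have p0: "p = 0" using c0 y' span by simp
    have "\<sigma> (y' * u) * y = (emb (q * a) + emb 0 * u) * e"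
      using k(2) P' p0 u_sym unfolding pq by (simp add: inv_mult mult.assoc emb_simps emb_left[of u])
    then have "coord (\<sigma> (y' * u) * y) = q * a"
      by (intro coord_lin2[of _ _ 0] trans[OF V0_form_e[OF V0_right[OF y'V lin2_self] yV]])
    then have "q * a = 0" using c0 UV(3)[OF y'] span by simp
    then show ?thesis using k(2) pq p0 P'(1) by simp
  qed
  then show thesis using that yV y(3) by blast
qed

text \<open>U collects the vectors with value in k0 F(u)^2 and contains N V0, where all values are
  zero. A nonzero y orthogonal to U would be killed by N, so w0 \<sigma>(y) would be a symmetric
  element of S. Applied to y0, which lies in U and is not orthogonal to w0, this symmetry forces y =
  0.\<close>

lemma one_square_class_of_inseparable:
  assumes S: "centralizer UNIV S = S" "subalg emb S" "S \<subseteq> Sym_plus emb \<sigma>" "x \<in> S"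
  shows one_square_class
proof -
  note cl = subalg_closed[OF S(2)]
  have comm: "s * t = t * s" if "s \<in> S" "t \<in> S" for s t
    using S(1) that unfolding centralizer_def by blast
  have sym: "\<sigma> s = s" if "s \<in> S" for s using S(3) that unfolding Sym_plus_def by blast
  define N where "N = {s \<in> S. s * s = 0}"
  have dec: "\<exists>p q t. t \<in> N \<and> s = emb p + emb q * x + t" if s: "s \<in> S" for s
  proof -
    obtain m where m: "s * s = emb m" using S(3) s unfolding Sym_plus_def by blast
    obtain p q where pq: "s * s = (emb p + emb q * x) * (emb p + emb q * x)"
      using symmetric_square_x[OF sym[OF s] m] by blast
    let ?k = "emb p + emb q * x"
    have k: "?k \<in> S" using S(4) by (intro cl)
    have "(s + ?k) * (s + ?k) = s * s + ?k * ?k" by (rule sq_add_a[OF comm[OF s k]])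
    also have "\<dots> = 0" unfolding pq by (rule two_a)
    finally have "s + ?k \<in> N" unfolding N_def using cl(4)[OF s k] by simp
    moreover have "s = ?k + (s + ?k)" by (simp add: add.left_commute)
    ultimately show ?thesis by blast
  qed
  have NS: "t \<in> S" if "t \<in> N" for t using that unfolding N_def by blast
  have N_V0: "t * y \<in> V0" if "t \<in> N" "y \<in> V0" for t y
    using V0_left[OF that(2) comm[OF NS[OF that(1)] S(4)]] .
  \<comment> \<open>The elements of N commute and have square zero. Running through a basis of N,
    the current vector y is replaced by t y whenever t y is nonzero; earlier basis elements still
    kill it.\<close>
  obtain w0 where w0: "w0 \<in> V0" "w0 \<noteq> 0" "\<And>t. t \<in> N \<Longrightarrow> t * w0 = 0"
  proof -
    obtain B where B: "B \<subseteq> N" "vs.independent B" "N \<subseteq> vs.span B"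
      using vs.maximal_independent_subset[of N] by blast
    have fin: "finite B" using fdim_indep_card[OF fdim B(2)] by simp
    have "\<exists>y\<in>V0. y \<noteq> 0 \<and> (\<forall>t\<in>B. t * y = 0)"
      using fin B(1)
    proof (induction B rule: finite_induct)
      case empty
      obtain y where "y \<in> V0" "\<sigma> y * y \<noteq> 0" using V0_nonalternating by blast
      then show ?case by (intro bexI[of _ y]) auto
    next
      case (insert t B)
      then obtain y where y: "y \<in> V0" "y \<noteq> 0" "\<And>r. r \<in> B \<Longrightarrow> r * y = 0" by auto
      have t: "t \<in> N" using insert by simp
      show ?case
      proof (cases "t * y = 0")
        case True then show ?thesis using y by blast
      next
        case False
        have "r * (t * y) = 0" if "r \<in> B" for r
        proof -
          have "r \<in> N" using that insert.prems by blast
          then have "r * (t * y) = t * (r * y)" using comm[OF NS NS[OF t], of r] by (simp flip: mult.assoc)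
          then show ?thesis using y(3)[OF that] by simp
        qed
        moreover have "t * (t * y) = 0" using t unfolding N_def by (simp flip: mult.assoc)
        ultimately show ?thesis using False N_V0[OF t y(1)] by blast
      qed
    qed
    then obtain y where y: "y \<in> V0" "y \<noteq> 0" "\<And>t. t \<in> B \<Longrightarrow> t * y = 0" by blast
    have "t * y = 0" if "t \<in> vs.span B" for t
      using that by (induction rule: vs.span_induct_alt) (simp_all add: distrib_right mult.assoc y(3))
    then show thesis using that[OF y(1,2)] B(3) by blast
  qed
  have "\<sigma> w0 \<noteq> 0" using w0(2) by simp
  then obtain y0 where y0: "y0 \<in> V0" "\<sigma> w0 * y0 \<noteq> 0" using V0_faithful[of "\<sigma> w0"] by blast
  \<comment> \<open>y0 is chosen only to pair nontrivially with w0, so k0 may still be zero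
    here.\<close>
  obtain k0 where k0: "k0 \<in> lin2 u" "\<sigma> y0 * y0 = k0 * e" using form[OF y0(1) y0(1)] by blast
  define U where "U = {y \<in> V0. \<exists>k\<in>lin2 u. \<sigma> y * y = k * k * k0 * e}"
  have UI: "y \<in> U" if "y \<in> V0" "k \<in> lin2 u" "\<sigma> y * y = k * k * k0 * e" for y k
    unfolding U_def using that by blast
  have sub: "vs.subspace U"
    unfolding vs.subspace_def
  proof (intro conjI allI ballI)
    show "0 \<in> U" using UI[OF V0_0 lin2_emb[of 0]] by simp
    show "y + y' \<in> U" if yy: "y \<in> U" "y' \<in> U" for y y'
    proof -
      obtain k where k: "y \<in> V0" "k \<in> lin2 u" "\<sigma> y * y = k * k * k0 * e"
        using yy(1) unfolding U_def by blast
      obtain k' where k': "y' \<in> V0" "k' \<in> lin2 u" "\<sigma> y' * y' = k' * k' * k0 * e"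
        using yy(2) unfolding U_def by blast
      have "\<sigma> (y + y') * (y + y') = (k + k') * (k + k') * k0 * e"
        unfolding form_add[OF k(1) k'(1)] sq_add_a[OF lin2_comm[OF k(2) k'(2)]] k(3) k'(3)
        by (simp add: distrib_right)
      then show ?thesis using UI V0_add[OF k(1) k'(1)] lin2_add[OF k(2) k'(2)] by blast
    qed
    show "emb m * y \<in> U" if y: "y \<in> U" for m y
    proof -
      obtain k where k: "y \<in> V0" "k \<in> lin2 u" "\<sigma> y * y = k * k * k0 * e"
        using y unfolding U_def by blast
      have "\<sigma> (emb m * y) * (emb m * y) = emb (m * m) * (\<sigma> y * y)"
        by (simp add: inv_scale emb_simps emb_left[of "\<sigma> y"])
      also have "\<dots> = (emb m * k) * (emb m * k) * k0 * e"
        unfolding k(3) by (simp add: emb_simps emb_left[of k])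
      finally show ?thesis using UI V0_scale[OF k(1)] lin2_scale[OF k(2)] by blast
    qed
  qed
  have Uu: "y * u \<in> U" if y: "y \<in> U" for y
  proof -
    obtain k where k: "y \<in> V0" "k \<in> lin2 u" "\<sigma> y * y = k * k * k0 * e"
      using y unfolding U_def by blast
    have "\<sigma> (y * u) * (y * u) = u * u * (k * k * k0) * e"
      using form_right[OF k(1) lin2_self k(3)] lin2_mult' k(2) k0(1) by blast
    also have "\<dots> = (emb a * k * k) * k0 * e" using P'(2) by (simp add: mult.assoc)
    also have "emb a * k * k = (u * k) * (u * k)"
      using lin2_comm[OF k(2) lin2_self] P'(2) by (metis mult.assoc)
    finally show ?thesis using UI V0_right[OF k(1) lin2_self] lin2_mult'[OF lin2_self k(2)] by blast
  qed
  have "U = V0"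
  proof (rule ccontr)
    assume "U \<noteq> V0"
    then obtain y where y: "y \<in> V0" "y \<noteq> 0" "\<And>y'. y' \<in> U \<Longrightarrow> \<sigma> y' * y = 0"
      using V0_dual[OF _ sub Uu] unfolding U_def by blast
    \<comment> \<open>t V0 lies in U and is orthogonal to y. Moving t across the form gives
      \<sigma>(t y) V0 = 0.\<close>
    have Ny: "t * y = 0" if t: "t \<in> N" for t
    proof -
      have "\<sigma> (t * y) * y' = 0" if y': "y' \<in> V0" for y'
      proof -
        have "\<sigma> (t * y') * (t * y') = \<sigma> y' * (t * t) * y'"
          using sym[OF NS[OF t]] by (simp add: inv_mult mult.assoc)
        then have "\<sigma> (t * y') * (t * y') = 0 * 0 * k0 * e" using t unfolding N_def by simp
        then have "t * y' \<in> U" using UI[OF N_V0[OF t y'] lin2_emb[of 0]] by simp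
        then have "\<sigma> (\<sigma> (t * y') * y) = 0" using y(3) by simp
        then show ?thesis using sym[OF NS[OF t]] by (simp add: inv_mult mult.assoc)
      qed
      then have "\<sigma> (t * y) = 0" by (rule V0_faithful)
      then show ?thesis by simp
    qed
    define E where "E = w0 * \<sigma> y"
    have "E * s = s * E" if s: "s \<in> S" for s
    proof -
      obtain p q t where t: "t \<in> N" "s = emb p + emb q * x + t" using dec[OF s] by blast
      have "E * t = w0 * \<sigma> (t * y)" unfolding E_def using sym[OF NS[OF t(1)]] by (simp add: inv_mult mult.assoc)
      then have "E * t = 0" using Ny[OF t(1)] by simp
      moreover have "t * E = 0" unfolding E_def using w0(3)[OF t(1)] by (simp flip: mult.assoc)
      moreover have "E * x = x * E"
        unfolding E_def using V0_inv(2)[OF y(1)] V0D(2)[OF w0(1)] by (metis mult.assoc)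
      ultimately show ?thesis unfolding t(2)
        by (simp add: algebra_simps emb_left[of E])
    qed
    then have "E \<in> centralizer UNIV S" unfolding centralizer_def by simp
    then have "\<sigma> E = E" using S(1) sym by simp
    then have "y * \<sigma> w0 = w0 * \<sigma> y" unfolding E_def by (simp add: inv_mult)
    then have "y * (\<sigma> w0 * y0) = w0 * \<sigma> y * y0" by (simp flip: mult.assoc)
    also have "\<dots> = w0 * \<sigma> (\<sigma> y0 * y)" by (simp add: inv_mult mult.assoc)
    also have "\<dots> = 0"
    proof -
      have "\<sigma> y0 * y0 = 1 * 1 * k0 * e" using k0(2) by simp
      then have "y0 \<in> U" using UI[OF y0(1) lin2_emb[of 1]] by simp
      then show ?thesis using y(3) by simp
    qed
    finally have 0: "y * (\<sigma> w0 * y0) = 0" .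
    obtain k where k: "k \<in> lin2 u" "\<sigma> w0 * y0 = k * e" using form[OF w0(1) y0(1)] by blast
    have "y * k = y * (e * k)" using V0D(1)[OF y(1)] by (simp flip: mult.assoc)
    also have "\<dots> = 0" using 0 unfolding k(2) lin2_e[OF k(1)] .
    finally have "y * k = 0" .
    moreover have "k \<noteq> 0" using y0(2) k(2) by auto
    ultimately show False using lin2_mult_eq_0[OF k(1)] y(2) by blast
  qed
  then have all: "\<forall>y\<in>V0. \<exists>k\<in>lin2 u. \<sigma> y * y = k * k * k0 * e" unfolding U_def by blast
  \<comment> \<open>Otherwise every value on \<open>V0\<close> would vanish, against
    \<open>V0_nonalternating\<close>.\<close>
  moreover have "k0 \<noteq> 0"
    using V0_nonalternating all by (metis mult_zero_left mult_zero_right)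
  ultimately show ?thesis unfolding one_square_class_def using k0(1) by blast
qed

end

section \<open>Orthonormal bases\<close>

locale corner_scaled = corner_square emb \<sigma> n a b u v e x c d
  for emb :: "'f::field \<Rightarrow> 'a::ring_1" and \<sigma> :: "'a \<Rightarrow> 'a" and n a b u v e x c d +
  fixes m l :: 'a
  assumes m: "m \<in> lin2 u" and m0: "m \<noteq> 0"
    and form_value: "\<And>y. y \<in> V0 \<Longrightarrow> \<exists>k\<in>lin2 u. \<sigma> y * y = k * k * m * e"
    and l: "l \<in> lin2 u" and lm: "l * m = 1" and ml: "m * l = 1"
begin

definition orthonormal :: "'a set \<Rightarrow> bool" where
  "orthonormal Y \<longleftrightarrow> Y \<subseteq> V0 \<and> (\<forall>y\<in>Y. \<forall>y'\<in>Y. \<sigma> y * y' = (if y = y' then m * e else 0))"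

lemma orthonormalD:
  assumes "orthonormal Y"
  shows "y \<in> Y \<Longrightarrow> y \<in> V0" "y \<in> Y \<Longrightarrow> y' \<in> Y \<Longrightarrow> \<sigma> y * y' = (if y = y' then m * e else 0)"
  using assms unfolding orthonormal_def by blast+

lemma me_nonzero: "m * e \<noteq> 0"
  using quat_e_eq_0 lin2_quat'[OF m] m0 by blast

lemma orthonormal_insert:
  assumes "orthonormal Y" "z \<in> V0" "\<sigma> z * z = m * e" "\<And>y. y \<in> Y \<Longrightarrow> \<sigma> y * z = 0"
  shows "orthonormal (insert z Y)" "z \<notin> Y"
proof -
  show "z \<notin> Y" using assms(3,4) me_nonzero by metis
  have "\<sigma> z * y = 0" if "y \<in> Y" for y
  proof -
    have "\<sigma> z * y = \<sigma> (\<sigma> y * z)" by (simp add: inv_mult)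
    then show ?thesis using assms(4)[OF that] by simp
  qed
  then show "orthonormal (insert z Y)"
    unfolding orthonormal_def using assms \<open>z \<notin> Y\<close> orthonormalD[OF assms(1)] by auto
qed

lemma orthonormal_independent:
  assumes "orthonormal Y"
  shows "vs.independent Y"
proof
  assume "vs.dependent Y"
  then obtain t g y where t: "finite t" "t \<subseteq> Y" "(\<Sum>z\<in>t. emb (g z) * z) = 0" "y \<in> t" "g y \<noteq> 0"
    unfolding vs.dependent_explicit by blast
  have "0 = \<sigma> y * (\<Sum>z\<in>t. emb (g z) * z)" unfolding t(3) by simp
  also have "\<dots> = (\<Sum>z\<in>t. emb (g z) * (\<sigma> y * z))"
    by (simp add: sum_distrib_left emb_left[of "\<sigma> y"])
  also have "\<dots> = (\<Sum>z\<in>t. if z = y then emb (g y) * (m * e) else 0)"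
  proof (intro sum.cong refl)
    fix z assume "z \<in> t"
    then have "y \<in> Y" "z \<in> Y" using t(2,4) by blast+
    then show "emb (g z) * (\<sigma> y * z) = (if z = y then emb (g y) * (m * e) else 0)"
      using orthonormalD(2)[OF assms, of y z] by (cases "z = y") simp_all
  qed
  also have "\<dots> = emb (g y) * (m * e)" using t by simp
  finally show False using t(5) me_nonzero by simp
qed

lemma orthonormal_finite: "orthonormal Y \<Longrightarrow> finite Y \<and> card Y \<le> 4 ^ n"
  using fdim_indep_card[OF fdim orthonormal_independent] by simp

text \<open>Since \<langle>1\<rangle> plus a hyperbolic plane is \<langle>1, 1, 1\<rangle>, a maximal orthonormal family is a basis even if its
  orthogonal complement is alternating.\<close>

lemma complete_orthonormal:
  obtains Y where "orthonormal Y" "finite Y" "(\<Sum>y\<in>Y. y * l * \<sigma> y) = 1"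
proof -
  have "orthonormal {}" unfolding orthonormal_def by simp
  moreover have "\<forall>Y. orthonormal Y \<longrightarrow> card Y < Suc (4 ^ n)"
    using orthonormal_finite by (simp add: less_Suc_eq_le)
  ultimately have "\<exists>Y. orthonormal Y \<and> (\<forall>Z. orthonormal Z \<longrightarrow> card Z \<le> card Y)"
    by (rule ex_has_greatest_nat)
  then obtain Y where Y: "orthonormal Y" "\<And>Z. orthonormal Z \<Longrightarrow> card Z \<le> card Y" by blast
  have fin: "finite Y" using orthonormal_finite[OF Y(1)] by simp
  note YD = orthonormalD[OF Y(1)]
  \<comment> \<open>The projection onto the orthogonal complement of Y. It commutes with x and so
    preserves \<open>V0\<close>.\<close>
  define f where "f = 1 + (\<Sum>y\<in>Y. y * l * \<sigma> y)"
  have yf: "\<sigma> y * f = 0" if y: "y \<in> Y" for y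
  proof -
    have "\<sigma> y * (\<Sum>z\<in>Y. z * l * \<sigma> z) = (\<Sum>z\<in>Y. \<sigma> y * z * l * \<sigma> z)"
      by (simp add: sum_distrib_left mult.assoc)
    also have "\<dots> = (\<Sum>z\<in>Y. if z = y then m * e * l * \<sigma> y else 0)"
      using YD(2)[OF y] by (intro sum.cong) auto
    also have "\<dots> = m * e * l * \<sigma> y" using y fin by simp
    also have "\<dots> = m * l * (e * \<sigma> y)" by (metis lin2_e[OF l] mult.assoc)
    also have "\<dots> = \<sigma> y" using V0_inv(1)[OF YD(1)[OF y]] ml by simp
    finally show ?thesis unfolding f_def by (simp add: distrib_left)
  qed
  have f_sym: "\<sigma> f = f"
    unfolding f_def using lin2_sym[OF l] by (simp add: inv_add inv_sum inv_mult mult.assoc)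
  have fy: "f * y = 0" if y: "y \<in> Y" for y
    using arg_cong[OF yf[OF y], of \<sigma>] f_sym by (simp add: inv_mult)
  have fx: "f * x = x * f"
  proof -
    have "y * l * \<sigma> y * x = x * (y * l * \<sigma> y)" if y: "y \<in> Y" for y
      using V0_inv(2)[OF YD(1)[OF y]] V0D(2)[OF YD(1)[OF y]] lin2_comm[OF l w_lin2]
      by (metis mult.assoc)
    then show ?thesis unfolding f_def
      by (simp add: distrib_left distrib_right sum_distrib_left sum_distrib_right)
  qed
  have ff: "f * f = f"
  proof -
    have "(\<Sum>y\<in>Y. f * (y * l * \<sigma> y)) = 0"
      by (intro sum.neutral ballI) (simp add: fy flip: mult.assoc)
    then have "f * (\<Sum>y\<in>Y. y * l * \<sigma> y) = 0" by (simp add: sum_distrib_left)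
    then show ?thesis by (subst (2) f_def) (simp add: distrib_left)
  qed
  have "f = 0"
  proof (rule ccontr)
    assume "f \<noteq> 0"
    then obtain y0 where y0: "y0 \<in> V0" "f * y0 \<noteq> 0" using V0_faithful by blast
    have fV: "f * y \<in> V0" if "y \<in> V0" for y using V0_left[OF that fx] .
    have orth: "\<sigma> y * (f * z) = 0" if "y \<in> Y" for y z using yf[OF that] by (simp flip: mult.assoc)
    show False
    proof (cases "\<exists>z\<in>V0. \<sigma> (f * z) * (f * z) \<noteq> 0")
      case True
      then obtain z where z: "z \<in> V0" "\<sigma> (f * z) * (f * z) \<noteq> 0" by blast
      obtain k where k: "k \<in> lin2 u" "\<sigma> (f * z) * (f * z) = k * k * m * e"
        using form_value[OF fV[OF z(1)]] by blast
      have "k \<noteq> 0" using z(2) k(2) by auto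
      then obtain r where r: "r \<in> lin2 u" "r * k = 1" using lin2_inverse[OF k(1)] by blast
      \<comment> \<open>Dividing by k turns the value k^2 m into m.\<close>
      let ?z = "f * z * r"
      have "\<sigma> ?z * ?z = r * r * (k * k * m) * e"
        by (rule form_right[OF fV[OF z(1)] r(1) k(2)]) (intro lin2_mult' k(1) m)
      also have "r * r * (k * k * m) = r * (r * k) * k * m" by (simp add: mult.assoc)
      also have "\<dots> = m" using r(2) by simp
      finally have zz: "\<sigma> ?z * ?z = m * e" .
      have "\<sigma> y * ?z = 0" if "y \<in> Y" for y using orth[OF that, of z] by (simp flip: mult.assoc)
      from orthonormal_insert[OF Y(1) V0_right[OF fV[OF z(1)] r(1)] zz this]
      have "orthonormal (insert ?z Y)" "?z \<notin> Y" by blast+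
      then show False using Y(2)[of "insert ?z Y"] fin by simp
    next
      case False
      then have alt: "\<sigma> (f * z) * (f * z) = 0" if "z \<in> V0" for z using that by blast
      \<comment> \<open>For empty Y, f would be 1 and the form on \<open>V0\<close> itself
        alternating.\<close>
      have "Y \<noteq> {}"
      proof
        assume "Y = {}"
        then have "f = 1" unfolding f_def by simp
        then show False using alt V0_nonalternating by simp
      qed
      then obtain y where y: "y \<in> Y" by blast
      note yV = YD(1)[OF y]
      have "\<sigma> (f * y0) \<noteq> 0" using y0(2) by simp
      then obtain z where z: "z \<in> V0" "\<sigma> (f * y0) * z \<noteq> 0" using V0_faithful by blast
      have "\<sigma> (f * y0) * (f * z) = \<sigma> y0 * (f * f) * z"
        using f_sym by (simp add: inv_mult mult.assoc)
      also have "\<dots> = \<sigma> (f * y0) * z" unfolding ff using f_sym by (simp add: inv_mult)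
      finally have nz: "\<sigma> (f * y0) * (f * z) \<noteq> 0" using z(2) by simp
      obtain k where k: "k \<in> lin2 u" "\<sigma> (f * y0) * (f * z) = k * e"
        using form[OF fV[OF y0(1)] fV[OF z(1)]] by blast
      have "k \<noteq> 0" using nz k(2) by auto
      then obtain r where r: "r \<in> lin2 u" "k * r = 1" using lin2_inverse[OF k(1)] by blast
      define p where "p = f * y0"
      \<comment> \<open>The factor r m makes p and q pair to m, the value of y. Then y + p, y + q
        and y + p + q all have value m, and m + m = 0 makes them orthogonal.\<close>
      define q where "q = f * (z * (r * m))"
      have pV: "p \<in> V0" and qV: "q \<in> V0"
        unfolding p_def q_def using fV y0(1) V0_right[OF z(1)] lin2_mult'[OF r(1) m] by auto
      have pq: "\<sigma> p * q = m * e"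
      proof -
        have "\<sigma> p * q = \<sigma> (f * y0) * (f * z) * (r * m)" unfolding p_def q_def by (simp add: mult.assoc)
        also have "\<dots> = k * (r * m * e)" unfolding k(2) using lin2_e[OF lin2_mult'[OF r(1) m]]
          by (simp add: mult.assoc)
        also have "\<dots> = m * e" using r(2) by (simp flip: mult.assoc)
        finally show ?thesis .
      qed
      have qp: "\<sigma> q * p = m * e"
        using form[OF pV qV] pq by metis
      have pp: "\<sigma> p * p = 0" and qq: "\<sigma> q * q = 0"
        unfolding p_def q_def using alt y0(1) V0_right[OF z(1)] lin2_mult'[OF r(1) m] by auto
      have yp: "\<sigma> z * p = 0" "\<sigma> z * q = 0" if "z \<in> Y" for z
        unfolding p_def q_def using orth[OF that] by auto
      have py: "\<sigma> p * y = 0" "\<sigma> q * y = 0"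
        using arg_cong[OF yp(1)[OF y], of \<sigma>] arg_cong[OF yp(2)[OF y], of \<sigma>]
        by (simp_all add: inv_mult)
      have yy: "\<sigma> y * y = m * e" using YD(2)[OF y y] by simp
      note tab = pq qp pp qq yp[OF y] py yy
      define Y0 where "Y0 = Y - {y}"
      have Y0: "orthonormal Y0" using Y(1) unfolding orthonormal_def Y0_def by auto
      have z0: "\<sigma> z * y = 0" "\<sigma> z * p = 0" "\<sigma> z * q = 0" if "z \<in> Y0" for z
        using that YD(2)[of z y] y yp[of z] unfolding Y0_def by auto
      have V: "y + p \<in> V0" "y + q \<in> V0" "y + p + q \<in> V0"
        using yV pV qV by (auto intro!: V0_add)
      have 1: "orthonormal (insert (y + p) Y0)" "y + p \<notin> Y0"
        by (rule orthonormal_insert[OF Y0 V(1)]; simp add: inv_add algebra_simps tab z0)+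
      have 2: "orthonormal (insert (y + q) (insert (y + p) Y0))" "y + q \<notin> insert (y + p) Y0"
        by (rule orthonormal_insert[OF 1(1) V(2)]; auto simp: inv_add algebra_simps tab z0)+
      have 3: "orthonormal (insert (y + p + q) (insert (y + q) (insert (y + p) Y0)))"
          "y + p + q \<notin> insert (y + q) (insert (y + p) Y0)"
        by (rule orthonormal_insert[OF 2(1) V(3)]; auto simp: inv_add algebra_simps tab z0)+
      have fin0: "finite Y0" unfolding Y0_def using fin by simp
      have "card (insert (y + p + q) (insert (y + q) (insert (y + p) Y0))) = card Y0 + 3"
        using 1(2) 2(2) 3(2) fin0 by simp
      moreover have "card Y = card Y0 + 1" unfolding Y0_def using fin y
        by (metis Suc_eq_plus1 card_Suc_Diff1)
      ultimately show False using Y(2)[OF 3(1)] by simp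
    qed
  qed
  then have "(\<Sum>y\<in>Y. y * l * \<sigma> y) = 1" unfolding f_def by (metis add0D)
  then show thesis using that Y(1) fin by blast
qed

end

section \<open>The algebra as matrices over \<open>quat u v\<close>\<close>

locale corner_basis = corner_scaled emb \<sigma> n a b u v e x c d m l
  for emb :: "'f::field \<Rightarrow> 'a::ring_1" and \<sigma> :: "'a \<Rightarrow> 'a" and n a b u v e x c d m l +
  fixes Y :: "'a set"
  assumes orthonormal: "orthonormal Y" and finite_Y: "finite Y"
    and complete: "(\<Sum>y\<in>Y. y * l * \<sigma> y) = 1"
begin

lemmas YD = orthonormalD[OF orthonormal]

text \<open>The embedding of \<open>quat u v\<close> as scalar matrices: \<open>psi q\<close> acts
  on each y in Y as right multiplication by q. Hence it commutes with the matrix units, and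
  \<open>psi w\<close> is x.\<close>

definition psi :: "'a \<Rightarrow> 'a" where "psi q = (\<Sum>y\<in>Y. y * q * l * \<sigma> y)"

lemma e_l_Y: "y \<in> Y \<Longrightarrow> q \<in> quat u v \<Longrightarrow> e * q * l * \<sigma> y = q * l * \<sigma> y"
proof -
  assume y: "y \<in> Y" and q: "q \<in> quat u v"
  have "e * q * l * \<sigma> y = q * l * (e * \<sigma> y)"
    using e_quat[OF quat_closed(2)[OF P q lin2_quat'[OF l]]] by (metis mult.assoc)
  then show ?thesis using V0_inv(1)[OF YD(1)[OF y]] by simp
qed

lemma psi_add: "psi (q + q') = psi q + psi q'"
  unfolding psi_def by (simp add: algebra_simps sum.distrib)

lemma psi_1: "psi 1 = 1" unfolding psi_def using complete by simp

lemma psi_scale: "psi (emb p * q) = emb p * psi q"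
proof -
  have "y * (emb p * q) * l * \<sigma> y = emb p * (y * q * l * \<sigma> y)" for y
    by (simp add: emb_left[of y] mult.assoc)
  then show ?thesis unfolding psi_def by (simp add: sum_distrib_left)
qed

lemma psi_Y: "q \<in> quat u v \<Longrightarrow> y \<in> Y \<Longrightarrow> psi q * y = y * q"
proof -
  assume q: "q \<in> quat u v" and y: "y \<in> Y"
  have "psi q * y = (\<Sum>z\<in>Y. z * q * l * (\<sigma> z * y))"
    unfolding psi_def by (simp add: sum_distrib_right mult.assoc)
  also have "\<dots> = (\<Sum>z\<in>Y. if z = y then y * q * l * (m * e) else 0)"
    using YD(2)[OF _ y] by (intro sum.cong) auto
  also have "\<dots> = y * q * l * (m * e)" using y finite_Y by simp
  also have "\<dots> = y * (e * q)" using lm e_quat[OF q] by (metis mult.assoc mult_1)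
  also have "\<dots> = y * q" using V0D(1)[OF YD(1)[OF y]] by (simp flip: mult.assoc)
  finally show ?thesis .
qed

lemma psi_mult:
  assumes "q \<in> quat u v"
  shows "psi (q * q') = psi q * psi q'"
proof -
  have "psi q * psi q' = (\<Sum>y\<in>Y. psi q * y * q' * l * \<sigma> y)"
    unfolding psi_def[of q'] by (simp add: sum_distrib_left mult.assoc)
  also have "\<dots> = psi (q * q')"
    unfolding psi_def[of "q * q'"] using psi_Y[OF assms] by (simp add: mult.assoc)
  finally show ?thesis ..
qed

lemma psi_emb: "psi (emb p) = emb p"
  using psi_scale[of p 1] psi_1 by simp

lemma psi_w: "psi w = x"
proof -
  have "psi w = (\<Sum>y\<in>Y. x * (y * l * \<sigma> y))"
    unfolding psi_def using V0D(2)[OF YD(1)] by (intro sum.cong) (simp_all flip: mult.assoc)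
  also have "\<dots> = x" using complete by (simp flip: sum_distrib_left)
  finally show ?thesis .
qed

lemma psi_pair: "quat_pair a b (psi u) (psi v)"
  unfolding quat_pair_def
  using P' psi_mult[OF quat_gens(1), of u] psi_mult[OF quat_gens(2), of v] psi_mult[OF quat_gens(2), of u]
    psi_mult[OF quat_gens(1), of v] psi_emb psi_add by metis

text \<open>m need not lie in F, so \<sigma> corresponds on the image to the involution of
  \<open>quat u v\<close> followed by conjugation by m. The image is invariant all the same.\<close>

lemma psi_inv: "q \<in> quat u v \<Longrightarrow> \<sigma> (psi q) = psi (l * \<sigma> q * m)"
proof -
  have "\<sigma> (psi q) = (\<Sum>y\<in>Y. y * l * \<sigma> q * \<sigma> y)"
    unfolding psi_def using lin2_sym[OF l] by (simp add: inv_sum inv_mult mult.assoc)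
  also have "\<dots> = psi (l * \<sigma> q * m)"
  proof -
    have "y * (l * \<sigma> q * m) * l * \<sigma> y = y * l * \<sigma> q * (m * l) * \<sigma> y" for y
      by (simp add: mult.assoc)
    then show ?thesis unfolding psi_def ml by simp
  qed
  finally show ?thesis .
qed

lemma psi_quat: "q \<in> quat u v \<Longrightarrow> psi q \<in> quat (psi u) (psi v)"
  unfolding quat_def
  by (auto simp: psi_add psi_scale psi_emb psi_mult[OF quat_gens(1)]) blast

lemma quat_psi: "z \<in> quat (psi u) (psi v) \<Longrightarrow> \<exists>q\<in>quat u v. z = psi q"
proof -
  assume "z \<in> quat (psi u) (psi v)"
  then obtain p q r s where "z = emb p + emb q * psi u + emb r * psi v + emb s * (psi u * psi v)"
    unfolding quat_def by blast
  then have "z = psi (emb p + emb q * u + emb r * v + emb s * (u * v))"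
    by (simp add: psi_add psi_scale psi_emb psi_mult[OF quat_gens(1)])
  then show ?thesis using quatI by blast
qed

lemma invariant_quaternion:
  "quat_subalg emb (quat (psi u) (psi v))" "\<sigma> ` quat (psi u) (psi v) \<subseteq> quat (psi u) (psi v)"
  "x \<in> quat (psi u) (psi v)"
proof -
  show "quat_subalg emb (quat (psi u) (psi v))"
    unfolding quat_subalg_def by (rule csa_quat[OF psi_pair])
  show "\<sigma> ` quat (psi u) (psi v) \<subseteq> quat (psi u) (psi v)"
  proof
    fix z assume "z \<in> \<sigma> ` quat (psi u) (psi v)"
    then obtain q where q: "q \<in> quat u v" "z = \<sigma> (psi q)" using quat_psi by blast
    have "l * \<sigma> q * m \<in> quat u v"
      using quat_closed(2)[OF P] lin2_quat'[OF l] lin2_quat'[OF m] quat_inv(2)[OF P u_sym v_sym q(1)] by blast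
    then show "z \<in> quat (psi u) (psi v)" unfolding q(2) psi_inv[OF q(1)] by (rule psi_quat)
  qed
  show "x \<in> quat (psi u) (psi v)" using psi_quat[OF lin2_quat'[OF w_lin2]] psi_w by simp
qed

lemma Y_separates:
  assumes "\<And>y. y \<in> Y \<Longrightarrow> z * y = z' * y"
  shows "z = z'"
proof -
  have "r = (\<Sum>y\<in>Y. r * y * l * \<sigma> y)" for r
  proof -
    have "r = r * (\<Sum>y\<in>Y. y * l * \<sigma> y)" using complete by simp
    then show ?thesis by (simp add: sum_distrib_left mult.assoc)
  qed
  then show ?thesis using assms by (metis (no_types, lifting) sum.cong)
qed

lemma Y_expand:
  assumes "z \<in> V0"
  obtains r where "\<And>y. r y \<in> lin2 u" "z = (\<Sum>y\<in>Y. y * r y)"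
proof -
  have "\<exists>k\<in>lin2 u. \<sigma> y * z = k * e" if "y \<in> Y" for y
    using form[OF YD(1)[OF that] assms] by metis
  then obtain k where k: "\<And>y. y \<in> Y \<Longrightarrow> k y \<in> lin2 u" "\<And>y. y \<in> Y \<Longrightarrow> \<sigma> y * z = k y * e" by metis
  define r where "r y = (if y \<in> Y then l * k y else 0)" for y
  have r: "r y \<in> lin2 u" for y
    unfolding r_def using lin2_mult'[OF l k(1)] lin2_emb[of 0 u] by simp
  have "z = (\<Sum>y\<in>Y. y * l * \<sigma> y) * z" using complete by simp
  also have "\<dots> = (\<Sum>y\<in>Y. y * r y)"
    unfolding sum_distrib_right
  proof (intro sum.cong refl)
    fix y assume y: "y \<in> Y"
    have "y * l * \<sigma> y * z = y * (l * k y * e)" using k(2)[OF y] by (simp add: mult.assoc)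
    also have "\<dots> = (y * e) * (l * k y)" unfolding lin2_e[OF lin2_mult'[OF l k(1)[OF y]], symmetric]
      by (simp add: mult.assoc)
    also have "\<dots> = y * r y" using V0D(1)[OF YD(1)[OF y]] y unfolding r_def by simp
    finally show "y * l * \<sigma> y * z = y * r y" .
  qed
  finally show thesis using that r by blast
qed

lemma Y_coefficients:
  assumes "\<And>y. y \<in> Y \<Longrightarrow> r y \<in> lin2 u" "(\<Sum>y\<in>Y. y * r y) = 0" "y \<in> Y"
  shows "r y = 0"
proof -
  have "0 = (\<Sum>z\<in>Y. \<sigma> y * z * r z)"
    using arg_cong[OF assms(2), of "\<lambda>t. \<sigma> y * t"] by (simp add: sum_distrib_left mult.assoc)
  also have "\<dots> = (\<Sum>z\<in>Y. if z = y then m * e * r y else 0)"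
    using YD(2)[OF assms(3)] by (intro sum.cong) auto
  also have "\<dots> = m * e * r y" using assms(3) finite_Y by simp
  also have "\<dots> = m * r y * e" using lin2_e[OF assms(1)[OF assms(3)]] by (simp add: mult.assoc)
  finally have "m * r y = 0"
    using quat_e_eq_0[OF lin2_quat'[OF lin2_mult'[OF m assms(1)[OF assms(3)]]]] by simp
  then have "l * m * r y = 0" by (simp add: mult.assoc)
  then show ?thesis using lm by simp
qed

text \<open>The elements y q m^(-1) \<sigma>(y'), with q in the basis of \<open>quat u v\<close>,
  form an F-basis of A, so 4 |Y|^2 = 4^n; this rules out n = 0.\<close>

lemma card_Y: "0 < n" "card Y = 2 ^ (n - 1)"
proof -
  define B where "B = {1, u, v, u * v}"
  have basis: "vs.independent B" "card B = 4" unfolding B_def by (rule quat_basis[OF P])+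
  have finB: "finite B" unfolding B_def by simp
  have spanB: "quat u v = vs.span B" unfolding B_def by (rule quat_span)
  define h where "h = (\<lambda>(y, y', q). y * q * l * \<sigma> y')"
  let ?I = "Y \<times> Y \<times> B"
  have h_eq: "\<sigma> y1 * h (y, y', q) * y1' = (if y = y1 \<and> y' = y1' then m * q * e else 0)"
    if "y1 \<in> Y" "y1' \<in> Y" "y \<in> Y" "y' \<in> Y" "q \<in> B" for y1 y1' y y' q
  proof -
    have q: "q \<in> quat u v" using that(5) unfolding spanB by (rule vs.span_base)
    have *: "m * e * q * l * (m * e) = m * q * e"
    proof -
      have "m * e * q * l * (m * e) = m * (e * q) * (l * m) * e" by (simp add: mult.assoc)
      also have "\<dots> = m * (q * e) * e" unfolding e_quat[OF q] lm by simp
      also have "\<dots> = m * q * e" using ee by (simp add: mult.assoc)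
      finally show ?thesis .
    qed
    have "\<sigma> y1 * h (y, y', q) * y1' = (\<sigma> y1 * y) * q * l * (\<sigma> y' * y1')"
      unfolding h_def by (simp add: mult.assoc)
    also have "\<dots> = (if y = y1 \<and> y' = y1' then m * q * e else 0)"
      using YD(2)[OF that(1,3)] YD(2)[OF that(4,2)] * by auto
    finally show ?thesis .
  qed
  have mq0: "m * q * e = 0 \<Longrightarrow> q = 0" if "q \<in> quat u v" for q
  proof -
    assume "m * q * e = 0"
    then have "m * q = 0" using quat_e_eq_0 quat_closed(2)[OF P lin2_quat'[OF m] that] by blast
    then have "l * m * q = 0" by (simp add: mult.assoc)
    then show ?thesis using lm by simp
  qed
  have Pq: "B \<subseteq> quat u v" unfolding spanB by (rule vs.span_superset)
  have P0: "0 \<notin> B"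
  proof
    assume "0 \<in> B"
    then have "vs.dependent B" by (rule vs.dependent_zero)
    then show False using basis(1) by contradiction
  qed
  have inj: "inj_on h ?I"
  proof (rule inj_onI)
    fix t t' assume t: "t \<in> ?I" "t' \<in> ?I" "h t = h t'"
    obtain y y' q where yq: "t = (y, y', q)" "y \<in> Y" "y' \<in> Y" "q \<in> B" using t(1) by blast
    obtain z z' r where zr: "t' = (z, z', r)" "z \<in> Y" "z' \<in> Y" "r \<in> B" using t(2) by blast
    have q: "q \<in> quat u v" and r: "r \<in> quat u v" using yq(4) zr(4) Pq by blast+
    have eq: "m * q * e = (if z = y \<and> z' = y' then m * r * e else 0)"
      using h_eq[OF yq(2,3) yq(2-4)] h_eq[OF yq(2,3) zr(2-4)] t(3) yq(1) zr(1) by simp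
    have "q \<noteq> 0" using yq(4) P0 by blast
    then have "m * q * e \<noteq> 0" using mq0[OF q] by blast
    then have zz: "z = y \<and> z' = y'" using eq by (cases "z = y \<and> z' = y'") simp_all
    have "m * (q + r) * e = 0" using eq zz by (simp add: algebra_simps)
    then have "q + r = 0" using mq0 quat_closed(1)[OF P q r] by blast
    then have "r = q" by (rule add0D)
    then show "t = t'" using yq(1) zr(1) zz by simp
  qed
  have fin: "finite ?I" using finite_Y finB by simp
  have cardI: "card (h ` ?I) = 4 * (card Y * card Y)"
    unfolding card_image[OF inj] card_cartesian_product basis(2) by simp
  have indep: "vs.independent (h ` ?I)"
  proof (rule vs.independent_if_scalars_zero)
    show "finite (h ` ?I)" using fin by simp
    fix g z assume 0: "(\<Sum>z\<in>h ` ?I. emb (g z) * z) = 0" and z: "z \<in> h ` ?I"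
    obtain y1 y1' q1 where z1: "z = h (y1, y1', q1)" "y1 \<in> Y" "y1' \<in> Y" "q1 \<in> B" using z by blast
    let ?c = "\<lambda>q. g (h (y1, y1', q))"
    \<comment> \<open>Sandwiching between \<sigma>(y1) and y1' keeps only the matrix position (y1,
      y1'), where the independence of the quaternion basis applies.\<close>
    have "0 = (\<Sum>t\<in>?I. \<sigma> y1 * (emb (g (h t)) * h t) * y1')"
      using 0 unfolding sum.reindex[OF inj]
      by (simp flip: sum_distrib_left sum_distrib_right)
    also have "\<dots> = (\<Sum>t\<in>?I. if t \<in> {y1} \<times> {y1'} \<times> B then emb (?c (snd (snd t))) * (m * snd (snd t) * e) else 0)"
    proof (intro sum.cong refl)
      fix t assume "t \<in> ?I"
      then obtain y y' q where t: "t = (y, y', q)" "y \<in> Y" "y' \<in> Y" "q \<in> B" by blast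
      have "\<sigma> y1 * (emb (g (h t)) * h t) * y1' = emb (g (h t)) * (\<sigma> y1 * h t * y1')"
        by (simp add: emb_left[of "\<sigma> y1"] mult.assoc)
      also have "\<dots> = emb (g (h t)) * (if y = y1 \<and> y' = y1' then m * q * e else 0)"
        unfolding t(1) h_eq[OF z1(2,3) t(2-4)] ..
      finally show "\<sigma> y1 * (emb (g (h t)) * h t) * y1' =
          (if t \<in> {y1} \<times> {y1'} \<times> B then emb (?c (snd (snd t))) * (m * snd (snd t) * e) else 0)"
        using t by (cases "y = y1 \<and> y' = y1'") auto
    qed
    also have "\<dots> = (\<Sum>t\<in>{y1} \<times> {y1'} \<times> B. emb (?c (snd (snd t))) * (m * snd (snd t) * e))"
      using z1(2,3) fin by (subst sum.inter_filter[symmetric], simp) (rule sum.cong, auto)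
    also have "\<dots> = (\<Sum>q\<in>B. emb (?c q) * (m * q * e))"
      by (rule sum.reindex_bij_witness[of _ "\<lambda>q. (y1, y1', q)" "\<lambda>t. snd (snd t)"]) auto
    also have "\<dots> = m * (\<Sum>q\<in>B. emb (?c q) * q) * e"
      unfolding sum_distrib_left sum_distrib_right
      by (intro sum.cong refl) (simp add: emb_left[of m] mult.assoc)
    finally have "m * (\<Sum>q\<in>B. emb (?c q) * q) * e = 0" by simp
    moreover have "(\<Sum>q\<in>B. emb (?c q) * q) \<in> quat u v"
      unfolding spanB by (intro vs.span_sum vs.span_scale vs.span_base)
    ultimately have "(\<Sum>q\<in>B. emb (?c q) * q) = 0" using mq0 by blast
    then have "?c q1 = 0" using vs.independentD[OF basis(1) finB _ _ z1(4), of ?c] by simp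
    then show "g z = 0" using z1(1) by simp
  qed
  have "z \<in> vs.span (h ` ?I)" for z
  proof -
    have "z = (\<Sum>y\<in>Y. y * l * \<sigma> y) * z * (\<Sum>y'\<in>Y. y' * l * \<sigma> y')" using complete by simp
    also have "\<dots> = (\<Sum>y'\<in>Y. \<Sum>y\<in>Y. y * l * \<sigma> y * z * (y' * l * \<sigma> y'))"
      by (simp only: sum_distrib_left sum_distrib_right)
    finally have z: "z = (\<Sum>y'\<in>Y. \<Sum>y\<in>Y. y * l * \<sigma> y * z * (y' * l * \<sigma> y'))" .
    have summand: "y * l * \<sigma> y * z * (y' * l * \<sigma> y') \<in> vs.span (h ` ?I)" if y: "y \<in> Y" "y' \<in> Y" for y y'
    proof -
      have "e * (\<sigma> y * z * y') * e = \<sigma> y * z * y'"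
        using V0D(1)[OF YD(1)[OF y(2)]] V0_inv(1)[OF YD(1)[OF y(1)]] by (metis mult.assoc)
      then obtain q where q: "q \<in> quat u v" "\<sigma> y * z * y' = q * e" using eze[of "\<sigma> y * z * y'"] by auto
      have "y * l * \<sigma> y * z * (y' * l * \<sigma> y') = y * l * (\<sigma> y * z * y') * l * \<sigma> y'"
        by (simp add: mult.assoc)
      also have "\<dots> = y * l * (e * q * l * \<sigma> y')" unfolding q(2) e_quat[OF q(1), symmetric] by (simp add: mult.assoc)
      also have "\<dots> = y * (l * q) * l * \<sigma> y'" unfolding e_l_Y[OF y(2) q(1)] by (simp add: mult.assoc)
      finally have eq: "y * l * \<sigma> y * z * (y' * l * \<sigma> y') = y * (l * q) * l * \<sigma> y'" .
      have "l * q \<in> vs.span B" using quat_closed(2)[OF P lin2_quat'[OF l] q(1)] unfolding spanB .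
      then have "y * (l * q) * l * \<sigma> y' \<in> vs.span (h ` ?I)"
      proof (induction rule: vs.span_induct_alt)
        case base then show ?case by (simp add: vs.span_zero)
      next
        case (step c1 q1 q2)
        have "h (y, y', q1) \<in> vs.span (h ` ?I)" using step(1) y by (intro vs.span_base) blast
        then have "emb c1 * h (y, y', q1) + y * q2 * l * \<sigma> y' \<in> vs.span (h ` ?I)"
          using step(2) by (intro vs.span_add vs.span_scale)
        then show ?case unfolding h_def by (simp add: algebra_simps emb_left[of y])
      qed
      then show ?thesis unfolding eq .
    qed
    show ?thesis by (subst z) (intro vs.span_sum summand)
  qed
  then have "UNIV \<subseteq> vs.span (h ` ?I)" by blast
  then have "\<not> card (h ` ?I) < 4 ^ n"
    using fdim_not_subset[OF fdim, of "h ` ?I"] fin by blast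
  moreover have "card (h ` ?I) \<le> 4 ^ n"
    using fdim_indep_card[OF fdim indep] by simp
  ultimately have card: "4 * (card Y * card Y) = 4 ^ n" using cardI by simp
  show "0 < n"
  proof (rule ccontr)
    assume "\<not> 0 < n"
    then show False using card by simp
  qed
  then have "(4::nat) ^ n = 4 * (2 ^ (n - 1) * 2 ^ (n - 1))"
    by (cases n) (simp_all flip: power_mult_distrib)
  then have "card Y ^ 2 = (2 ^ (n - 1)) ^ 2" using card by (simp add: power2_eq_square)
  then show "card Y = 2 ^ (n - 1)" by (simp add: power2_eq_iff_nonneg)
qed

text \<open>Indexing Y by the subsets of a set with n - 1 elements lets the elementary abelian 2-group of
  those subsets act regularly on Y; together with F(x) it spans an inseparable subalgebra.\<close>

lemma inseparable_subalgebra: "\<exists>S. insep_subalg emb \<sigma> n S \<and> x \<in> S"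
proof -
  define J where "J = {..<n - 1}"
  have finJ: "finite (Pow J)" unfolding J_def by simp
  have "card (Pow J) = card Y" unfolding J_def card_Y(2) by (simp add: card_Pow)
  from finite_same_card_bij[OF finJ finite_Y this]
  obtain g where g: "bij_betw g (Pow J) Y" by (rule exE)
  have gY: "g I \<in> Y" if "I \<in> Pow J" for I using g that by (rule bij_betwE[THEN bspec])
  have gV: "g I \<in> V0" if "I \<in> Pow J" for I using YD(1) gY[OF that] by blast
  have inj: "inj_on g (Pow J)" and img: "g ` Pow J = Y" using g unfolding bij_betw_def by blast+
  have gg: "\<sigma> (g I) * g I' = (if I = I' then m * e else 0)" if "I \<in> Pow J" "I' \<in> Pow J" for I I'
    using YD(2)[OF gY[OF that(1)] gY[OF that(2)]] inj_on_eq_iff[OF inj that] by simp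
  have sd: "sym_diff I D \<in> Pow J" if "I \<in> Pow J" "D \<in> Pow J" for I D using that by blast
  have sum_Y: "(\<Sum>y\<in>Y. h y) = (\<Sum>I\<in>Pow J. h (g I))" for h :: "'a \<Rightarrow> 'a"
    using sum.reindex[OF inj, of h] unfolding img by simp
  have sep: "z = z'" if "\<And>I. I \<in> Pow J \<Longrightarrow> z * g I = z' * g I" for z z'
    using Y_separates[of z z'] that img by blast

  \<comment> \<open>The permutation matrix of g I -> g (I + D), with + the symmetric difference.
    Each D is its own inverse, so the matrix is symmetric.\<close>
  define T where "T D = (\<Sum>I\<in>Pow J. g (sym_diff I D) * l * \<sigma> (g I))" for D
  have T_g: "T D * g I = g (sym_diff I D)" if D: "D \<in> Pow J" and I: "I \<in> Pow J" for D I
  proof -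
    have "T D * g I = (\<Sum>K\<in>Pow J. g (sym_diff K D) * l * (\<sigma> (g K) * g I))"
      unfolding T_def by (simp add: sum_distrib_right mult.assoc)
    also have "\<dots> = (\<Sum>K\<in>Pow J. if K = I then g (sym_diff I D) * l * (m * e) else 0)"
      by (intro sum.cong refl) (simp add: gg[OF _ I])
    also have "\<dots> = g (sym_diff I D) * l * (m * e)" using I finJ by simp
    also have "\<dots> = g (sym_diff I D) * (l * m) * e" by (simp add: mult.assoc)
    also have "\<dots> = g (sym_diff I D)" unfolding lm using V0D(1)[OF gV[OF sd[OF I D]]] by simp
    finally show ?thesis .
  qed
  have T_inv: "\<sigma> (T D) = T D" if D: "D \<in> Pow J" for D
  proof -
    have "\<sigma> (T D) = (\<Sum>I\<in>Pow J. g I * l * \<sigma> (g (sym_diff I D)))"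
      unfolding T_def using lin2_sym[OF l] by (simp add: inv_sum inv_mult mult.assoc)
    also have "\<dots> = T D"
      unfolding T_def
    proof (rule sum.reindex_bij_witness[of _ "\<lambda>I. sym_diff I D" "\<lambda>I. sym_diff I D"])
      fix I assume I: "I \<in> Pow J"
      have II: "sym_diff (sym_diff I D) D = I" by blast
      show "sym_diff (sym_diff I D) D = I" "sym_diff (sym_diff I D) D = I" by (rule II)+
      show "sym_diff I D \<in> Pow J" "sym_diff I D \<in> Pow J" using sd[OF I D] by blast+
      show "g (sym_diff (sym_diff I D) D) * l * \<sigma> (g (sym_diff I D)) = g I * l * \<sigma> (g (sym_diff I D))"
        unfolding II ..
    qed
    finally show ?thesis .
  qed
  have T_mult: "T D * T D' = T (sym_diff D D')" if D: "D \<in> Pow J" "D' \<in> Pow J" for D D'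
  proof (rule sep)
    fix I assume I: "I \<in> Pow J"
    have eq: "sym_diff (sym_diff I D') D = sym_diff I (sym_diff D D')" by blast
    show "T D * T D' * g I = T (sym_diff D D') * g I"
      unfolding mult.assoc T_g[OF D(2) I] T_g[OF D(1) sd[OF I D(2)]] T_g[OF sd[OF D] I] eq ..
  qed
  have T_0: "T {} = 1"
  proof (rule sep)
    fix I assume I: "I \<in> Pow J"
    show "T {} * g I = 1 * g I" using T_g[OF _ I, of "{}"] by simp
  qed
  have T_x: "T D * x = x * T D" if D: "D \<in> Pow J" for D
  proof (rule sep)
    fix I assume I: "I \<in> Pow J"
    have "T D * x * g I = T D * g I * w" using V0D(2)[OF gV[OF I]] by (simp add: mult.assoc)
    also have "\<dots> = x * g (sym_diff I D)"
      unfolding T_g[OF D I] using V0D(2)[OF gV[OF sd[OF I D]]] by simp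
    also have "\<dots> = x * T D * g I" using T_g[OF D I] by (simp add: mult.assoc)
    finally show "T D * x * g I = x * T D * g I" .
  qed
  have sd_comm: "sym_diff D D' = sym_diff D' D" for D D' :: "nat set" by blast

  define h where "h = (\<lambda>(D, i). (if i then x else 1) * T D)"
  define X where "X = h ` (Pow J \<times> (UNIV :: bool set))"
  define S where "S = vs.span X"
  have X_cases: "\<exists>D i. D \<in> Pow J \<and> z = h (D, i)" if "z \<in> X" for z
    using that unfolding X_def by blast
  have hX: "h (D, i) \<in> S" if "D \<in> Pow J" for D i
    unfolding S_def X_def using that by (intro vs.span_base) simp
  have TS: "T D \<in> S" "x * T D \<in> S" if "D \<in> Pow J" for D
    using hX[OF that, of False] hX[OF that, of True] unfolding h_def by simp_all
  have xS: "x \<in> S" using TS(2)[of "{}"] T_0 by simp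
  have embS: "emb p \<in> S" for p
    using TS(1)[of "{}"] T_0 vs.span_scale[of 1 X p] unfolding S_def by simp
  have xx: "x * x = emb (c * c + d * d * a)" by (rule x_sq)
  have h_mult: "h (D, i) * h (D', j) \<in> S" "h (D, i) * h (D', j) = h (D', j) * h (D, i)"
    if D: "D \<in> Pow J" "D' \<in> Pow J" for D D' i j
  proof -
    let ?x = "\<lambda>i. if i then x else 1"
    have xc: "T D * ?x j = ?x j * T D" if "D \<in> Pow J" for D j using T_x[OF that] by simp
    have "h (D, i) * h (D', j) = ?x i * (T D * ?x j) * T D'"
      unfolding h_def by (simp add: mult.assoc)
    also have "\<dots> = ?x i * ?x j * T (sym_diff D D')"
      unfolding xc[OF D(1)] T_mult[OF D, symmetric] by (simp add: mult.assoc)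
    finally have 1: "h (D, i) * h (D', j) = ?x i * ?x j * T (sym_diff D D')" .
    have "h (D', j) * h (D, i) = ?x j * (T D' * ?x i) * T D"
      unfolding h_def by (simp add: mult.assoc)
    also have "\<dots> = ?x j * ?x i * T (sym_diff D' D)"
      unfolding xc[OF D(2)] T_mult[OF D(2,1), symmetric] by (simp add: mult.assoc)
    also have "\<dots> = ?x i * ?x j * T (sym_diff D D')"
      unfolding sd_comm[of D' D] by simp
    finally show "h (D, i) * h (D', j) = h (D', j) * h (D, i)" using 1 by simp
    have TD: "T (sym_diff D D') \<in> S" "x * T (sym_diff D D') \<in> S" using TS[OF sd[OF D]] by blast+
    have "emb (c * c + d * d * a) * T (sym_diff D D') \<in> S"
      using TD(1) vs.span_scale unfolding S_def by blast
    then have "x * x * T (sym_diff D D') \<in> S" unfolding xx .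
    then show "h (D, i) * h (D', j) \<in> S" unfolding 1 using TD by (cases i; cases j) simp_all
  qed
  have S_mult: "z * z' \<in> S" if z: "z \<in> S" and z': "z' \<in> S" for z z'
    using z unfolding S_def
  proof (induction rule: vs.span_induct_alt)
    case base then show ?case by (simp add: vs.span_zero)
  next
    case (step p y r)
    have "y * z' \<in> vs.span X"
      using z' unfolding S_def
    proof (induction rule: vs.span_induct_alt)
      case base then show ?case by (simp add: vs.span_zero)
    next
      case (step p' y' r')
      have "y * y' \<in> vs.span X"
        using h_mult(1) X_cases[OF \<open>y \<in> X\<close>] X_cases[OF \<open>y' \<in> X\<close>] unfolding S_def by metis
      then have "emb p' * (y * y') + y * r' \<in> vs.span X"
        using step(2) by (intro vs.span_add vs.span_scale)
      then show ?case by (simp add: distrib_left emb_left[of y])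
    qed
    then have "emb p * (y * z') + r * z' \<in> vs.span X"
      using step(2) by (intro vs.span_add vs.span_scale)
    then show ?case by (simp add: distrib_right mult.assoc)
  qed
  have X_comm: "y * y' = y' * y" if "y \<in> X" "y' \<in> X" for y y'
    using h_mult(2) X_cases[OF that(1)] X_cases[OF that(2)] by metis
  have S_comm: "z * z' = z' * z" if "z \<in> S" "z' \<in> S" for z z'
  proof -
    have "z' * y = y * z'" if "y \<in> X" for y
      using commutes_span[of X y z'] X_comm[OF _ that] \<open>z' \<in> S\<close> unfolding S_def by blast
    then show ?thesis using commutes_span[of X z' z] that(1) unfolding S_def by metis
  qed
  have sub: "subalg emb S"
    unfolding subalg_def using embS S_mult unfolding S_def by (auto intro: vs.span_add)
  note cl = subalg_closed[OF sub]

  have Sym: "S \<subseteq> Sym_plus emb \<sigma>"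
  proof
    fix z assume "z \<in> S"
    then have "z \<in> S \<and> \<sigma> z = z \<and> z * z \<in> range emb"
      unfolding S_def
    proof (induction rule: vs.span_induct_alt)
      case base
      have "0 = emb 0" by simp
      then show ?case by (auto simp: vs.span_zero)
    next
      case (step p y r)
      obtain D i where D: "D \<in> Pow J" "y = h (D, i)" using X_cases[OF step(1)] by blast
      have y_sym: "\<sigma> y = y"
        unfolding D(2) h_def using T_inv[OF D(1)] T_x[OF D(1)] x_sym by (simp add: inv_mult)
      have TT: "T D * T D = 1" using T_mult[OF D(1) D(1)] T_0 by simp
      have yy: "y * y \<in> range emb"
      proof (cases i)
        case True
        have "y * y = x * (T D * x) * T D" unfolding D(2) h_def using True by (simp add: mult.assoc)
        also have "\<dots> = x * x * (T D * T D)" unfolding T_x[OF D(1)] by (simp add: mult.assoc)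
        also have "\<dots> = emb (c * c + d * d * a)" unfolding TT xx by simp
        finally show ?thesis by blast
      next
        case False
        then have "y * y = emb 1" unfolding D(2) h_def using TT by simp
        then show ?thesis by blast
      qed
      have yS: "y \<in> S" using hX[OF D(1)] D(2) by simp
      have rS: "r \<in> S" using step(2) unfolding S_def by blast
      obtain m1 m2 where mm: "y * y = emb m1" "r * r = emb m2" using yy step(2) by blast
      have "(emb p * y + r) * (emb p * y + r) = (emb p * y) * (emb p * y) + r * r"
        by (rule sq_add_a[OF S_comm[OF cl(5)[OF cl(1) yS] rS]])
      also have "(emb p * y) * (emb p * y) = emb (p * p) * (y * y)"
        by (simp add: emb_left[of y] emb_mult_assoc mult.assoc)
      finally have "(emb p * y + r) * (emb p * y + r) = emb (p * p * m1 + m2)"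
        unfolding mm by (simp add: emb_add emb_mult)
      moreover have "\<sigma> (emb p * y + r) = emb p * y + r"
        using y_sym step(2) by (simp add: inv_add inv_scale)
      moreover have "emb p * y + r \<in> vs.span X" using cl(4)[OF cl(5)[OF cl(1) yS] rS] unfolding S_def .
      ultimately show ?case by blast
    qed
    then show "z \<in> Sym_plus emb \<sigma>" unfolding Sym_plus_def by blast
  qed

  \<comment> \<open>Evaluation at g {} reduces questions about S to coordinates in
    \<open>V0\<close>: the elements \<open>h (D, i)\<close> go to g D and g D w, an F-basis of
    \<open>V0\<close> because 1 and w span F(u).\<close>
  have act: "h (D, i) * g {} = g D * (if i then w else 1)" if D: "D \<in> Pow J" for D i
  proof -
    have "T D * g {} = g D" using T_g[OF D, of "{}"] by simp
    then show ?thesis unfolding h_def using V0D(2)[OF gV[OF D]] by (cases i) (simp_all add: mult.assoc)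
  qed
  have zero: "p = 0 \<and> q = 0" if "emb p + emb q * w = 0" for p q
  proof -
    have "emb (p + q * c) + emb (q * d) * u = emb 0 + emb 0 * u"
      using that unfolding w_def by (simp add: emb_simps)
    then have "p + q * c = 0 \<and> q * d = 0" unfolding lin2_eq_iff .
    then show ?thesis using d0 by auto
  qed
  have coef: "f (D, False) = 0 \<and> f (D, True) = 0"
    if f: "(\<Sum>t\<in>Pow J \<times> UNIV. emb (f t) * h t) = 0" and D: "D \<in> Pow J" for f D
  proof -
    let ?r = "\<lambda>D. emb (f (D, False)) + emb (f (D, True)) * w"
    have "0 = (\<Sum>t\<in>Pow J \<times> UNIV. emb (f t) * h t) * g {}" unfolding f by simp
    also have "\<dots> = (\<Sum>I\<in>Pow J. \<Sum>i\<in>UNIV. emb (f (I, i)) * (h (I, i) * g {}))"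
      unfolding sum.cartesian_product sum_distrib_right by (simp add: mult.assoc case_prod_unfold)
    also have "\<dots> = (\<Sum>I\<in>Pow J. g I * ?r I)"
      by (intro sum.cong refl) (simp add: act UNIV_bool distrib_left emb_left mult.assoc)
    also have "\<dots> = (\<Sum>y\<in>Y. y * ?r (the_inv_into (Pow J) g y))"
      unfolding sum_Y by (intro sum.cong refl) (simp add: the_inv_into_f_f[OF inj])
    finally have "(\<Sum>y\<in>Y. y * ?r (the_inv_into (Pow J) g y)) = 0" by simp
    then have "?r (the_inv_into (Pow J) g (g D)) = 0"
      by (rule Y_coefficients[rotated]) (intro gY[OF D] lin2_add lin2_scale w_lin2 lin2_emb)+
    then show ?thesis unfolding the_inv_into_f_f[OF inj D] by (rule zero)
  qed
  have h_inj: "inj_on h (Pow J \<times> UNIV)"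
  proof (rule inj_onI)
    fix t t' assume t: "t \<in> Pow J \<times> UNIV" "t' \<in> Pow J \<times> (UNIV :: bool set)" "h t = h t'"
    show "t = t'"
    proof (rule ccontr)
      assume ne: "t \<noteq> t'"
      \<comment> \<open>A repeated value of h would be a linear relation with both coefficients
        1.\<close>
      let ?f = "\<lambda>r. if r = t \<or> r = t' then 1 else (0::'f)"
      have "(\<Sum>r\<in>Pow J \<times> UNIV. emb (?f r) * h r) = (\<Sum>r\<in>{t, t'}. emb (?f r) * h r)"
        using t(1,2) finJ by (intro sum.mono_neutral_right) auto
      also have "\<dots> = 0" using ne t(3) by simp
      finally have "?f (fst t, False) = 0 \<and> ?f (fst t, True) = 0"
        by (rule coef) (use t(1) in auto)
      then show False by (cases t; cases "snd t") auto
    qed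
  qed
  have dim: "has_fdim emb S (2 ^ n)"
    unfolding has_fdim_def
  proof (intro exI conjI)
    show fin: "finite X" unfolding X_def using finJ by simp
    show "X \<subseteq> S" unfolding S_def by (rule vs.span_superset)
    show "vs.span X = S" by (simp add: S_def)
    have "card X = 2 ^ (n - 1) * 2"
      unfolding X_def card_image[OF h_inj] card_cartesian_product
      by (simp add: J_def card_Pow)
    then show "card X = 2 ^ n" using card_Y(1) by (cases n) simp_all
    show "vs.independent X"
    proof (rule vs.independent_if_scalars_zero[OF fin])
      fix f z assume f: "(\<Sum>z\<in>X. emb (f z) * z) = 0" and z: "z \<in> X"
      obtain D i where D: "D \<in> Pow J" "z = h (D, i)" using X_cases[OF z] by blast
      have "(\<Sum>t\<in>Pow J \<times> UNIV. emb (f (h t)) * h t) = 0"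
        using f unfolding X_def sum.reindex[OF h_inj] by simp
      from coef[OF this D(1)] show "f z = 0" unfolding D(2) by (cases i) simp_all
    qed
  qed

  have cent: "centralizer UNIV S = S"
  proof
    show "S \<subseteq> centralizer UNIV S" unfolding centralizer_def using S_comm by blast
    show "centralizer UNIV S \<subseteq> S"
    proof
      fix z assume "z \<in> centralizer UNIV S"
      then have z: "z * s = s * z" if "s \<in> S" for s using that unfolding centralizer_def by blast
      \<comment> \<open>At g {} the element z agrees with some s0 in S. Both commute with every T I,
        and T I g {} = g I, so they agree on all of Y.\<close>
      have zV: "z * g {} \<in> V0" using V0_left[OF gV z[OF xS]] by simp
      obtain r where r: "\<And>y. r y \<in> lin2 u" "z * g {} = (\<Sum>y\<in>Y. y * r y)" using Y_expand[OF zV] by blast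
      have "\<exists>s\<in>S. s * g {} = g D * r (g D)" if D: "D \<in> Pow J" for D
      proof -
        obtain p q where pq: "r (g D) = emb p + emb q * u" using r(1)[of "g D"] unfolding lin2_def by blast
        \<comment> \<open>The basis 1, u is exchanged for 1, w by u = (w + c) / d.\<close>
        have rw: "r (g D) = emb (p + q / d * c) + emb (q / d) * w"
          unfolding pq w_def using d0 by (simp add: emb_simps)
        let ?s = "emb (p + q / d * c) * h (D, False) + emb (q / d) * h (D, True)"
        have "?s \<in> S" using hX[OF D] by (intro cl)
        moreover have "?s * g {} = g D * r (g D)"
          unfolding rw by (simp add: distrib_right distrib_left mult.assoc act[OF D] emb_left[of "g D"])
        ultimately show ?thesis by blast
      qed
      then obtain s where s: "\<And>D. D \<in> Pow J \<Longrightarrow> s D \<in> S" "\<And>D. D \<in> Pow J \<Longrightarrow> s D * g {} = g D * r (g D)"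
        by metis
      define s0 where "s0 = (\<Sum>D\<in>Pow J. s D)"
      have s0: "s0 \<in> S" unfolding s0_def using s(1) unfolding S_def by (intro vs.span_sum)
      have "s0 * g {} = (\<Sum>D\<in>Pow J. g D * r (g D))"
        unfolding s0_def sum_distrib_right by (intro sum.cong refl s(2))
      then have eq: "z * g {} = s0 * g {}" unfolding r(2) sum_Y by simp
      have "z = s0"
      proof (rule sep)
        fix I assume I: "I \<in> Pow J"
        have "T I * g {} = g I" using T_g[OF I, of "{}"] by simp
        then have "z * g I = z * T I * g {}" by (simp add: mult.assoc)
        also have "\<dots> = T I * (s0 * g {})" unfolding z[OF TS(1)[OF I]] using eq by (simp add: mult.assoc)
        also have "\<dots> = s0 * T I * g {}" unfolding S_comm[OF s0 TS(1)[OF I]] by (simp add: mult.assoc)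
        also have "\<dots> = s0 * g I" using \<open>T I * g {} = g I\<close> by (simp add: mult.assoc)
        finally show "z * g I = s0 * g I" .
      qed
      then show "z \<in> S" using s0 by simp
    qed
  qed

  \<comment> \<open>The singletons give n - 1 generators; the last index is left for x and exists
    because n > 0.\<close>
  define G where "G i = (if i < n - 1 then T {i} else x)" for i
  have gen: "S = gen_subalg emb (G ` {..<n})"
  proof
    have "G ` {..<n} \<subseteq> S" unfolding G_def using TS(1) xS by (auto simp: J_def)
    then show "gen_subalg emb (G ` {..<n}) \<subseteq> S" unfolding gen_subalg_def using sub by blast
    show "S \<subseteq> gen_subalg emb (G ` {..<n})"
      unfolding gen_subalg_def
    proof (rule Inter_greatest)
      fix B assume "B \<in> {B. subalg emb B \<and> G ` {..<n} \<subseteq> B}"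
      then have B: "subalg emb B" "G ` {..<n} \<subseteq> B" by blast+
      note clB = subalg_closed[OF B(1)]
      have "G (n - 1) \<in> B" using B(2) card_Y(1) by auto
      then have xB: "x \<in> B" unfolding G_def by simp
      have Ti: "T {i} \<in> B" if "i \<in> J" for i
      proof -
        have "G i \<in> B" using B(2) that unfolding J_def by auto
        then show ?thesis using that unfolding G_def J_def by simp
      qed
      have "T D \<in> B" if "D \<in> Pow J" for D
      proof -
        have "finite D" using that finite_subset[of D J] unfolding J_def by auto
        then show ?thesis using that
        proof (induction D rule: finite_induct)
          case empty then show ?case using clB(2) T_0 by simp
        next
          case (insert i D)
          have "sym_diff {i} D = insert i D" using insert.hyps by blast
          then have "T (insert i D) = T {i} * T D" using T_mult[of "{i}" D] insert.prems by simp
          then show ?case using clB(5)[OF Ti] insert by simp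
        qed
      qed
      then have "h (D, i) \<in> B" if "D \<in> Pow J" for D i
        unfolding h_def using that xB clB(5)[OF xB] by simp
      then have "X \<subseteq> B" using X_cases by blast
      moreover have "vs.subspace B" unfolding vs.subspace_def using clB by blast
      ultimately show "S \<subseteq> B" unfolding S_def by (rule vs.span_minimal)
    qed
  qed
  have "insep_subalg emb \<sigma> n S"
    unfolding insep_subalg_def using sub dim Sym cent gen by blast
  then show ?thesis using xS by blast
qed

end

section \<open>Both kinds of subalgebra from one square class, and the equivalence\<close>

context corner_square
begin

lemma quaternion_and_inseparable:
  assumes one_square_class
  shows "\<exists>Q. quat_subalg emb Q \<and> \<sigma> ` Q \<subseteq> Q \<and> x \<in> Q"
    and "\<exists>S. insep_subalg emb \<sigma> n S \<and> x \<in> S"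
proof -
  obtain m where m: "m \<in> lin2 u" "m \<noteq> 0" "\<And>y. y \<in> V0 \<Longrightarrow> \<exists>k\<in>lin2 u. \<sigma> y * y = k * k * m * e"
    using assms unfolding one_square_class_def by blast
  obtain l where l: "l \<in> lin2 u" "l * m = 1" "m * l = 1" using lin2_inverse[OF m(1,2)] by blast
  interpret corner_scaled emb \<sigma> n a b u v e x c d m l
    by unfold_locales (use m l in auto)
  obtain Y where Y: "orthonormal Y" "finite Y" "(\<Sum>y\<in>Y. y * l * \<sigma> y) = 1"
    by (rule complete_orthonormal)
  interpret corner_basis emb \<sigma> n a b u v e x c d m l Y
    by unfold_locales (use Y in auto)
  show "\<exists>Q. quat_subalg emb Q \<and> \<sigma> ` Q \<subseteq> Q \<and> x \<in> Q" using invariant_quaternion by blast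
  show "\<exists>S. insep_subalg emb \<sigma> n S \<and> x \<in> S" by (rule inseparable_subalgebra)
qed

end

theorem theorem5p10:
  fixes emb :: "'f::field \<Rightarrow> 'a::ring_1" and \<sigma> :: "'a \<Rightarrow> 'a" and n :: nat and x :: 'a
  assumes char2: "CHAR('f) = 2"
    and alg: "f_algebra emb"
    and csa_A: "csa emb UNIV (4 ^ n)"
    and inv: "involution1 emb \<sigma>"
    and orth: "orthogonal_on UNIV \<sigma>"
    and td: "totally_decomposable emb \<sigma> n"
    and x_sym: "x \<in> Sym_plus emb \<sigma>"
    and x_nsq: "x * x \<notin> {emb (c * c) | c. True}"
    and idx: "alg_pf_index emb \<sigma> n (n - 1)"
  shows "(\<exists>Q. quat_subalg emb Q \<and> \<sigma> ` Q \<subseteq> Q \<and> x \<in> Q) \<longleftrightarrow>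
         (\<exists>S. insep_subalg emb \<sigma> n S \<and> x \<in> S)"
proof -
  interpret char2_algebra emb \<sigma> by unfold_locales (rule char2 alg inv)+
  have orth': "1 \<notin> Alt UNIV \<sigma>" using orth unfolding orthogonal_on_def .
  have cent: "centralizer UNIV UNIV = range emb" using csa_A unfolding csa_def by (elim conjE) assumption
  have xs: "\<sigma> x = x" and x2: "x * x \<in> range emb" using x_sym unfolding Sym_plus_def by auto
  have xF: "x \<notin> range emb"
  proof
    assume "x \<in> range emb"
    then obtain p where "x = emb p" by blast
    then have "x * x = emb (p * p)" by (simp add: emb_mult)
    then show False using x_nsq by blast
  qed
  obtain Qs \<alpha> where td': "tot_decomp emb \<sigma> n Qs"
    and disc: "\<And>i. i < n \<Longrightarrow> disc_rep emb (Qs i) \<sigma> (\<alpha> i)"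
    and pf: "pf_index (map \<alpha> [0..<n]) (n - 1)"
    using idx unfolding alg_pf_index_def by blast
  \<comment> \<open>For n = 0 the algebra is F and has no such x. With n positive, the truncated
    difference n - 1 really is one less than the number of slots.\<close>
  have n: "n \<noteq> 0"
  proof
    assume "n = 0"
    then have "vs.span {1} = UNIV" using td' unfolding tot_decomp_def by simp
    then show False using xF unfolding span_1 by simp
  qed
  obtain b0 U0 V0 where F0: "frame n \<alpha> b0 U0 V0"
    using frame_of_decomposition[OF orth' td' disc] by blast
  obtain k where k: "k < n" "\<And>c. \<alpha> k \<noteq> c * c"
    "\<And>i. i < n \<Longrightarrow> \<exists>c d. \<alpha> i = c * c + d * d * \<alpha> k"
  proof -
    have "length (map \<alpha> [0..<n]) = Suc (n - 1)" using n by simp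
    from pf_index_corank_one[OF pf this] obtain k where k: "k < length (map \<alpha> [0..<n])"
      "\<And>c. map \<alpha> [0..<n] ! k \<noteq> c * c"
      "\<And>i. i < length (map \<alpha> [0..<n]) \<Longrightarrow>
        \<exists>c d. map \<alpha> [0..<n] ! i = c * c + d * d * map \<alpha> [0..<n] ! k" by metis
    show thesis by (rule that[of k]) (use k in auto)
  qed
  obtain \<alpha>' b U V where F: "frame n \<alpha>' b U V" and ns: "\<And>c. \<alpha>' k \<noteq> c * c"
    and one: "\<And>i. i < n \<Longrightarrow> i \<noteq> k \<Longrightarrow> \<alpha>' i = 1 \<and> b i = 0"
    using frame_normalize[OF F0 k, of n] by blast
  obtain e where C: "corner (\<alpha>' k) (b k) (U k) (V k) e"
    using corner_of_frame[OF F k(1) one cent] by blast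
  interpret ca: corner_algebra emb \<sigma> n "\<alpha>' k" "b k" "U k" "V k" e
    by unfold_locales (rule csa_A C ns)+
  \<comment> \<open>Here c + d u is a square root of x^2 in F(u); d = 0 would put x^2 in
    F^2.\<close>
  have "\<exists>c d. d \<noteq> 0 \<and> x * x = emb (c * c + d * d * \<alpha>' k)"
  proof -
    obtain N where N: "x * x = emb N" using x2 by blast
    obtain c d where cd: "N = c * c + d * d * \<alpha>' k"
      using ca.symmetric_square[OF xs N] unfolding nsq_def by blast
    have "d \<noteq> 0"
    proof
      assume "d = 0"
      then have "x * x = emb (c * c)" using N cd by simp
      then show False using x_nsq by blast
    qed
    then show ?thesis using N cd by blast
  qed
  then obtain c d where cd: "d \<noteq> 0" "x * x = emb (c * c + d * d * \<alpha>' k)" by blast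
  interpret corner_square emb \<sigma> n "\<alpha>' k" "b k" "U k" "V k" e x c d
    by unfold_locales (rule xs cd)+
  show ?thesis
  proof
    assume "\<exists>Q. quat_subalg emb Q \<and> \<sigma> ` Q \<subseteq> Q \<and> x \<in> Q"
    then obtain Q where Q: "csa emb Q 4" "\<sigma> ` Q \<subseteq> Q" "x \<in> Q" unfolding quat_subalg_def by blast
    obtain p where "x + emb p \<in> Alt UNIV \<sigma>"
      using quat_invariant_alternating[OF Q(1,2) orth' Q(3) xs xF x2] .
    then show "\<exists>S. insep_subalg emb \<sigma> n S \<and> x \<in> S"
      by (intro quaternion_and_inseparable(2) one_square_class_of_alternating)
  next
    assume "\<exists>S. insep_subalg emb \<sigma> n S \<and> x \<in> S"
    then obtain S where "centralizer UNIV S = S" "subalg emb S" "S \<subseteq> Sym_plus emb \<sigma>" "x \<in> S"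
      unfolding insep_subalg_def by blast
    then show "\<exists>Q. quat_subalg emb Q \<and> \<sigma> ` Q \<subseteq> Q \<and> x \<in> Q"
      by (intro quaternion_and_inseparable(1) one_square_class_of_inseparable)
  qed
qed

end
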